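(* Let $(W,\|\cdot\|)$ be a uniformly convex Banach space and let $A_p,B_p\in C(W,W^\ast)$ be potential operators satisfying assumptions $(A_1)$, $(A_2)$, $(B_1)$, $(B_2)$, $(B_3)$ listed in the context. Let $\mathcal M$, $\Psi$ and $\lambda_k$, $k\in\mathbb N$, be as defined in the context. If $\lambda_k<\lambda_{k+1}$, then the sublevel set $\Psi^{\lambda_k}=\{u\in\mathcal M:\Psi(u)\le\lambda_k\}$ has a compact symmetric subset of index $k$ (i.e., a compact symmetric subset $C$ with $i(C)=k$).
   Context: $W^\ast$ is the dual of $W$ and $(\cdot,\cdot)$ the duality pairing. An operator $h\in C(W,W^\ast)$ is a potential operator if there is $H\in C^1(W,\mathbb R)$ with $H'=h$. Assumptions: $(A_1)$ $A_p$ is $(p-1)$-homogeneous and odd for some $p\in(1,\infty)$: $A_p(tu)=|t|^{p-2}t\,A_pu$ for all $u\in W$, $t\in\mathbb R$. $(A_2)$ $(A_pu,v)\le\|u\|^{p-1}\|v\|$ for all $u,v\in W$, and equality holds if and only if $\alpha u=\beta v$ for some $\alpha,\beta\ge0$, not both zero (in particular $(A_pu,u)=\|u\|^p$ for all $u\in W$). $(B_1)$ $B_p$ is $(p-1)$-homogeneous and odd: $B_p(tu)=|t|^{p-2}t\,B_pu$ for all $u\in W$, $t\in\mathbb R$. $(B_2)$ $(B_pu,u)>0$ for all $u\in W\setminus\{0\}$, and $(B_pu,v)\le(B_pu,u)^{(p-1)/p}(B_pv,v)^{1/p}$ for all $u,v\in W$. $(B_3)$ $B_p$ is a compact operator. Set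 $I_p(u)=\frac1p(A_pu,u)=\frac1p\|u\|^p$, $J_p(u)=\frac1p(B_pu,u)$, $\mathcal M=\{u\in W:I_p(u)=1\}$, and $\Psi(u)=1/J_p(u)$ for $u\in\mathcal M$. Let $\mathcal F$ be the class of symmetric subsets of $\mathcal M$ (sets $M$ with $-M=M$), let $\mathcal F_k=\{M\in\mathcal F:i(M)\ge k\}$, and let $$\lambda_k=\inf_{M\in\mathcal F_k}\ \sup_{u\in M}\Psi(u),\qquad k\in\mathbb N$$ (with $\inf\emptyset=+\infty$). $\mathbb Z_2$-cohomological index $i$ (Fadell–Rabinowitz): for a symmetric set $A\subset W\setminus\{0\}$, let $\overline A=A/\mathbb Z_2$ be the quotient of $A$ with each $u$ and $-u$ identified, let $f:\overline A\to\mathbb{RP}^\infty$ be the classifying map, and let $f^\ast:H^\ast(\mathbb{RP}^\infty)\to H^\ast(\overline A)$ be the induced homomorphism of Alexander–Spanier cohomology rings with $\mathbb Z_2$ coefficients. Then $i(A)=0$ if $A=\emptyset$ and $i(A)=\sup\{m\ge1:f^\ast(\omega^{m-1})\ne0\}$ otherwise, where $\omega\in H^1(\mathbb{RP}^\infty)$ generates $H^\ast(\mathbb{RP}^\infty)=\mathbb Z_2[\omega]$. *)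

theory Defs
  imports "HOL-Analysis.Analysis" "HOL-Algebra.QuotRing" "HOL-Library.Z2"
begin

section \<open>Alexander--Spanier cohomology rings with coefficients in the field of two elements\<close>

text \<open>
  An Alexander--Spanier \<open>q\<close>-cochain on \<open>X\<close> is an arbitrary function of \<open>q + 1\<close> points of \<open>X\<close>.
  All degrees are treated at once: a cochain is a function on lists of points, the degree \<open>q\<close>
  part being its restriction to the lists of length \<open>q + 1\<close>, and only finitely many degrees
  occur. Functions are normalised to be \<open>0\<close> outside the nonempty lists of points of \<open>X\<close>.
\<close>

definition as_cochains :: "'a topology \<Rightarrow> ('a list \<Rightarrow> bit) set" where
  "as_cochains X = {\<phi>. (\<forall>xs. \<phi> xs \<noteq> 0 \<longrightarrow> xs \<noteq> [] \<and> set xs \<subseteq> topspace X) \<and>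
                        (\<exists>n. \<forall>xs. \<phi> xs \<noteq> 0 \<longrightarrow> length xs \<le> n)}"

text \<open>
  Cup product: on \<open>(x\<^sub>0, \<dots>, x\<^sub>n)\<close> the sum over \<open>i\<close> of
  \<open>\<phi> (x\<^sub>0, \<dots>, x\<^sub>i) * \<psi> (x\<^sub>i, \<dots>, x\<^sub>n)\<close>.
\<close>

definition as_cup :: "('a list \<Rightarrow> bit) \<Rightarrow> ('a list \<Rightarrow> bit) \<Rightarrow> 'a list \<Rightarrow> bit" where
  "as_cup \<phi> \<psi> xs = (\<Sum>i<length xs. \<phi> (take (Suc i) xs) * \<psi> (drop i xs))"

definition as_coboundary :: "'a topology \<Rightarrow> ('a list \<Rightarrow> bit) \<Rightarrow> 'a list \<Rightarrow> bit" where
  "as_coboundary X \<phi> xs =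
     (if set xs \<subseteq> topspace X then \<Sum>i<length xs. \<phi> (take i xs @ drop (Suc i) xs) else 0)"

definition as_locally_zero :: "'a topology \<Rightarrow> ('a list \<Rightarrow> bit) set" where
  "as_locally_zero X = {\<phi> \<in> as_cochains X.
     \<forall>x \<in> topspace X. \<exists>U. openin X U \<and> x \<in> U \<and> (\<forall>xs. set xs \<subseteq> U \<longrightarrow> \<phi> xs = 0)}"

text \<open>
  The Alexander--Spanier complex is the quotient of the cochains by the locally zero ones. Its
  cohomology is formed in one step, as the cochains whose coboundary is locally zero modulo the
  sums of a coboundary and a locally zero cochain.
\<close>

definition as_cocycle_ring :: "'a topology \<Rightarrow> ('a list \<Rightarrow> bit) ring" where
  "as_cocycle_ring X =
     \<lparr>carrier = {\<phi> \<in> as_cochains X. as_coboundary X \<phi> \<in> as_locally_zero X},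
      mult = as_cup,
      one = (\<lambda>xs. if length xs = 1 \<and> set xs \<subseteq> topspace X then 1 else 0),
      zero = (\<lambda>xs. 0),
      add = (\<lambda>\<phi> \<psi> xs. \<phi> xs + \<psi> xs)\<rparr>"

definition as_boundary_ideal :: "'a topology \<Rightarrow> ('a list \<Rightarrow> bit) set" where
  "as_boundary_ideal X =
     {\<lambda>xs. as_coboundary X \<psi> xs + \<theta> xs | \<psi> \<theta>. \<psi> \<in> as_cochains X \<and> \<theta> \<in> as_locally_zero X}"

definition as_cohomology_ring :: "'a topology \<Rightarrow> ('a list \<Rightarrow> bit) set ring" where
  "as_cohomology_ring X = as_cocycle_ring X Quot as_boundary_ideal X"

definition as_cohomology_group :: "nat \<Rightarrow> 'a topology \<Rightarrow> ('a list \<Rightarrow> bit) set set" where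
  "as_cohomology_group q X = {c \<in> carrier (as_cohomology_ring X).
     \<exists>\<phi> \<in> c. \<forall>xs. \<phi> xs \<noteq> 0 \<longrightarrow> length xs = Suc q}"

definition as_pullback :: "'a topology \<Rightarrow> ('a \<Rightarrow> 'b) \<Rightarrow> ('b list \<Rightarrow> bit) \<Rightarrow> 'a list \<Rightarrow> bit" where
  "as_pullback X f \<phi> xs = (if set xs \<subseteq> topspace X then \<phi> (map f xs) else 0)"

definition as_induced ::
    "'a topology \<Rightarrow> ('a \<Rightarrow> 'b) \<Rightarrow> ('b list \<Rightarrow> bit) set \<Rightarrow> ('a list \<Rightarrow> bit) set" where
  "as_induced X f c =
     (\<Union>\<phi>\<in>c. as_boundary_ideal X +>\<^bsub>as_cocycle_ring X\<^esub> as_pullback X f \<phi>)"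


text \<open>
  The cocycles form a ring, in which the boundaries are an ideal, so that the quotient above is
  a ring.
\<close>

context
  notes add_bit_eq_xor [simp del] mult_bit_eq_and [simp del]
    bit_not_zero_iff [simp del] bit_not_one_iff [simp del]
begin

lemma bit_self_add [simp]: "(a::bit) + a = 0" by (cases a) auto

lemma as_cochainsD:
  assumes "\<phi> \<in> as_cochains X" 
  shows "\<phi> [] = 0" "\<not> set xs \<subseteq> topspace X \<Longrightarrow> \<phi> xs = 0"
  using assms unfolding as_cochains_def by blast+

lemma as_cochainsI:
  assumes "\<phi> [] = 0" "\<And>xs. \<not> set xs \<subseteq> topspace X \<Longrightarrow> \<phi> xs = 0" "\<And>xs. n < length xs \<Longrightarrow> \<phi> xs = 0"
  shows "\<phi> \<in> as_cochains X"
proof -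
  have "xs \<noteq> [] \<and> set xs \<subseteq> topspace X" "length xs \<le> n" if "\<phi> xs \<noteq> 0" for xs
    using that assms(1) assms(2)[of xs] assms(3)[of xs] not_less by fastforce+
  then show ?thesis unfolding as_cochains_def by blast
qed

lemma as_cochains_bound:
  assumes "\<phi> \<in> as_cochains X" obtains n where "\<And>xs. n < length xs \<Longrightarrow> \<phi> xs = 0"
proof -
  obtain n where "\<forall>xs. \<phi> xs \<noteq> 0 \<longrightarrow> length xs \<le> n"
    using assms unfolding as_cochains_def by blast
  then show thesis using that[of n] by (meson not_le)
qed

lemma as_cup_cochain:
  assumes "\<phi> \<in> as_cochains X" "\<psi> \<in> as_cochains X"
  shows "as_cup \<phi> \<psi> \<in> as_cochains X"
proof -
  obtain m where m: "\<And>xs. m < length xs \<Longrightarrow> \<phi> xs = 0" using as_cochains_bound assms(1) by blast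
  obtain n where n: "\<And>xs. n < length xs \<Longrightarrow> \<psi> xs = 0" using as_cochains_bound assms(2) by blast
  show ?thesis
  proof (rule as_cochainsI[where n="m+n"])
    show "as_cup \<phi> \<psi> [] = 0" by (simp add: as_cup_def)
  next
    fix xs assume xs: "\<not> set xs \<subseteq> topspace X"
    have "\<phi> (take (Suc i) xs) * \<psi> (drop i xs) = 0" for i
    proof (rule ccontr)
      assume "\<not> ?thesis"
      then have "set (take (Suc i) xs) \<subseteq> topspace X" "set (drop i xs) \<subseteq> topspace X"
        using as_cochainsD(2)[OF assms(1), of "take (Suc i) xs"] as_cochainsD(2)[OF assms(2), of "drop i xs"] by auto
      moreover have "set (take i xs) \<subseteq> set (take (Suc i) xs)" by (simp add: set_take_subset_set_take)
      moreover have "set xs = set (take i xs) \<union> set (drop i xs)" by (metis append_take_drop_id set_append)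
      ultimately show False using xs by blast
    qed
    then show "as_cup \<phi> \<psi> xs = 0" unfolding as_cup_def by (intro sum.neutral ballI) simp
  next
    fix xs :: "'a list" assume xs: "m + n < length xs"
    have "\<phi> (take (Suc i) xs) * \<psi> (drop i xs) = 0" if "i < length xs" for i
      using m[of "take (Suc i) xs"] n[of "drop i xs"] xs that by (cases "m < Suc i") auto
    then show "as_cup \<phi> \<psi> xs = 0" unfolding as_cup_def by (intro sum.neutral ballI) simp
  qed
qed

lemma as_coboundary_cochain:
  assumes "\<phi> \<in> as_cochains X"
  shows "as_coboundary X \<phi> \<in> as_cochains X"
proof -
  obtain m where m: "\<And>xs. m < length xs \<Longrightarrow> \<phi> xs = 0" using as_cochains_bound assms(1) by blast
  show ?thesis
    by (rule as_cochainsI[where n="Suc m"])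
       (auto simp: as_coboundary_def intro!: sum.neutral m)
qed

lemma as_add_cochain:
  assumes "\<phi> \<in> as_cochains X" "\<psi> \<in> as_cochains X"
  shows "(\<lambda>xs. \<phi> xs + \<psi> xs) \<in> as_cochains X"
proof -
  obtain m where m: "\<And>xs. m < length xs \<Longrightarrow> \<phi> xs = 0" using as_cochains_bound assms(1) by blast
  obtain n where n: "\<And>xs. n < length xs \<Longrightarrow> \<psi> xs = 0" using as_cochains_bound assms(2) by blast
  show ?thesis
    by (rule as_cochainsI[where n="m+n"]) (auto simp: m n as_cochainsD[OF assms(1)] as_cochainsD[OF assms(2)])
qed

lemma as_locally_zeroI:
  assumes "\<phi> \<in> as_cochains X"
  "\<And>x. x \<in> topspace X \<Longrightarrow> \<exists>U. openin X U \<and> x \<in> U \<and> (\<forall>xs. set xs \<subseteq> U \<longrightarrow> \<phi> xs = 0)"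
  shows "\<phi> \<in> as_locally_zero X"
  using assms by (auto simp: as_locally_zero_def)

lemma as_locally_zero_cochain: "\<phi> \<in> as_locally_zero X \<Longrightarrow> \<phi> \<in> as_cochains X"
  by (simp add: as_locally_zero_def)

lemma as_zero_locally_zero: "(\<lambda>xs. 0) \<in> as_locally_zero X"
  by (rule as_locally_zeroI) (auto simp: as_cochains_def)

lemma as_add_locally_zero:
  assumes "\<phi> \<in> as_locally_zero X" "\<psi> \<in> as_locally_zero X"
  shows "(\<lambda>xs. \<phi> xs + \<psi> xs) \<in> as_locally_zero X"
proof (rule as_locally_zeroI)
  show "(\<lambda>xs. \<phi> xs + \<psi> xs) \<in> as_cochains X"
    using assms as_locally_zero_cochain as_add_cochain by blast
  fix x assume "x \<in> topspace X"
  then obtain U V where "openin X U" "x \<in> U" "\<forall>xs. set xs \<subseteq> U \<longrightarrow> \<phi> xs = 0"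
     "openin X V" "x \<in> V" "\<forall>xs. set xs \<subseteq> V \<longrightarrow> \<psi> xs = 0"
    using assms unfolding as_locally_zero_def by blast
  then show "\<exists>U. openin X U \<and> x \<in> U \<and> (\<forall>xs. set xs \<subseteq> U \<longrightarrow> \<phi> xs + \<psi> xs = 0)"
    by (intro exI[of _ "U \<inter> V"]) auto
qed

lemma as_coboundary_locally_zero:
  assumes "\<phi> \<in> as_locally_zero X"
  shows "as_coboundary X \<phi> \<in> as_locally_zero X"
proof (rule as_locally_zeroI)
  show "as_coboundary X \<phi> \<in> as_cochains X"
    using assms as_locally_zero_cochain as_coboundary_cochain by blast
  fix x assume "x \<in> topspace X"
  then obtain U where U: "openin X U" "x \<in> U" "\<forall>xs. set xs \<subseteq> U \<longrightarrow> \<phi> xs = 0"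
    using assms unfolding as_locally_zero_def by blast
  have "as_coboundary X \<phi> xs = 0" if "set xs \<subseteq> U" for xs
  proof -
    have "\<phi> (take i xs @ drop (Suc i) xs) = 0" for i
    proof -
      have "set (take i xs @ drop (Suc i) xs) \<subseteq> U"
        using that set_take_subset[of i xs] set_drop_subset[of "Suc i" xs] by auto
      with U(3) show ?thesis by blast
    qed
    then show ?thesis by (simp add: as_coboundary_def)
  qed
  with U show "\<exists>U. openin X U \<and> x \<in> U \<and> (\<forall>xs. set xs \<subseteq> U \<longrightarrow> as_coboundary X \<phi> xs = 0)"
    by blast
qed

lemma as_cup_locally_zero:
  assumes "\<phi> \<in> as_cochains X" "\<psi> \<in> as_cochains X" "\<phi> \<in> as_locally_zero X \<or> \<psi> \<in> as_locally_zero X"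
  shows "as_cup \<phi> \<psi> \<in> as_locally_zero X"
proof (rule as_locally_zeroI)
  show "as_cup \<phi> \<psi> \<in> as_cochains X"
    using assms as_cup_cochain by blast
  fix x assume "x \<in> topspace X"
  then obtain U where U: "openin X U" "x \<in> U" "(\<forall>xs. set xs \<subseteq> U \<longrightarrow> \<phi> xs = 0) \<or> (\<forall>xs. set xs \<subseteq> U \<longrightarrow> \<psi> xs = 0)"
    using assms unfolding as_locally_zero_def by blast
  have "as_cup \<phi> \<psi> xs = 0" if "set xs \<subseteq> U" for xs
  proof -
    have "\<phi> (take (Suc i) xs) * \<psi> (drop i xs) = 0" for i
    proof -
      have "set (take (Suc i) xs) \<subseteq> U" "set (drop i xs) \<subseteq> U"
        using that set_take_subset[of "Suc i" xs] set_drop_subset[of i xs] by auto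
      with U(3) have "\<phi> (take (Suc i) xs) = 0 \<or> \<psi> (drop i xs) = 0" by blast
      then show ?thesis by (elim disjE) simp_all
    qed
    then show ?thesis unfolding as_cup_def by (intro sum.neutral ballI) simp
  qed
  with U show "\<exists>U. openin X U \<and> x \<in> U \<and> (\<forall>xs. set xs \<subseteq> U \<longrightarrow> as_cup \<phi> \<psi> xs = 0)"
    by blast
qed

lemma as_coboundary_add:
  "as_coboundary X (\<lambda>xs. \<phi> xs + \<psi> xs) = (\<lambda>xs. as_coboundary X \<phi> xs + as_coboundary X \<psi> xs)"
  by (auto simp: as_coboundary_def sum.distrib)

lemma as_cup_add:
  "as_cup (\<lambda>xs. \<phi> xs + \<psi> xs) \<rho> = (\<lambda>xs. as_cup \<phi> \<rho> xs + as_cup \<psi> \<rho> xs)"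
  "as_cup \<rho> (\<lambda>xs. \<phi> xs + \<psi> xs) = (\<lambda>xs. as_cup \<rho> \<phi> xs + as_cup \<rho> \<psi> xs)"
  by (rule ext, simp only: as_cup_def distrib_left distrib_right sum.distrib)+

lemma as_cup_assoc: "as_cup (as_cup \<phi> \<psi>) \<rho> xs = as_cup \<phi> (as_cup \<psi> \<rho>) xs"
proof -
  let ?n = "length xs"
  let ?g = "\<lambda>j i. \<phi> (take (Suc j) xs) * \<psi> (take (Suc (i - j)) (drop j xs)) * \<rho> (drop i xs)"
  have "as_cup (as_cup \<phi> \<psi>) \<rho> xs = (\<Sum>i<?n. \<Sum>j<Suc i. ?g j i)"
    unfolding as_cup_def sum_distrib_right
    by (intro sum.cong) (auto simp: min_def drop_take Suc_diff_le )
  also have "\<dots> = (\<Sum>(i,j)\<in>(SIGMA i:{..<?n}. {..<Suc i}). ?g j i)"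
    by (subst sum.Sigma) auto
  also have "\<dots> = (\<Sum>(j,k)\<in>(SIGMA j:{..<?n}. {..<?n-j}). ?g j (j + k))"
    by (rule sum.reindex_bij_witness[where i="\<lambda>(j,k). (j+k,j)" and j="\<lambda>(i,j). (j,i-j)"]) auto
  also have "\<dots> = (\<Sum>j<?n. \<Sum>k<?n-j. ?g j (j + k))"
    by (subst sum.Sigma) auto
  also have "\<dots> = as_cup \<phi> (as_cup \<psi> \<rho>) xs"
    unfolding as_cup_def sum_distrib_left
    by (intro sum.cong refl) (auto simp: mult.assoc add.commute)
  finally show ?thesis .
qed

lemma as_coboundary_cup:
  assumes "\<phi> \<in> as_cochains X" "\<psi> \<in> as_cochains X"
  shows "as_coboundary X (as_cup \<phi> \<psi>) =
     (\<lambda>xs. as_cup (as_coboundary X \<phi>) \<psi> xs + as_cup \<phi> (as_coboundary X \<psi>) xs)"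
proof
  fix xs
  show "as_coboundary X (as_cup \<phi> \<psi>) xs =
     as_cup (as_coboundary X \<phi>) \<psi> xs + as_cup \<phi> (as_coboundary X \<psi>) xs"
  proof (cases "set xs \<subseteq> topspace X \<and> xs \<noteq> []")
    case False
    have z: "\<eta> xs = 0" if "\<eta> \<in> as_cochains X" for \<eta>
      using False as_cochainsD[OF that] by (cases "xs = []") auto
    show ?thesis
      by (simp only: z as_coboundary_cochain as_cup_cochain assms add_0_right)
  next
    case True
    then obtain n where n: "length xs = Suc n" by (cases xs) auto
    define del where "del = (\<lambda>m (ys::'a list). take m ys @ drop (Suc m) ys)"
    have X: "set (take i xs) \<subseteq> topspace X" "set (drop i xs) \<subseteq> topspace X" for i
      using True set_take_subset set_drop_subset by fast+
    let ?P = "\<lambda>i m. \<phi> (del m (take (Suc (Suc i)) xs)) * \<psi> (drop (Suc i) xs)"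
    let ?Q = "\<lambda>i m. \<phi> (take (Suc i) xs) * \<psi> (del (m - i) (drop i xs))"
    let ?D = "\<Sum>i<n. \<phi> (take (Suc i) xs) * \<psi> (drop (Suc i) xs)"
    have del1: "take (Suc i) (del m xs) = del m (take (Suc (Suc i)) xs)"
       "drop i (del m xs) = drop (Suc i) xs" if "m \<le> i" "i < n" for i m
      using that n by (auto simp: del_def min_def drop_take Suc_diff_le)
    have del2: "take (Suc i) (del m xs) = take (Suc i) xs"
       "drop i (del m xs) = del (m - i) (drop i xs)" if "i < m" "m < Suc n" for i m
      using that n by (auto simp: del_def min_def drop_take)
    have "as_coboundary X (as_cup \<phi> \<psi>) xs = (\<Sum>m<Suc n. as_cup \<phi> \<psi> (del m xs))"
      using True by (simp add: as_coboundary_def del_def n)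
    also have "\<dots> = (\<Sum>m<Suc n. \<Sum>i<n. if m \<le> i then ?P i m else ?Q i m)"
    proof (intro sum.cong refl)
      fix m assume m: "m \<in> {..<Suc n}"
      then have "length (del m xs) = n" using n by (auto simp: del_def)
      then show "as_cup \<phi> \<psi> (del m xs) = (\<Sum>i<n. if m \<le> i then ?P i m else ?Q i m)"
        unfolding as_cup_def using m by (intro sum.cong) (auto simp: del1 del2)
    qed
    also have "\<dots> = (\<Sum>i<n. \<Sum>m<Suc n. if m \<le> i then ?P i m else ?Q i m)"
      by (rule sum.swap)
    also have "\<dots> = (\<Sum>i<n. (\<Sum>m\<le>i. ?P i m) + (\<Sum>m\<in>{Suc i..n}. ?Q i m))"
    proof (intro sum.cong refl)
      fix i assume "i \<in> {..<n}"
      then have "{..<Suc n} = {..i} \<union> {Suc i..n}" by auto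
      then show "(\<Sum>m<Suc n. if m \<le> i then ?P i m else ?Q i m) = (\<Sum>m\<le>i. ?P i m) + (\<Sum>m\<in>{Suc i..n}. ?Q i m)"
        by (simp add: sum.union_disjoint ivl_disj_int_two)
    qed
    finally have L: "as_coboundary X (as_cup \<phi> \<psi>) xs = (\<Sum>i<n. \<Sum>m\<le>i. ?P i m) + (\<Sum>i<n. \<Sum>m\<in>{Suc i..n}. ?Q i m)"
      by (simp add: sum.distrib)
    have "as_cup (as_coboundary X \<phi>) \<psi> xs = (\<Sum>i<Suc n. as_coboundary X \<phi> (take (Suc i) xs) * \<psi> (drop i xs))"
      by (simp add: as_cup_def n)
    also have "\<dots> = as_coboundary X \<phi> (take (Suc 0) xs) * \<psi> (drop 0 xs) + (\<Sum>i<n. as_coboundary X \<phi> (take (Suc (Suc i)) xs) * \<psi> (drop (Suc i) xs))"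
      by (rule sum.lessThan_Suc_shift)
    also have "as_coboundary X \<phi> (take (Suc 0) xs) = 0"
      using as_cochainsD(1)[OF assms(1)] n by (simp add: as_coboundary_def)
    also have "(\<Sum>i<n. as_coboundary X \<phi> (take (Suc (Suc i)) xs) * \<psi> (drop (Suc i) xs))
       = (\<Sum>i<n. (\<Sum>m\<le>i. ?P i m) + \<phi> (take (Suc i) xs) * \<psi> (drop (Suc i) xs))"
    proof (intro sum.cong refl)
      fix i assume i: "i \<in> {..<n}"
      have "as_coboundary X \<phi> (take (Suc (Suc i)) xs) = (\<Sum>m<Suc (Suc i). \<phi> (del m (take (Suc (Suc i)) xs)))"
        using X i n by (simp add: as_coboundary_def del_def)
      also have "\<dots> = (\<Sum>m\<le>i. \<phi> (del m (take (Suc (Suc i)) xs))) + \<phi> (del (Suc i) (take (Suc (Suc i)) xs))"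
        by (simp add: lessThan_Suc_atMost)
      also have "del (Suc i) (take (Suc (Suc i)) xs) = take (Suc i) xs"
        using i n by (simp add: del_def min_def)
      finally show "as_coboundary X \<phi> (take (Suc (Suc i)) xs) * \<psi> (drop (Suc i) xs) = 
          (\<Sum>m\<le>i. ?P i m) + \<phi> (take (Suc i) xs) * \<psi> (drop (Suc i) xs)"
        by (simp only: distrib_right sum_distrib_right)
    qed
    finally have R1: "as_cup (as_coboundary X \<phi>) \<psi> xs = (\<Sum>i<n. \<Sum>m\<le>i. ?P i m) + ?D"
      by (simp add: sum.distrib)
    have "as_cup \<phi> (as_coboundary X \<psi>) xs = (\<Sum>i<Suc n. \<phi> (take (Suc i) xs) * as_coboundary X \<psi> (drop i xs))"
      by (simp add: as_cup_def n)
    also have "\<dots> = (\<Sum>i<n. \<phi> (take (Suc i) xs) * as_coboundary X \<psi> (drop i xs)) + \<phi> (take (Suc n) xs) * as_coboundary X \<psi> (drop n xs)"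
      by simp
    also have "as_coboundary X \<psi> (drop n xs) = 0"
      using as_cochainsD(1)[OF assms(2)] n by (simp add: as_coboundary_def)
    also have "(\<Sum>i<n. \<phi> (take (Suc i) xs) * as_coboundary X \<psi> (drop i xs)) =
        (\<Sum>i<n. \<phi> (take (Suc i) xs) * \<psi> (drop (Suc i) xs) + (\<Sum>m\<in>{Suc i..n}. ?Q i m))"
    proof (intro sum.cong refl)
      fix i assume i: "i \<in> {..<n}"
      have "as_coboundary X \<psi> (drop i xs) = (\<Sum>m<Suc (n-i). \<psi> (del m (drop i xs)))"
        using X i n by (simp add: as_coboundary_def del_def Suc_diff_le)
      also have "\<dots> = \<psi> (del 0 (drop i xs)) + (\<Sum>m<n-i. \<psi> (del (Suc m) (drop i xs)))"
        by (rule sum.lessThan_Suc_shift)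
      also have "del 0 (drop i xs) = drop (Suc i) xs" by (simp add: del_def)
      also have "(\<Sum>m<n-i. \<psi> (del (Suc m) (drop i xs))) = (\<Sum>m\<in>{Suc i..n}. \<psi> (del (m-i) (drop i xs)))"
        by (rule sum.reindex_bij_witness[where i="\<lambda>m. m - Suc i" and j="\<lambda>m. m + Suc i"]) auto
      finally show "\<phi> (take (Suc i) xs) * as_coboundary X \<psi> (drop i xs) = 
         \<phi> (take (Suc i) xs) * \<psi> (drop (Suc i) xs) + (\<Sum>m\<in>{Suc i..n}. ?Q i m)"
        by (simp only: distrib_left sum_distrib_left)
    qed
    finally have R2: "as_cup \<phi> (as_coboundary X \<psi>) xs = ?D + (\<Sum>i<n. \<Sum>m\<in>{Suc i..n}. ?Q i m)"
      by (simp add: sum.distrib)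
    have cancel: "a + b = (a + d) + (d + b)" for a b d :: bit
      by (cases a; cases b; cases d) auto
    show ?thesis unfolding L R1 R2 by (rule cancel)
  qed
qed

lemma as_coboundary_coboundary:
  assumes "\<phi> \<in> as_cochains X"
  shows "as_coboundary X (as_coboundary X \<phi>) = (\<lambda>xs. 0)"
proof
  fix xs
  show "as_coboundary X (as_coboundary X \<phi>) xs = 0"
  proof (cases "set xs \<subseteq> topspace X")
    case False then show ?thesis by (simp add: as_coboundary_def)
  next
    case True
    define del where "del = (\<lambda>m (ys::'a list). take m ys @ drop (Suc m) ys)"
    let ?n = "length xs"
    have set_del: "set (del m xs) \<subseteq> topspace X" for m
      using True set_take_subset set_drop_subset unfolding del_def by fastforce
    have "as_coboundary X (as_coboundary X \<phi>) xs = (\<Sum>m<?n. as_coboundary X \<phi> (del m xs))"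
      using True by (simp add: as_coboundary_def del_def)
    also have "\<dots> = (\<Sum>m<?n. \<Sum>l<?n - 1. \<phi> (del l (del m xs)))"
    proof (intro sum.cong refl)
      fix m assume "m \<in> {..<?n}"
      then have "length (del m xs) = ?n - 1" by (auto simp: del_def)
      then show "as_coboundary X \<phi> (del m xs) = (\<Sum>l<?n - 1. \<phi> (del l (del m xs)))"
        using set_del by (simp add: as_coboundary_def del_def)
    qed
    also have "\<dots> = (\<Sum>(m,l)\<in>{..<?n}\<times>{..<?n-1}. \<phi> (del l (del m xs)))"
      by (simp add: sum.cartesian_product)
    also have "\<dots> = (\<Sum>(m,l)\<in>{(m,l). m < ?n \<and> l < ?n-1 \<and> m \<le> l}. \<phi> (del l (del m xs))) 
         + (\<Sum>(m,l)\<in>{(m,l). m < ?n \<and> l < ?n-1 \<and> l < m}. \<phi> (del l (del m xs)))"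
    proof -
      have eq: "{..<?n}\<times>{..<?n-1} = {(m,l). m < ?n \<and> l < ?n-1 \<and> m \<le> l} \<union> {(m,l). m < ?n \<and> l < ?n-1 \<and> l < m}"
        by auto
      have fin: "finite ({..<?n}\<times>{..<?n-1})" by simp
      then have "finite {(m,l). m < ?n \<and> l < ?n-1 \<and> m \<le> l}" "finite {(m,l). m < ?n \<and> l < ?n-1 \<and> l < m}"
        unfolding eq by auto
      then show ?thesis unfolding eq by (intro sum.union_disjoint) auto
    qed
    also have "(\<Sum>(m,l)\<in>{(m,l). m < ?n \<and> l < ?n-1 \<and> m \<le> l}. \<phi> (del l (del m xs))) 
         = (\<Sum>(m,l)\<in>{(m,l). m < ?n \<and> l < ?n-1 \<and> l < m}. \<phi> (del l (del m xs)))"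
    proof (rule sum.reindex_bij_witness[where i="\<lambda>(m,l). (l,m-1)" and j="\<lambda>(m,l). (Suc l,m)"], goal_cases)
      case (5 a)
      then obtain m l where a: "a = (m,l)" "m < ?n" "l < ?n - 1" "m \<le> l" by auto
      have "del m (del (Suc l) xs) = del l (del m xs)"
        using a by (simp add: del_def drop_take min_def)
      then show ?case using a by simp
    qed auto
    finally show ?thesis by simp
  qed
qed

lemma as_cup_one:
  assumes "\<phi> \<in> as_cochains X"
  shows "as_cup (\<lambda>xs. if length xs = 1 \<and> set xs \<subseteq> topspace X then 1 else 0) \<phi> = \<phi>" (is "as_cup ?e \<phi> = _")
        "as_cup \<phi> (\<lambda>xs. if length xs = 1 \<and> set xs \<subseteq> topspace X then 1 else 0) = \<phi>"
proof -
  have "as_cup ?e \<phi> xs = \<phi> xs \<and> as_cup \<phi> ?e xs = \<phi> xs" for xs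
  proof (cases "set xs \<subseteq> topspace X \<and> xs \<noteq> []")
    case False
    have e: "?e \<in> as_cochains X" by (rule as_cochainsI[where n=1]) auto
    have z: "\<eta> xs = 0" if "\<eta> \<in> as_cochains X" for \<eta>
      using False as_cochainsD[OF that] by (cases "xs = []") auto
    show ?thesis
      by (simp only: z as_cup_cochain[OF e assms] as_cup_cochain[OF assms e] assms simp_thms)
  next
    case True
    then obtain n where n: "length xs = Suc n" by (cases xs) auto
    have X: "set (take i xs) \<subseteq> topspace X" "set (drop i xs) \<subseteq> topspace X" for i
      using True set_take_subset set_drop_subset by fast+
    have "as_cup ?e \<phi> xs = (\<Sum>i<Suc n. if i = 0 then \<phi> (drop i xs) else 0)"
      unfolding as_cup_def n using X n by (intro sum.cong) auto
    moreover have "as_cup \<phi> ?e xs = (\<Sum>i<Suc n. if i = n then \<phi> (take (Suc i) xs) else 0)"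
      unfolding as_cup_def n using X n by (intro sum.cong) auto
    ultimately show ?thesis using n by simp
  qed
  then show "as_cup ?e \<phi> = \<phi>" "as_cup \<phi> ?e = \<phi>" by auto
qed

lemma as_one_cocycle:
  "(\<lambda>xs. if length xs = 1 \<and> set xs \<subseteq> topspace X then 1 else 0) \<in> as_cochains X" (is "?e \<in> _")
  "as_coboundary X (\<lambda>xs. if length xs = 1 \<and> set xs \<subseteq> topspace X then 1 else 0) = (\<lambda>xs. 0)"
proof -
  show "?e \<in> as_cochains X" by (rule as_cochainsI[where n=1]) auto
  have "as_coboundary X ?e xs = 0" for xs
  proof (cases "length xs = 2 \<and> set xs \<subseteq> topspace X")
    case True
    then obtain x y where "xs = [x,y]" by (auto simp: length_Suc_conv numeral_2_eq_2)
    then show ?thesis using True by (simp add: as_coboundary_def numeral_2_eq_2)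
  next
    case False
    then show ?thesis by (auto simp: as_coboundary_def intro!: sum.neutral)
  qed
  then show "as_coboundary X ?e = (\<lambda>xs. 0)" by auto
qed

lemma ring_as_cocycle_ring: "ring (as_cocycle_ring X)"
proof (rule ringI)
  show "abelian_group (as_cocycle_ring X)"
  proof (rule abelian_groupI; clarsimp simp: as_cocycle_ring_def as_coboundary_add as_add_cochain as_add_locally_zero ac_simps)
    show "(\<lambda>xs. 0) \<in> as_cochains X \<and> as_coboundary X (\<lambda>xs. 0) \<in> as_locally_zero X"
      using as_zero_locally_zero as_locally_zero_cochain as_coboundary_locally_zero by blast
  next
    fix x assume "x \<in> as_cochains X" "as_coboundary X x \<in> as_locally_zero X"
    then show "\<exists>y. y \<in> as_cochains X \<and> as_coboundary X y \<in> as_locally_zero X \<and> (\<lambda>xs. x xs + y xs) = (\<lambda>xs. 0)"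
      by (intro exI[of _ x]) auto
  qed
  show "monoid (as_cocycle_ring X)"
  proof (rule monoidI; clarsimp simp: as_cocycle_ring_def as_cup_cochain as_coboundary_cup)
    fix x y assume "x \<in> as_cochains X" "as_coboundary X x \<in> as_locally_zero X" 
      "y \<in> as_cochains X" "as_coboundary X y \<in> as_locally_zero X"
    then show "(\<lambda>xs. as_cup (as_coboundary X x) y xs + as_cup x (as_coboundary X y) xs) \<in> as_locally_zero X"
      by (intro as_add_locally_zero as_cup_locally_zero) (auto intro: as_coboundary_cochain)
  qed (auto simp: as_one_cocycle[unfolded One_nat_def] as_zero_locally_zero as_cup_one[unfolded One_nat_def] intro!: ext as_cup_assoc)
qed (auto simp: as_cocycle_ring_def as_cup_add)

lemma as_boundary_ideal:
  "ideal (as_boundary_ideal X) (as_cocycle_ring X)"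
proof -
  interpret R: ring "as_cocycle_ring X" by (rule ring_as_cocycle_ring)
  let ?B = "as_boundary_ideal X"
  have BI: "(\<lambda>xs. as_coboundary X \<psi> xs + \<theta> xs) \<in> ?B" if "\<psi> \<in> as_cochains X" "\<theta> \<in> as_locally_zero X" for \<psi> \<theta>
    using that unfolding as_boundary_ideal_def by blast
  have sub: "?B \<subseteq> carrier (as_cocycle_ring X)"
    by (auto simp: as_boundary_ideal_def as_cocycle_ring_def as_add_cochain as_coboundary_cochain
       as_coboundary_add as_coboundary_coboundary as_locally_zero_cochain as_coboundary_locally_zero)
  have add: "a \<oplus>\<^bsub>as_cocycle_ring X\<^esub> b \<in> ?B" if a: "a \<in> ?B" and b: "b \<in> ?B" for a b
  proof -
    obtain \<psi> \<theta> \<psi>' \<theta>' where e: "a = (\<lambda>xs. as_coboundary X \<psi> xs + \<theta> xs)" "\<psi> \<in> as_cochains X" "\<theta> \<in> as_locally_zero X"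
      "b = (\<lambda>xs. as_coboundary X \<psi>' xs + \<theta>' xs)" "\<psi>' \<in> as_cochains X" "\<theta>' \<in> as_locally_zero X"
      using a b unfolding as_boundary_ideal_def by blast
    have "a \<oplus>\<^bsub>as_cocycle_ring X\<^esub> b = (\<lambda>xs. as_coboundary X (\<lambda>xs. \<psi> xs + \<psi>' xs) xs + (\<lambda>xs. \<theta> xs + \<theta>' xs) xs)"
      by (simp add: as_cocycle_ring_def e as_coboundary_add ac_simps)
    then show ?thesis using BI[of "\<lambda>xs. \<psi> xs + \<psi>' xs" "\<lambda>xs. \<theta> xs + \<theta>' xs"] e by (simp add: as_add_cochain as_add_locally_zero)
  qed
  have zero: "\<zero>\<^bsub>as_cocycle_ring X\<^esub> \<in> ?B"
    using BI[of "\<lambda>xs. 0" "\<lambda>xs. 0"] as_zero_locally_zero[of X] as_locally_zero_cochain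
    by (auto simp: as_cocycle_ring_def as_coboundary_def cong: if_cong)
  have neg: "\<ominus>\<^bsub>as_cocycle_ring X\<^esub> a = a" if "a \<in> carrier (as_cocycle_ring X)" for a
    using that R.minus_equality[of a a] by (simp add: as_cocycle_ring_def)
  show ?thesis
  proof (rule idealI)
    show "subgroup ?B (add_monoid (as_cocycle_ring X))"
    proof (rule group.subgroupI[OF R.a_group])
      fix a assume "a \<in> ?B"
      with neg[of a] sub show "inv\<^bsub>add_monoid (as_cocycle_ring X)\<^esub> a \<in> ?B"
        unfolding a_inv_def by (metis subsetD)
    qed (use sub zero add in auto)
  next
    fix a x assume a: "a \<in> ?B" and x: "x \<in> carrier (as_cocycle_ring X)"
    obtain \<psi> \<theta> where e: "a = (\<lambda>xs. as_coboundary X \<psi> xs + \<theta> xs)" "\<psi> \<in> as_cochains X" "\<theta> \<in> as_locally_zero X"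
      using a unfolding as_boundary_ideal_def by blast
    have x': "x \<in> as_cochains X" "as_coboundary X x \<in> as_locally_zero X"
      using x by (auto simp: as_cocycle_ring_def)
    have c: "b = (a + b) + a" "b = (b + a) + a" "a + b + c = (a + b) + c" for a b c :: bit by (cases a; cases b; auto)+
    have e1: "as_cup x (as_coboundary X \<psi>) = (\<lambda>xs. as_coboundary X (as_cup x \<psi>) xs + as_cup (as_coboundary X x) \<psi> xs)"
      using as_coboundary_cup[OF x'(1) e(2)] c by auto
    have e2: "as_cup (as_coboundary X \<psi>) x = (\<lambda>xs. as_coboundary X (as_cup \<psi> x) xs + as_cup \<psi> (as_coboundary X x) xs)"
      using as_coboundary_cup[OF e(2) x'(1)] c by (auto simp: add.assoc)
    have "x \<otimes>\<^bsub>as_cocycle_ring X\<^esub> a = (\<lambda>xs. as_coboundary X (as_cup x \<psi>) xs + (\<lambda>xs. as_cup (as_coboundary X x) \<psi> xs + as_cup x \<theta> xs) xs)"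
      by (simp add: as_cocycle_ring_def e as_cup_add e1 ac_simps)
    then show "x \<otimes>\<^bsub>as_cocycle_ring X\<^esub> a \<in> ?B"
      using BI[of "as_cup x \<psi>" "\<lambda>xs. as_cup (as_coboundary X x) \<psi> xs + as_cup x \<theta> xs"] e x'
      by (simp add: as_cup_cochain as_add_locally_zero as_cup_locally_zero as_coboundary_cochain as_locally_zero_cochain)
    have "a \<otimes>\<^bsub>as_cocycle_ring X\<^esub> x = (\<lambda>xs. as_coboundary X (as_cup \<psi> x) xs + (\<lambda>xs. as_cup \<psi> (as_coboundary X x) xs + as_cup \<theta> x xs) xs)"
      by (simp add: as_cocycle_ring_def e as_cup_add e2 ac_simps)
    then show "a \<otimes>\<^bsub>as_cocycle_ring X\<^esub> x \<in> ?B"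
      using BI[of "as_cup \<psi> x" "\<lambda>xs. as_cup \<psi> (as_coboundary X x) xs + as_cup \<theta> x xs"] e x'
      by (simp add: as_cup_cochain as_add_locally_zero as_cup_locally_zero as_coboundary_cochain as_locally_zero_cochain)
  qed (rule R.ring_axioms)
qed

lemma ring_as_cohomology_ring: "ring (as_cohomology_ring X)"
  unfolding as_cohomology_ring_def by (rule ideal.quotient_is_ring[OF as_boundary_ideal])

end


section \<open>Antipodal quotients and the infinite-dimensional real projective space\<close>

definition antipodal_quotient :: "'a::uminus topology \<Rightarrow> 'a set topology" where
  "antipodal_quotient X = topology (\<lambda>V. V \<subseteq> (\<lambda>x. {x, -x}) ` topspace X \<and>
                                         openin X {x \<in> topspace X. {x, -x} \<in> V})"

text \<open>The union of the spheres \<open>S\<^sup>n\<close>, with the direct limit topology.\<close>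

definition infinite_sphere :: "(nat \<Rightarrow> real) topology" where
  "infinite_sphere = topology (\<lambda>U. U \<subseteq> (\<Union>n. topspace (nsphere n)) \<and>
                                   (\<forall>n. openin (nsphere n) (U \<inter> topspace (nsphere n))))"

definition RP_infinity :: "(nat \<Rightarrow> real) set topology" where
  "RP_infinity = antipodal_quotient infinite_sphere"

lemma openin_antipodal_quotient:
  "openin (antipodal_quotient X) V \<longleftrightarrow>
     V \<subseteq> (\<lambda>x. {x, -x}) ` topspace X \<and> openin X {x \<in> topspace X. {x, -x} \<in> V}"
proof -
  have "istopology (\<lambda>V. V \<subseteq> (\<lambda>x. {x, -x}) ` topspace X \<and> openin X {x \<in> topspace X. {x, -x} \<in> V})"
    unfolding istopology_def
  proof (intro conjI allI impI)
    fix S T :: "'a set set"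
    assume "S \<subseteq> (\<lambda>x. {x, -x}) ` topspace X \<and> openin X {x \<in> topspace X. {x, -x} \<in> S}"
      and "T \<subseteq> (\<lambda>x. {x, -x}) ` topspace X \<and> openin X {x \<in> topspace X. {x, -x} \<in> T}"
    moreover have "{x \<in> topspace X. {x, -x} \<in> S \<inter> T} =
        {x \<in> topspace X. {x, -x} \<in> S} \<inter> {x \<in> topspace X. {x, -x} \<in> T}"
      by auto
    ultimately show "S \<inter> T \<subseteq> (\<lambda>x. {x, -x}) ` topspace X"
      "openin X {x \<in> topspace X. {x, -x} \<in> S \<inter> T}"
      by auto
  next
    fix K :: "'a set set set"
    assume K: "\<forall>S\<in>K. S \<subseteq> (\<lambda>x. {x, -x}) ` topspace X \<and> openin X {x \<in> topspace X. {x, -x} \<in> S}"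
    then show "\<Union>K \<subseteq> (\<lambda>x. {x, -x}) ` topspace X"
      by blast
    have "{x \<in> topspace X. {x, -x} \<in> \<Union>K} = (\<Union>S\<in>K. {x \<in> topspace X. {x, -x} \<in> S})"
      by auto
    with K show "openin X {x \<in> topspace X. {x, -x} \<in> \<Union>K}"
      by auto
  qed
  then show ?thesis
    by (simp add: antipodal_quotient_def)
qed

lemma openin_infinite_sphere:
  "openin infinite_sphere U \<longleftrightarrow> U \<subseteq> (\<Union>n. topspace (nsphere n)) \<and>
     (\<forall>n. openin (nsphere n) (U \<inter> topspace (nsphere n)))"
proof -
  have "istopology (\<lambda>U. U \<subseteq> (\<Union>n. topspace (nsphere n)) \<and>
                        (\<forall>n. openin (nsphere n) (U \<inter> topspace (nsphere n))))"
    unfolding istopology_def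
  proof (intro conjI allI impI)
    fix S T :: "(nat \<Rightarrow> real) set" and n
    assume S: "S \<subseteq> (\<Union>n. topspace (nsphere n)) \<and>
               (\<forall>n. openin (nsphere n) (S \<inter> topspace (nsphere n)))"
      and T: "T \<subseteq> (\<Union>n. topspace (nsphere n)) \<and>
               (\<forall>n. openin (nsphere n) (T \<inter> topspace (nsphere n)))"
    then show "S \<inter> T \<subseteq> (\<Union>n. topspace (nsphere n))"
      by auto
    have "S \<inter> T \<inter> topspace (nsphere n) =
        (S \<inter> topspace (nsphere n)) \<inter> (T \<inter> topspace (nsphere n))"
      by auto
    with S T show "openin (nsphere n) (S \<inter> T \<inter> topspace (nsphere n))"
      by auto
  next
    fix K :: "(nat \<Rightarrow> real) set set" and n
    assume K: "\<forall>S\<in>K. S \<subseteq> (\<Union>n. topspace (nsphere n)) \<and>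
               (\<forall>n. openin (nsphere n) (S \<inter> topspace (nsphere n)))"
    then show "\<Union>K \<subseteq> (\<Union>n. topspace (nsphere n))"
      by blast
    have "\<Union>K \<inter> topspace (nsphere n) = (\<Union>S\<in>K. S \<inter> topspace (nsphere n))"
      by auto
    moreover have "openin (nsphere n) (\<Union>S\<in>K. S \<inter> topspace (nsphere n))"
      by (rule openin_Union) (use K in blast)
    ultimately show "openin (nsphere n) (\<Union>K \<inter> topspace (nsphere n))"
      by simp
  qed
  then show ?thesis
    by (simp add: infinite_sphere_def)
qed

text \<open>
  The generator of the cohomology ring of \<open>RP\<^sup>\<infinity>\<close>: the only nonzero class of degree one.
\<close>

definition RP_generator :: "((nat \<Rightarrow> real) set list \<Rightarrow> bit) set" where
  "RP_generator = (THE \<omega>. \<omega> \<in> as_cohomology_group 1 RP_infinity \<and>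
                          \<omega> \<noteq> \<zero>\<^bsub>as_cohomology_ring RP_infinity\<^esub>)"


section \<open>The cohomological index of Fadell and Rabinowitz\<close>

definition symmetric_set :: "'a::uminus set \<Rightarrow> bool" where
  "symmetric_set A \<longleftrightarrow> uminus ` A = A"

text \<open>
  A classifying map of the double covering \<open>A \<rightarrow> A/\<int>\<^sub>2\<close> is a map covered by an equivariant map
  into the total space \<open>S\<^sup>\<infinity>\<close> of the universal covering.
\<close>

definition classifying_map ::
    "'a::real_normed_vector set \<Rightarrow> ('a set \<Rightarrow> (nat \<Rightarrow> real) set) \<Rightarrow> bool" where
  "classifying_map A f \<longleftrightarrow>
     continuous_map (antipodal_quotient (top_of_set A)) RP_infinity f \<and>
     (\<exists>F. continuous_map (top_of_set A) infinite_sphere F \<and>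
          (\<forall>u\<in>A. F (-u) = - F u \<and> f {u, -u} = {F u, - F u}))"

text \<open>
  Classifying maps are unique up to homotopy, so it does not matter which one is used.
\<close>

definition cohomological_index :: "'a::real_normed_vector set \<Rightarrow> enat" where
  "cohomological_index A =
     (if A = {} then 0
      else Sup {enat m | m. 1 \<le> m \<and> (\<exists>f. classifying_map A f \<and>
        as_induced (antipodal_quotient (top_of_set A)) f
          (RP_generator [^]\<^bsub>as_cohomology_ring RP_infinity\<^esub> (m - 1))
        \<noteq> \<zero>\<^bsub>as_cohomology_ring (antipodal_quotient (top_of_set A))\<^esub>)})"


section \<open>The variational setting\<close>

definition uniformly_convex :: "'a::real_normed_vector itself \<Rightarrow> bool" where
  "uniformly_convex _ \<longleftrightarrow>
     (\<forall>\<epsilon>>0. \<exists>\<delta>>0. \<forall>x y::'a. norm x = 1 \<and> norm y = 1 \<and> norm (x - y) \<ge> \<epsilon> \<longrightarrow>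
        norm ((1/2) *\<^sub>R (x + y)) \<le> 1 - \<delta>)"

definition potential_operator ::
    "('a::real_normed_vector \<Rightarrow> 'a \<Rightarrow>\<^sub>L real) \<Rightarrow> bool" where
  "potential_operator h \<longleftrightarrow> continuous_on UNIV h \<and>
     (\<exists>H::'a \<Rightarrow> real. \<forall>u. (H has_derivative blinfun_apply (h u)) (at u))"

definition compact_operator ::
    "('a::real_normed_vector \<Rightarrow> 'b::real_normed_vector) \<Rightarrow> bool" where
  "compact_operator h \<longleftrightarrow> continuous_on UNIV h \<and> (\<forall>S. bounded S \<longrightarrow> compact (closure (h ` S)))"

text \<open>\<open>I\<^sub>p\<close> for \<open>T = A\<^sub>p\<close> and \<open>J\<^sub>p\<close> for \<open>T = B\<^sub>p\<close>.\<close>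

definition homogeneous_potential ::
    "real \<Rightarrow> ('a::real_normed_vector \<Rightarrow> 'a \<Rightarrow>\<^sub>L real) \<Rightarrow> 'a \<Rightarrow> real" where
  "homogeneous_potential p T u = (1 / p) * blinfun_apply (T u) u"

definition level_manifold ::
    "real \<Rightarrow> ('a::real_normed_vector \<Rightarrow> 'a \<Rightarrow>\<^sub>L real) \<Rightarrow> 'a set" where
  "level_manifold p A = {u. homogeneous_potential p A u = 1}"

definition Psi :: "real \<Rightarrow> ('a::real_normed_vector \<Rightarrow> 'a \<Rightarrow>\<^sub>L real) \<Rightarrow> 'a \<Rightarrow> real" where
  "Psi p B u = 1 / homogeneous_potential p B u"

definition index_class ::
    "real \<Rightarrow> ('a::real_normed_vector \<Rightarrow> 'a \<Rightarrow>\<^sub>L real) \<Rightarrow> nat \<Rightarrow> 'a set set" where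
  "index_class p A k =
     {M. M \<subseteq> level_manifold p A \<and> symmetric_set M \<and> cohomological_index M \<ge> enat k}"

definition minimax_eigenvalue ::
    "real \<Rightarrow> ('a::real_normed_vector \<Rightarrow> 'a \<Rightarrow>\<^sub>L real) \<Rightarrow> ('a \<Rightarrow> 'a \<Rightarrow>\<^sub>L real) \<Rightarrow> nat \<Rightarrow> ereal" where
  "minimax_eigenvalue p A B k = (INF M\<in>index_class p A k. SUP u\<in>M. ereal (Psi p B u))"

definition Psi_sublevel ::
    "real \<Rightarrow> ('a::real_normed_vector \<Rightarrow> 'a \<Rightarrow>\<^sub>L real) \<Rightarrow> ('a \<Rightarrow> 'a \<Rightarrow>\<^sub>L real) \<Rightarrow> ereal \<Rightarrow> 'a set" where
  "Psi_sublevel p A B a = {u \<in> level_manifold p A. ereal (Psi p B u) \<le> a}"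

end

theory Submission
  imports Defs
begin

text \<open>
  For \<open>u \<in> \<M>\<close> let \<open>T u\<close> be the maximiser of the functional \<open>B\<^sub>p u\<close> on the sphere \<open>\<M>\<close>, which exists,
  is unique and depends continuously on \<open>B\<^sub>p u\<close> by uniform convexity. The map \<open>T\<close> is odd, and
  \<open>(B\<^sub>2)\<close> gives \<open>\<Psi> (T u) \<le> \<Psi> u\<close>. As \<open>B\<^sub>p\<close> is compact, the closure of the image of a sublevel set
  under \<open>T\<close> is a compact symmetric subset \<open>C\<^sub>\<mu>\<close> of \<open>\<Psi>\<^sup>\<mu>\<close>, and it has index at least \<open>k\<close> for
  \<open>\<mu> > \<lambda>\<^sub>k\<close> by monotonicity of the index. The intersection of the \<open>C\<^sub>\<mu>\<close> over \<open>\<mu> > \<lambda>\<^sub>k\<close> still has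
  index at least \<open>k\<close> by continuity of the index on compact sets, and index at most \<open>k\<close> because
  it lies in \<open>\<Psi>\<^sup>\<lambda>\<close> for \<open>\<lambda> = \<lambda>\<^sub>k < \<lambda>\<^sub>k\<^sub>+\<^sub>1\<close>.

  The properties of the index hold at the level of cochains: if \<open>g\<close> is any function on \<open>A\<close> with
  \<open>g (- x) = g x + 1\<close>, then every classifying map pulls the generator back to the class of the
  cochain that is \<open>g x + g y\<close> on nearby orbits of \<open>x\<close> and \<open>y\<close>.
\<close>

text \<open>\<open>T\<close> is a normalised step of inverse iteration: if \<open>A_p v\<close> is a
  positive multiple of \<open>B_p u\<close>, then \<open>(A_2)\<close> makes \<open>v\<close> a
  vector at which \<open>B_p u\<close> attains its norm, and uniform convexity supplies such a
  vector without inverting \<open>A_p\<close>. The infimum defining \<open>\<lambda>\<^sub>k\<close>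
  need not be attained, so compact sets are produced strictly above it and a limit is taken.
  Alexander-Spanier cohomology controls this limit: its cochains are arbitrary functions, which even
  discontinuous maps pull back. Two points need work before the index can be used. Its generator is
  a definite description, so the projective space must be shown to have exactly one nonzero class in
  degree one. And the index is positive only for sets that admit a map into the direct limit sphere;
  such maps are built for compact sets, which suffices because the target of every comparison is
  compact.\<close>

declare add_bit_eq_xor [simp del] mult_bit_eq_and [simp del]
  bit_not_zero_iff [simp del] bit_not_one_iff [simp del]

lemma bit_add_cancel [simp]:
  fixes a b c :: bit
  shows "a + (a + b) = b" "b + a + a = b" "(c + a) + (a + b) = c + b" "a + b = 0 \<longleftrightarrow> a = b"
  by (cases a; cases b; cases c; simp)+

section \<open>Cosets and pullbacks of cocycles\<close>

abbreviation as_class :: "'a topology \<Rightarrow> ('a list \<Rightarrow> bit) \<Rightarrow> ('a list \<Rightarrow> bit) set" where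
  "as_class X \<phi> \<equiv> as_boundary_ideal X +>\<^bsub>as_cocycle_ring X\<^esub> \<phi>"

lemma as_cocycle_ring_simps [simp]:
  "mult (as_cocycle_ring X) = as_cup"
  "add (as_cocycle_ring X) = (\<lambda>\<phi> \<psi> xs. \<phi> xs + \<psi> xs)"
  "zero (as_cocycle_ring X) = (\<lambda>xs. 0)"
  "one (as_cocycle_ring X) = (\<lambda>xs. if length xs = 1 \<and> set xs \<subseteq> topspace X then 1 else 0)"
  by (simp_all add: as_cocycle_ring_def)

lemma carrier_as_cocycle_ring:
  "\<phi> \<in> carrier (as_cocycle_ring X) \<longleftrightarrow>
     \<phi> \<in> as_cochains X \<and> as_coboundary X \<phi> \<in> as_locally_zero X"
  by (simp add: as_cocycle_ring_def)

text \<open>In characteristic two every cochain is its own negative; cosets are therefore compared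
  through sums instead of differences.\<close>

lemma as_cocycle_ring_minus:
  assumes "\<phi> \<in> carrier (as_cocycle_ring X)"
  shows "\<ominus>\<^bsub>as_cocycle_ring X\<^esub> \<phi> = \<phi>"
proof -
  interpret ring "as_cocycle_ring X" by (rule ring_as_cocycle_ring)
  show ?thesis using assms by (intro minus_equality) auto
qed

lemma as_class_eq_iff:
  assumes "\<phi> \<in> carrier (as_cocycle_ring X)" "\<psi> \<in> carrier (as_cocycle_ring X)"
  shows "as_class X \<phi> = as_class X \<psi> \<longleftrightarrow> (\<lambda>xs. \<phi> xs + \<psi> xs) \<in> as_boundary_ideal X"
proof -
  interpret ideal "as_boundary_ideal X" "as_cocycle_ring X" by (rule as_boundary_ideal)
  have "as_class X \<phi> = as_class X \<psi> \<longleftrightarrow> \<phi> \<in> as_class X \<psi>"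
    using a_repr_independence'[of \<phi> \<psi>] a_rcos_self[of \<phi>] assms by auto
  also have "\<dots> \<longleftrightarrow> \<phi> \<oplus>\<^bsub>as_cocycle_ring X\<^esub> \<ominus>\<^bsub>as_cocycle_ring X\<^esub> \<psi> \<in> as_boundary_ideal X"
    using a_rcos_module assms by blast
  finally show ?thesis using assms by (simp add: as_cocycle_ring_minus)
qed

lemma as_class_mem_carrier:
  assumes "\<phi> \<in> carrier (as_cocycle_ring X)"
  shows "as_class X \<phi> \<in> carrier (as_cohomology_ring X)"
proof -
  interpret ideal "as_boundary_ideal X" "as_cocycle_ring X" by (rule as_boundary_ideal)
  show ?thesis
    using ring_hom_closed[OF rcos_ring_hom assms] by (simp add: as_cohomology_ring_def)
qed

lemma as_cohomology_class_eq:
  assumes "c \<in> carrier (as_cohomology_ring X)" "\<phi> \<in> c"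
  shows "\<phi> \<in> carrier (as_cocycle_ring X)" "c = as_class X \<phi>"
proof -
  interpret ideal "as_boundary_ideal X" "as_cocycle_ring X" by (rule as_boundary_ideal)
  from assms(1) obtain \<psi> where \<psi>: "\<psi> \<in> carrier (as_cocycle_ring X)" "c = as_class X \<psi>"
    by (auto simp: as_cohomology_ring_def FactRing_def A_RCOSETS_def')
  then show "\<phi> \<in> carrier (as_cocycle_ring X)" "c = as_class X \<phi>"
    using assms(2) a_elemrcos_carrier a_repr_independence' by blast+
qed

lemma zero_as_cohomology_ring: "\<zero>\<^bsub>as_cohomology_ring X\<^esub> = as_boundary_ideal X"
  by (simp add: as_cohomology_ring_def FactRing_def)

lemma as_class_eq_zero_iff:
  assumes "\<phi> \<in> carrier (as_cocycle_ring X)"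
  shows "as_class X \<phi> = \<zero>\<^bsub>as_cohomology_ring X\<^esub> \<longleftrightarrow> \<phi> \<in> as_boundary_ideal X"
proof -
  interpret ideal "as_boundary_ideal X" "as_cocycle_ring X" by (rule as_boundary_ideal)
  show ?thesis
    unfolding zero_as_cohomology_ring using a_rcos_const a_rcos_self assms by blast
qed

lemma as_cocycle_pow_closed:
  assumes "\<phi> \<in> carrier (as_cocycle_ring X)"
  shows "\<phi> [^]\<^bsub>as_cocycle_ring X\<^esub> (n::nat) \<in> carrier (as_cocycle_ring X)"
proof -
  interpret ring "as_cocycle_ring X" by (rule ring_as_cocycle_ring)
  show ?thesis using assms by (rule nat_pow_closed)
qed

lemma as_class_pow:
  assumes "\<phi> \<in> carrier (as_cocycle_ring X)"
  shows "as_class X \<phi> [^]\<^bsub>as_cohomology_ring X\<^esub> (n::nat) = as_class X (\<phi> [^]\<^bsub>as_cocycle_ring X\<^esub> n)"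
proof -
  interpret ideal "as_boundary_ideal X" "as_cocycle_ring X" by (rule as_boundary_ideal)
  interpret h: ring_hom_ring "as_cocycle_ring X" "as_cocycle_ring X Quot as_boundary_ideal X"
    "as_class X" by (rule rcos_ring_hom_ring)
  show ?thesis using h.hom_nat_pow[OF assms, of n] by (simp add: as_cohomology_ring_def)
qed

text \<open>An ideal absorbs further factors. Hence the exponents with nonvanishing power form an
  initial segment, and a single exponent decides a lower bound for the index.\<close>

lemma as_pow_mem_boundary_mono:
  assumes "\<phi> \<in> carrier (as_cocycle_ring X)" "\<phi> [^]\<^bsub>as_cocycle_ring X\<^esub> m \<in> as_boundary_ideal X"
    and "m \<le> (n::nat)"
  shows "\<phi> [^]\<^bsub>as_cocycle_ring X\<^esub> n \<in> as_boundary_ideal X"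
proof -
  interpret ideal "as_boundary_ideal X" "as_cocycle_ring X" by (rule as_boundary_ideal)
  have "\<phi> [^]\<^bsub>as_cocycle_ring X\<^esub> m \<otimes>\<^bsub>as_cocycle_ring X\<^esub> \<phi> [^]\<^bsub>as_cocycle_ring X\<^esub> (n - m)
      \<in> as_boundary_ideal X"
    using assms as_cocycle_pow_closed by (intro I_r_closed)
  also have "\<phi> [^]\<^bsub>as_cocycle_ring X\<^esub> m \<otimes>\<^bsub>as_cocycle_ring X\<^esub> \<phi> [^]\<^bsub>as_cocycle_ring X\<^esub> (n - m)
      = \<phi> [^]\<^bsub>as_cocycle_ring X\<^esub> n"
    using assms nat_pow_mult[of \<phi> m "n - m"] by simp
  finally show ?thesis .
qed

section \<open>Pullback of cochains along maps of points\<close>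

lemma as_pullback_cochain:
  assumes "\<phi> \<in> as_cochains Y"
  shows "as_pullback X f \<phi> \<in> as_cochains X"
proof -
  obtain m where "\<And>xs. m < length xs \<Longrightarrow> \<phi> xs = 0" using as_cochains_bound assms by blast
  then show ?thesis
    using as_cochainsD(1)[OF assms] by (intro as_cochainsI[where n=m]) (auto simp: as_pullback_def)
qed

lemma set_take_drop_subset:
  "set xs \<subseteq> S \<Longrightarrow> set (take i xs) \<subseteq> S" "set xs \<subseteq> S \<Longrightarrow> set (drop i xs) \<subseteq> S"
  using set_take_subset set_drop_subset by fast+

text \<open>Deleting an entry commutes with \<open>map f\<close>, whatever \<open>f\<close> is.
  Continuity enters only when locally zero cochains are pulled back, and this leaves room for
  discontinuous maps later.\<close>

lemma as_pullback_coboundary: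
  assumes "f \<in> topspace X \<rightarrow> topspace Y"
  shows "as_pullback X f (as_coboundary Y \<phi>) = as_coboundary X (as_pullback X f \<phi>)"
proof
  fix xs
  show "as_pullback X f (as_coboundary Y \<phi>) xs = as_coboundary X (as_pullback X f \<phi>) xs"
  proof (cases "set xs \<subseteq> topspace X")
    case True
    moreover have "f ` set xs \<subseteq> topspace Y" using True assms by auto
    moreover have "as_pullback X f \<phi> (take i xs @ drop (Suc i) xs)
        = \<phi> (take i (map f xs) @ drop (Suc i) (map f xs))" for i
      using True by (simp add: as_pullback_def set_take_drop_subset take_map drop_map)
    ultimately show ?thesis
      by (simp add: as_coboundary_def as_pullback_def[of _ _ "as_coboundary Y \<phi>"])
  qed (simp add: as_pullback_def as_coboundary_def)
qed

lemma as_pullback_cup: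
  assumes "\<phi> \<in> as_cochains Y" "\<psi> \<in> as_cochains Y"
  shows "as_pullback X f (as_cup \<phi> \<psi>) = as_cup (as_pullback X f \<phi>) (as_pullback X f \<psi>)"
proof
  fix xs
  show "as_pullback X f (as_cup \<phi> \<psi>) xs = as_cup (as_pullback X f \<phi>) (as_pullback X f \<psi>) xs"
  proof (cases "set xs \<subseteq> topspace X")
    case True
    then show ?thesis
      by (simp add: as_cup_def as_pullback_def set_take_drop_subset take_map drop_map)
  next
    case False
    have "as_cup (as_pullback X f \<phi>) (as_pullback X f \<psi>) \<in> as_cochains X"
      using assms by (intro as_cup_cochain as_pullback_cochain)
    from as_cochainsD(2)[OF this False] False show ?thesis by (simp add: as_pullback_def)
  qed
qed

lemma as_pullback_pow:
  assumes "f \<in> topspace X \<rightarrow> topspace Y" "\<phi> \<in> as_cochains Y"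
  shows "as_pullback X f (\<phi> [^]\<^bsub>as_cocycle_ring Y\<^esub> (n::nat))
       = as_pullback X f \<phi> [^]\<^bsub>as_cocycle_ring X\<^esub> n"
proof (induction n)
  case 0
  show ?case using assms(1) by (intro ext) (auto simp: as_pullback_def image_subset_iff)
next
  case (Suc n)
  have "\<phi> [^]\<^bsub>as_cocycle_ring Y\<^esub> n \<in> as_cochains Y"
    by (induction n) (auto simp: as_one_cocycle[unfolded One_nat_def] as_cup_cochain assms)
  then show ?case using Suc assms by (simp add: as_pullback_cup)
qed

lemma as_pullback_locally_zero:
  assumes "continuous_map X Y f" "\<theta> \<in> as_locally_zero Y"
  shows "as_pullback X f \<theta> \<in> as_locally_zero X"
proof (rule as_locally_zeroI)
  show "as_pullback X f \<theta> \<in> as_cochains X"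
    using assms as_locally_zero_cochain as_pullback_cochain by blast
  fix x assume x: "x \<in> topspace X"
  then have "f x \<in> topspace Y" using assms(1) by (auto simp: continuous_map_def)
  then obtain U where U: "openin Y U" "f x \<in> U" "\<And>xs. set xs \<subseteq> U \<Longrightarrow> \<theta> xs = 0"
    using assms(2) unfolding as_locally_zero_def by blast
  have "as_pullback X f \<theta> xs = 0" if "set xs \<subseteq> {x \<in> topspace X. f x \<in> U}" for xs
    using U(3)[of "map f xs"] that by (auto simp: as_pullback_def)
  moreover have "openin X {x \<in> topspace X. f x \<in> U}"
    using assms(1) U(1) by (auto simp: continuous_map_def)
  ultimately show "\<exists>U. openin X U \<and> x \<in> U \<and> (\<forall>xs. set xs \<subseteq> U \<longrightarrow> as_pullback X f \<theta> xs = 0)"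
    using x U(2) by blast
qed

lemma as_boundary_idealI:
  assumes "\<psi> \<in> as_cochains X" "\<theta> \<in> as_locally_zero X" "\<And>xs. \<phi> xs = as_coboundary X \<psi> xs + \<theta> xs"
  shows "\<phi> \<in> as_boundary_ideal X"
  unfolding as_boundary_ideal_def using assms by blast

text \<open>\<open>as_induced\<close> is a union over all representatives of a class. Cohomologous
  cocycles have cohomologous pullbacks, so the union consists of one coset only.\<close>

lemma as_induced_class:
  assumes f: "continuous_map X Y f" and \<phi>: "\<phi> \<in> carrier (as_cocycle_ring Y)"
  shows "as_pullback X f \<phi> \<in> carrier (as_cocycle_ring X)"
    and "as_induced X f (as_class Y \<phi>) = as_class X (as_pullback X f \<phi>)"
proof -
  have f': "f \<in> topspace X \<rightarrow> topspace Y" using f by (auto simp: continuous_map_def)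
  have pb: "as_pullback X f \<eta> \<in> carrier (as_cocycle_ring X)"
    if "\<eta> \<in> carrier (as_cocycle_ring Y)" for \<eta>
    using that as_pullback_locally_zero[OF f]
    by (auto simp: carrier_as_cocycle_ring as_pullback_cochain
        simp flip: as_pullback_coboundary[OF f'])
  show "as_pullback X f \<phi> \<in> carrier (as_cocycle_ring X)" using pb \<phi> .
  interpret ideal "as_boundary_ideal Y" "as_cocycle_ring Y" by (rule as_boundary_ideal)
  have eq: "as_class X (as_pullback X f \<eta>) = as_class X (as_pullback X f \<phi>)"
    if "\<eta> \<in> as_class Y \<phi>" for \<eta>
  proof -
    have \<eta>: "\<eta> \<in> carrier (as_cocycle_ring Y)" using that \<phi> a_elemrcos_carrier by blast
    have "as_class Y \<eta> = as_class Y \<phi>" using that \<phi> a_repr_independence' by blast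
    then have "(\<lambda>xs. \<eta> xs + \<phi> xs) \<in> as_boundary_ideal Y" using \<eta> \<phi> as_class_eq_iff by blast
    then obtain \<psi> \<theta> where c: "\<psi> \<in> as_cochains Y" "\<theta> \<in> as_locally_zero Y"
      and "(\<lambda>xs. \<eta> xs + \<phi> xs) = (\<lambda>xs. as_coboundary Y \<psi> xs + \<theta> xs)"
      unfolding as_boundary_ideal_def by blast
    then have "\<eta> xs + \<phi> xs = as_coboundary Y \<psi> xs + \<theta> xs" for xs by metis
    with c have "(\<lambda>xs. as_pullback X f \<eta> xs + as_pullback X f \<phi> xs) \<in> as_boundary_ideal X"
      using f by (intro as_boundary_idealI[of "as_pullback X f \<psi>" _ "as_pullback X f \<theta>"])
        (simp_all add: as_pullback_cochain as_pullback_locally_zero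
          as_pullback_def[of _ _ "as_coboundary Y \<psi>"] as_pullback_def[of _ _ \<theta>]
          as_pullback_def[of _ _ \<eta>] as_pullback_def[of _ _ \<phi>]
          flip: as_pullback_coboundary[OF f'])
    then show ?thesis using as_class_eq_iff pb \<eta> \<phi> by blast
  qed
  moreover have "\<phi> \<in> as_class Y \<phi>" using \<phi> a_rcos_self by blast
  ultimately show "as_induced X f (as_class Y \<phi>) = as_class X (as_pullback X f \<phi>)"
    unfolding as_induced_def by blast
qed

section \<open>The degree-one class of an antipodal double covering\<close>

text \<open>The notion has to cover spheres of real sequences as well as subsets of a normed space.
  The class \<open>uminus\<close> carries no axioms, so involutivity is part of the
  definition.\<close>

definition antipodal :: "'a::uminus topology \<Rightarrow> bool" where
  "antipodal X \<longleftrightarrow> (\<forall>x\<in>topspace X. - (- x) = x) \<and> continuous_map X X uminus"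

lemma antipodalD:
  assumes "antipodal X" "x \<in> topspace X"
  shows "- x \<in> topspace X" "- (- x) = x"
  using assms by (auto simp: antipodal_def continuous_map_def)

lemma orbit_eq_iff:
  assumes "antipodal X" "x \<in> topspace X" "y \<in> topspace X"
  shows "{x, -x} = {y, -y} \<longleftrightarrow> x = y \<or> x = - y"
  using antipodalD[OF assms(1)] assms by (metis doubleton_eq_iff)

lemma topspace_antipodal_quotient:
  "topspace (antipodal_quotient X) = (\<lambda>x. {x, -x}) ` topspace X"
proof (rule subset_antisym)
  show "topspace (antipodal_quotient X) \<subseteq> (\<lambda>x. {x, -x}) ` topspace X"
    using openin_topspace[of "antipodal_quotient X"] unfolding openin_antipodal_quotient by blast
  have "{x \<in> topspace X. {x, -x} \<in> (\<lambda>x. {x, -x}) ` topspace X} = topspace X" by blast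
  then have "openin (antipodal_quotient X) ((\<lambda>x. {x, -x}) ` topspace X)"
    by (simp add: openin_antipodal_quotient)
  then show "(\<lambda>x. {x, -x}) ` topspace X \<subseteq> topspace (antipodal_quotient X)"
    by (rule openin_subset)
qed

text \<open>The saturation of \<open>U\<close> is the union of \<open>U\<close> and its mirror
  image, both open, so the projection onto the orbits is an open map.\<close>

lemma openin_antipodal_quotient_image:
  assumes "antipodal X" "openin X U"
  shows "openin (antipodal_quotient X) ((\<lambda>x. {x, -x}) ` U)"
proof -
  have U: "U \<subseteq> topspace X" using assms(2) openin_subset by blast
  have "{x \<in> topspace X. {x, -x} \<in> (\<lambda>x. {x, -x}) ` U} = U \<union> {x \<in> topspace X. - x \<in> U}"
  proof (intro equalityI subsetI)
    fix x assume "x \<in> {x \<in> topspace X. {x, -x} \<in> (\<lambda>x. {x, -x}) ` U}"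
    then obtain y where y: "x \<in> topspace X" "y \<in> U" "{x, -x} = {y, -y}" by blast
    then have "x = y \<or> x = - y" using orbit_eq_iff[OF assms(1)] U by blast
    then show "x \<in> U \<union> {x \<in> topspace X. - x \<in> U}"
      using y U antipodalD[OF assms(1), of y] by auto
  next
    fix x assume x: "x \<in> U \<union> {x \<in> topspace X. - x \<in> U}"
    show "x \<in> {x \<in> topspace X. {x, -x} \<in> (\<lambda>x. {x, -x}) ` U}"
    proof (cases "x \<in> U")
      case False
      with x have x: "x \<in> topspace X" "- x \<in> U" by auto
      moreover have "{x, -x} = {- x, - (- x)}" using antipodalD[OF assms(1) x(1)] by auto
      ultimately show ?thesis by blast
    qed (use U in auto)
  qed
  moreover have "openin X {x \<in> topspace X. - x \<in> U}"
    using assms unfolding antipodal_def continuous_map_def by blast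
  ultimately show ?thesis using U assms(2) by (auto simp: openin_antipodal_quotient)
qed

text \<open>The projection is continuous and open, so local vanishing on the orbit space can be
  tested on neighbourhoods in \<open>X\<close> itself. All later local arguments take place
  there.\<close>

lemma as_locally_zero_antipodal_iff:
  assumes "antipodal X"
  shows "\<theta> \<in> as_locally_zero (antipodal_quotient X) \<longleftrightarrow>
    \<theta> \<in> as_cochains (antipodal_quotient X) \<and>
    (\<forall>x\<in>topspace X. \<exists>U. openin X U \<and> x \<in> U \<and>
       (\<forall>ys. set ys \<subseteq> U \<longrightarrow> \<theta> (map (\<lambda>y. {y, -y}) ys) = 0))"
    (is "?L \<longleftrightarrow> ?C \<and> ?R")
proof (intro iffI conjI)
  assume L: ?L
  then show ?C by (rule as_locally_zero_cochain)
  show ?R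
  proof
    fix x assume x: "x \<in> topspace X"
    then have "{x, -x} \<in> topspace (antipodal_quotient X)"
      by (auto simp: topspace_antipodal_quotient)
    then obtain V where V: "openin (antipodal_quotient X) V" "{x, -x} \<in> V"
      "\<And>xs. set xs \<subseteq> V \<Longrightarrow> \<theta> xs = 0"
      using L unfolding as_locally_zero_def by blast
    have "\<theta> (map (\<lambda>y. {y, -y}) ys) = 0" if "set ys \<subseteq> {x \<in> topspace X. {x, -x} \<in> V}" for ys
      using that by (intro V(3)) auto
    then show "\<exists>U. openin X U \<and> x \<in> U \<and> (\<forall>ys. set ys \<subseteq> U \<longrightarrow> \<theta> (map (\<lambda>y. {y, -y}) ys) = 0)"
      using V x by (intro exI[of _ "{x \<in> topspace X. {x, -x} \<in> V}"])
        (auto simp: openin_antipodal_quotient)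
  qed
next
  assume CR: "?C \<and> ?R"
  show ?L
  proof (rule as_locally_zeroI)
    fix q assume "q \<in> topspace (antipodal_quotient X)"
    then obtain x where x: "x \<in> topspace X" "q = {x, -x}"
      by (auto simp: topspace_antipodal_quotient)
    then obtain U where U: "openin X U" "x \<in> U"
      "\<And>ys. set ys \<subseteq> U \<Longrightarrow> \<theta> (map (\<lambda>y. {y, -y}) ys) = 0"
      using CR by blast
    have "\<theta> xs = 0" if "set xs \<subseteq> (\<lambda>y. {y, -y}) ` U" for xs
    proof -
      from that have "xs \<in> lists ((\<lambda>y. {y, -y}) ` U)" by auto
      then obtain ys where "ys \<in> lists U" "xs = map (\<lambda>y. {y, -y}) ys"
        unfolding lists_image by blast
      then show ?thesis using U(3) by auto
    qed
    then show "\<exists>V. openin (antipodal_quotient X) V \<and> q \<in> V \<and> (\<forall>xs. set xs \<subseteq> V \<longrightarrow> \<theta> xs = 0)"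
      using openin_antipodal_quotient_image[OF assms U(1)] U(2) x(2) by blast
  qed (use CR in blast)
qed

text \<open>
  A cochain representing the class of the double covering \<open>X \<rightarrow> X/\<int>\<^sub>2\<close>: a section of the covering,
  which need not be continuous, is encoded by a function \<open>g\<close> with \<open>g (- x) = g x + 1\<close>.
\<close>

definition double_cover_cocycle ::
    "'a::uminus topology \<Rightarrow> ('a \<Rightarrow> bit) \<Rightarrow> ('a set list \<Rightarrow> bit) \<Rightarrow> bool" where
  "double_cover_cocycle X g \<phi> \<longleftrightarrow>
     \<phi> \<in> as_cochains (antipodal_quotient X) \<and> (\<forall>xs. \<phi> xs \<noteq> 0 \<longrightarrow> length xs = 2) \<and>
     (\<forall>x\<in>topspace X. g (- x) = g x + 1) \<and>
     (\<forall>x\<in>topspace X. \<exists>U. openin X U \<and> x \<in> U \<and>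
        (\<forall>y\<in>U. \<forall>z\<in>U. \<phi> [{y, -y}, {z, -z}] = g y + g z))"

lemma as_coboundary_two:
  "a \<in> topspace X \<Longrightarrow> b \<in> topspace X \<Longrightarrow> as_coboundary X \<phi> [a, b] = \<phi> [b] + \<phi> [a]"
  by (simp add: as_coboundary_def lessThan_Suc)

lemma as_coboundary_three:
  "a \<in> topspace X \<Longrightarrow> b \<in> topspace X \<Longrightarrow> c \<in> topspace X \<Longrightarrow>
   as_coboundary X \<phi> [a, b, c] = \<phi> [b, c] + \<phi> [a, c] + \<phi> [a, b]"
  by (simp add: as_coboundary_def lessThan_Suc add_ac)

lemma as_coboundary_degree:
  assumes "\<forall>xs. \<phi> xs \<noteq> 0 \<longrightarrow> length xs = n" "length xs \<noteq> Suc n"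
  shows "as_coboundary X \<phi> xs = 0"
proof -
  have "\<phi> (take i xs @ drop (Suc i) xs) = 0" if "i < length xs" for i
  proof -
    have "length (take i xs @ drop (Suc i) xs) \<noteq> n" using assms(2) that by auto
    then show ?thesis using assms(1) by blast
  qed
  then show ?thesis by (simp add: as_coboundary_def)
qed

text \<open>On small sets of \<open>X\<close> the cochain is the coboundary of \<open>g\<close>,
  although \<open>g\<close> does not descend to the orbits. In the coboundary of
  \<open>\<phi>\<close> each of the three values of \<open>g\<close> therefore occurs twice.\<close>

lemma double_cover_cocycle_in_carrier:
  assumes X: "antipodal X" and \<phi>: "double_cover_cocycle X g \<phi>"
  shows "\<phi> \<in> carrier (as_cocycle_ring (antipodal_quotient X))"
  unfolding carrier_as_cocycle_ring as_locally_zero_antipodal_iff[OF X]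
proof (intro conjI ballI)
  show c: "\<phi> \<in> as_cochains (antipodal_quotient X)"
    using \<phi> by (simp add: double_cover_cocycle_def)
  then show "as_coboundary (antipodal_quotient X) \<phi> \<in> as_cochains (antipodal_quotient X)"
    by (rule as_coboundary_cochain)
  fix x assume "x \<in> topspace X"
  then obtain U where U: "openin X U" "x \<in> U"
      "\<forall>y\<in>U. \<forall>z\<in>U. \<phi> [{y, -y}, {z, -z}] = g y + g z"
    using \<phi> unfolding double_cover_cocycle_def by blast
  have "as_coboundary (antipodal_quotient X) \<phi> (map (\<lambda>y. {y, -y}) ys) = 0" if "set ys \<subseteq> U" for ys
  proof (cases "length ys = 3")
    case True
    then obtain a b c where ys: "ys = [a, b, c]"
      by (auto simp: numeral_3_eq_3 length_Suc_conv)
    have "{a, b, c} \<subseteq> topspace X" using that ys U(1) openin_subset by fastforce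
    then have "as_coboundary (antipodal_quotient X) \<phi> (map (\<lambda>y. {y, -y}) ys)
        = (g b + g c) + (g a + g c) + (g a + g b)"
      using that ys U(3) by (simp add: as_coboundary_three topspace_antipodal_quotient)
    also have "\<dots> = 0" by (cases "g a"; cases "g b"; cases "g c"; simp)
    finally show ?thesis .
  next
    case False
    then show ?thesis
      using \<phi> by (intro as_coboundary_degree[of _ 2]) (auto simp: double_cover_cocycle_def)
  qed
  then show "\<exists>U. openin X U \<and> x \<in> U \<and> (\<forall>ys. set ys \<subseteq> U \<longrightarrow>
      as_coboundary (antipodal_quotient X) \<phi> (map (\<lambda>y. {y, -y}) ys) = 0)"
    using U(1,2) by blast
qed

text \<open>An even potential descends to the 0-cochain \<open>\<psi>\<close> on the orbit space,
  and the coboundary of \<open>\<psi>\<close> agrees with \<open>\<phi>\<close> on small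
  sets.\<close>

lemma even_local_potential_boundary:
  assumes X: "antipodal X" and \<phi>: "\<phi> \<in> as_cochains (antipodal_quotient X)"
    and deg: "\<forall>xs. \<phi> xs \<noteq> 0 \<longrightarrow> length xs = 2"
    and even: "\<forall>x\<in>topspace X. h (- x) = h x"
    and loc: "\<forall>x\<in>topspace X. \<exists>U. openin X U \<and> x \<in> U \<and>
        (\<forall>y\<in>U. \<forall>z\<in>U. \<phi> [{y, -y}, {z, -z}] = h y + h z)"
  shows "\<phi> \<in> as_boundary_ideal (antipodal_quotient X)"
proof -
  let ?Q = "antipodal_quotient X"
  define \<psi> :: "'a set list \<Rightarrow> bit" where
    "\<psi> = (\<lambda>xs. if \<exists>x\<in>topspace X. xs = [{x, -x}] \<and> h x = 1 then 1 else 0)"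
  have \<psi>1: "\<psi> [{x, -x}] = h x" if "x \<in> topspace X" for x
  proof -
    have "h y = h x" if "y \<in> topspace X" "{x, -x} = {y, -y}" for y
      using orbit_eq_iff[OF X \<open>x \<in> topspace X\<close> that(1)] that even by auto
    then show ?thesis using that unfolding \<psi>_def by (cases "h x") auto
  qed
  have \<psi>deg: "\<forall>xs. \<psi> xs \<noteq> 0 \<longrightarrow> length xs = 1" by (auto simp: \<psi>_def)
  have \<psi>c: "\<psi> \<in> as_cochains ?Q"
    by (rule as_cochainsI[where n=1]) (auto simp: \<psi>_def topspace_antipodal_quotient)
  show ?thesis
  proof (rule as_boundary_idealI[OF \<psi>c])
    show "(\<lambda>xs. \<phi> xs + as_coboundary ?Q \<psi> xs) \<in> as_locally_zero ?Q"
      unfolding as_locally_zero_antipodal_iff[OF X]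
    proof (intro conjI ballI as_add_cochain as_coboundary_cochain \<phi> \<psi>c)
      fix x assume "x \<in> topspace X"
      then obtain U where U: "openin X U" "x \<in> U"
        "\<forall>y\<in>U. \<forall>z\<in>U. \<phi> [{y, -y}, {z, -z}] = h y + h z"
        using loc by blast
      have "\<phi> (map (\<lambda>y. {y, -y}) ys) + as_coboundary ?Q \<psi> (map (\<lambda>y. {y, -y}) ys) = 0"
        if "set ys \<subseteq> U" for ys
      proof (cases "length ys = 2")
        case True
        then obtain a b where ys: "ys = [a, b]"
          by (auto simp: numeral_2_eq_2 length_Suc_conv)
        have "{a, b} \<subseteq> topspace X" using that ys U(1) openin_subset by fastforce
        then show ?thesis
          using that ys U(3) by (simp add: as_coboundary_two topspace_antipodal_quotient \<psi>1 add.commute)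
      next
        case False
        then have "\<phi> (map (\<lambda>y. {y, -y}) ys) = 0" using deg by force
        moreover have "as_coboundary ?Q \<psi> (map (\<lambda>y. {y, -y}) ys) = 0"
          using False by (intro as_coboundary_degree[OF \<psi>deg]) simp
        ultimately show ?thesis by simp
      qed
      then show "\<exists>U. openin X U \<and> x \<in> U \<and> (\<forall>ys. set ys \<subseteq> U \<longrightarrow>
          \<phi> (map (\<lambda>y. {y, -y}) ys) + as_coboundary ?Q \<psi> (map (\<lambda>y. {y, -y}) ys) = 0)"
        using U(1,2) by blast
    qed
  qed (metis add.commute bit_add_cancel(2) add.assoc)
qed

text \<open>The sum of two odd potentials is even because the two ones cancel modulo 2. The sum of
  the two cocycles thus has an even potential and is a boundary.\<close>

lemma double_cover_cocycle_unique:
  assumes X: "antipodal X" and "double_cover_cocycle X g \<phi>" "double_cover_cocycle X g' \<phi>'"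
  shows "as_class (antipodal_quotient X) \<phi> = as_class (antipodal_quotient X) \<phi>'"
proof -
  have "(\<lambda>xs. \<phi> xs + \<phi>' xs) \<in> as_boundary_ideal (antipodal_quotient X)"
  proof (rule even_local_potential_boundary[OF X, of _ "\<lambda>x. g x + g' x"])
    show "\<forall>x\<in>topspace X. g (- x) + g' (- x) = g x + g' x"
      using assms(2,3) by (simp add: double_cover_cocycle_def ac_simps)
    show "\<forall>x\<in>topspace X. \<exists>U. openin X U \<and> x \<in> U \<and> (\<forall>y\<in>U. \<forall>z\<in>U.
        \<phi> [{y, -y}, {z, -z}] + \<phi>' [{y, -y}, {z, -z}] = g y + g' y + (g z + g' z))"
    proof
      fix x assume x: "x \<in> topspace X"
      obtain U where U: "openin X U" "x \<in> U"
        "\<forall>y\<in>U. \<forall>z\<in>U. \<phi> [{y, -y}, {z, -z}] = g y + g z"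
        using assms(2) x unfolding double_cover_cocycle_def by blast
      obtain V where V: "openin X V" "x \<in> V"
        "\<forall>y\<in>V. \<forall>z\<in>V. \<phi>' [{y, -y}, {z, -z}] = g' y + g' z"
        using assms(3) x unfolding double_cover_cocycle_def by blast
      show "\<exists>U. openin X U \<and> x \<in> U \<and> (\<forall>y\<in>U. \<forall>z\<in>U.
        \<phi> [{y, -y}, {z, -z}] + \<phi>' [{y, -y}, {z, -z}] = g y + g' y + (g z + g' z))"
        using U V by (intro exI[of _ "U \<inter> V"]) (auto simp: ac_simps)
    qed
    show "\<forall>xs. \<phi> xs + \<phi>' xs \<noteq> 0 \<longrightarrow> length xs = 2"
      using assms(2,3) unfolding double_cover_cocycle_def by (metis add.right_neutral)
  qed (use assms(2,3) in \<open>auto simp: double_cover_cocycle_def as_add_cochain\<close>)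
  then show ?thesis
    using as_class_eq_iff double_cover_cocycle_in_carrier[OF X] assms(2,3) by blast
qed

text \<open>Apart from oddness only \<open>loc\<close> is asked of \<open>F\<close>: near each
  point, \<open>g\<close> composed with \<open>F\<close> must be a potential of the pulled back
  cochain. Continuous lifts of classifying maps qualify, and so do sufficiently fine discontinuous
  maps.\<close>

lemma double_cover_cocycle_pullback:
  assumes X: "antipodal X" and \<phi>: "double_cover_cocycle Y g \<phi>"
    and F: "\<And>x. x \<in> topspace X \<Longrightarrow> F x \<in> topspace Y"
    and odd: "\<And>x. x \<in> topspace X \<Longrightarrow> F (- x) = - F x \<and> f {x, -x} = {F x, - F x}"
    and loc: "\<And>x. x \<in> topspace X \<Longrightarrow> \<exists>U. openin X U \<and> x \<in> U \<and>
       (\<forall>y\<in>U. \<forall>z\<in>U. \<phi> [{F y, - F y}, {F z, - F z}] = g (F y) + g (F z))"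
  shows "double_cover_cocycle X (g \<circ> F) (as_pullback (antipodal_quotient X) f \<phi>)"
  unfolding double_cover_cocycle_def
proof (intro conjI ballI)
  show "as_pullback (antipodal_quotient X) f \<phi> \<in> as_cochains (antipodal_quotient X)"
    using \<phi> as_pullback_cochain unfolding double_cover_cocycle_def by blast
  show "\<forall>xs. as_pullback (antipodal_quotient X) f \<phi> xs \<noteq> 0 \<longrightarrow> length xs = 2"
    using \<phi> unfolding double_cover_cocycle_def as_pullback_def by (metis length_map)
  fix x assume x: "x \<in> topspace X"
  show "(g \<circ> F) (- x) = (g \<circ> F) x + 1"
    using \<phi> odd F x unfolding double_cover_cocycle_def by simp
  obtain U where U: "openin X U" "x \<in> U"
    "\<forall>y\<in>U. \<forall>z\<in>U. \<phi> [{F y, - F y}, {F z, - F z}] = g (F y) + g (F z)"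
    using loc[OF x] by blast
  have "U \<subseteq> topspace X" using U(1) openin_subset by blast
  then have "as_pullback (antipodal_quotient X) f \<phi> [{y, -y}, {z, -z}] = (g \<circ> F) y + (g \<circ> F) z"
    if "y \<in> U" "z \<in> U" for y z
    using U(3) odd that
    by (auto simp: as_pullback_def topspace_antipodal_quotient subset_iff)
  then show "\<exists>U. openin X U \<and> x \<in> U \<and> (\<forall>y\<in>U. \<forall>z\<in>U.
      as_pullback (antipodal_quotient X) f \<phi> [{y, -y}, {z, -z}] = (g \<circ> F) y + (g \<circ> F) z)"
    using U(1,2) by blast
qed

text \<open>
  The map \<open>F\<close> need not be continuous: it only has to be fine enough for the two cochains
  involved. This is what makes the tautness argument work with nearest point maps.
\<close>

lemma double_cover_pow_boundary_pullback:
  assumes X: "antipodal X" and w: "double_cover_cocycle X g' w"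
    and \<phi>: "double_cover_cocycle Y g \<phi>"
    and eq: "\<And>xs. (\<phi> [^]\<^bsub>as_cocycle_ring (antipodal_quotient Y)\<^esub> (n::nat)) xs
          = as_coboundary (antipodal_quotient Y) \<psi> xs + \<theta> xs"
    and \<psi>: "\<psi> \<in> as_cochains (antipodal_quotient Y)" and \<theta>: "\<theta> \<in> as_cochains (antipodal_quotient Y)"
    and F: "\<And>x. x \<in> topspace X \<Longrightarrow> F x \<in> topspace Y \<and> F (- x) = - F x"
    and loc: "\<And>x. x \<in> topspace X \<Longrightarrow> \<exists>U. openin X U \<and> x \<in> U \<and>
       (\<forall>y\<in>U. \<forall>z\<in>U. \<phi> [{F y, - F y}, {F z, - F z}] = g (F y) + g (F z)) \<and>
       (\<forall>ys. set ys \<subseteq> U \<longrightarrow> \<theta> (map (\<lambda>y. {F y, - F y}) ys) = 0)"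
  shows "w [^]\<^bsub>as_cocycle_ring (antipodal_quotient X)\<^esub> n \<in> as_boundary_ideal (antipodal_quotient X)"
proof -
  let ?QX = "antipodal_quotient X" and ?QY = "antipodal_quotient Y"
  let ?R = "as_cocycle_ring ?QX"
  let ?pb = "as_pullback ?QX (image F)"
  have img: "F ` {x, -x} = {F x, - F x}" if "x \<in> topspace X" for x using F[OF that] by auto
  have im: "image F \<in> topspace ?QX \<rightarrow> topspace ?QY"
    using F img unfolding topspace_antipodal_quotient by blast
  have w': "double_cover_cocycle X (g \<circ> F) (?pb \<phi>)"
  proof (rule double_cover_cocycle_pullback[OF X \<phi>])
    fix x assume "x \<in> topspace X"
    from loc[OF this] show "\<exists>U. openin X U \<and> x \<in> U \<and>
       (\<forall>y\<in>U. \<forall>z\<in>U. \<phi> [{F y, - F y}, {F z, - F z}] = g (F y) + g (F z))" by blast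
  qed (use F img in auto)
  have \<phi>c: "\<phi> \<in> as_cochains ?QY" using \<phi> by (simp add: double_cover_cocycle_def)
  have "?pb (\<phi> [^]\<^bsub>as_cocycle_ring ?QY\<^esub> n) \<in> as_boundary_ideal ?QX"
  proof (rule as_boundary_idealI[of "?pb \<psi>" _ "?pb \<theta>"])
    show "?pb \<psi> \<in> as_cochains ?QX" using \<psi> by (rule as_pullback_cochain)
    show "?pb \<theta> \<in> as_locally_zero ?QX"
      unfolding as_locally_zero_antipodal_iff[OF X]
    proof (intro conjI ballI)
      show "?pb \<theta> \<in> as_cochains ?QX" using \<theta> by (rule as_pullback_cochain)
      fix x assume "x \<in> topspace X"
      from loc[OF this] obtain U where U: "openin X U" "x \<in> U"
        "\<forall>ys. set ys \<subseteq> U \<longrightarrow> \<theta> (map (\<lambda>y. {F y, - F y}) ys) = 0"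
        by (elim exE conjE) (rule that)
      have "?pb \<theta> (map (\<lambda>y. {y, -y}) ys) = 0" if "set ys \<subseteq> U" for ys
      proof -
        have "set ys \<subseteq> topspace X" using that U(1) openin_subset by blast
        then have "map (image F) (map (\<lambda>y. {y, -y}) ys) = map (\<lambda>y. {F y, - F y}) ys"
          using img by (auto simp del: image_insert)
        then show ?thesis using U(3) that by (simp add: as_pullback_def del: map_map)
      qed
      then show "\<exists>U. openin X U \<and> x \<in> U \<and> (\<forall>ys. set ys \<subseteq> U \<longrightarrow> ?pb \<theta> (map (\<lambda>y. {y, -y}) ys) = 0)"
        using U by blast
    qed
    show "?pb (\<phi> [^]\<^bsub>as_cocycle_ring ?QY\<^esub> n) xs = as_coboundary ?QX (?pb \<psi>) xs + ?pb \<theta> xs" for xs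
      unfolding as_pullback_coboundary[OF im, symmetric] by (simp add: as_pullback_def eq)
  qed
  then have "?pb \<phi> [^]\<^bsub>?R\<^esub> n \<in> as_boundary_ideal ?QX"
    by (simp add: as_pullback_pow[OF im \<phi>c])
  \<comment> \<open>Both cochains are double cover cocycles on \<open>X\<close>, hence cohomologous,
    and so are their powers.\<close>
  moreover have "as_class ?QX (w [^]\<^bsub>?R\<^esub> n) = as_class ?QX (?pb \<phi> [^]\<^bsub>?R\<^esub> n)"
    using double_cover_cocycle_unique[OF X w w'] double_cover_cocycle_in_carrier[OF X] w w'
    by (simp flip: as_class_pow)
  ultimately show ?thesis
    using double_cover_cocycle_in_carrier[OF X] w w' as_cocycle_pow_closed as_class_eq_zero_iff
    by metis
qed

text \<open>
  Two orbits near each other are compared through their nearest representatives.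
\<close>

lemma double_cover_cocycle_exists:
  fixes X :: "'a::{metric_space, uminus} topology"
  assumes X: "antipodal X" and ne: "\<And>x. x \<in> topspace X \<Longrightarrow> x \<noteq> - x"
    and iso: "\<And>x y. x \<in> topspace X \<Longrightarrow> y \<in> topspace X \<Longrightarrow> dist (- x) (- y) = dist x y"
    and ball: "\<And>x r. openin X (topspace X \<inter> ball x r)"
  obtains g \<phi> where "double_cover_cocycle X g \<phi>"
proof -
  \<comment> \<open>The choice depends on the orbit only as a set, so exactly one of
    \<open>x\<close> and \<open>- x\<close> receives the value 1.\<close>
  define g where "g x = (if (SOME y. y \<in> {x, -x}) = x then 1 else 0 :: bit)" for x :: 'a
  have g: "g (- x) = g x + 1" if x: "x \<in> topspace X" for x
  proof -
    have eq: "{- x, - (- x)} = {x, - x}" using antipodalD[OF X x] by auto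
    have "(SOME y. y \<in> {x, -x}) \<in> {x, -x}" by (rule someI[of _ x]) simp
    then show ?thesis using ne[OF x] unfolding g_def eq by auto
  qed
  define P where "P x y \<longleftrightarrow> dist x y < dist x (- y) \<and> g x \<noteq> g y" for x y :: 'a
  define \<phi> where "\<phi> xs = (if \<exists>x\<in>topspace X. \<exists>y\<in>topspace X. xs = [{x, -x}, {y, -y}] \<and> P x y
      then 1 else 0 :: bit)" for xs
  have sym: "dist (- x) y = dist x (- y)" if "x \<in> topspace X" "y \<in> topspace X" for x y
    using iso[of x "- y"] antipodalD[OF X] that by simp
  have \<phi>: "\<phi> [{x, -x}, {y, -y}] = g x + g y"
    if xy: "x \<in> topspace X" "y \<in> topspace X" and d: "dist x y < dist x (- y)" for x y
  proof -
    have "g u \<noteq> g v \<longleftrightarrow> g x \<noteq> g y"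
      if "u \<in> topspace X" "v \<in> topspace X" "{x, -x} = {u, -u}" "{y, -y} = {v, -v}"
        and uv: "dist u v < dist u (- v)" for u v
    proof -
      have u: "x = u \<or> x = - u" and v: "y = v \<or> y = - v" using that xy orbit_eq_iff[OF X] by auto
      \<comment> \<open>The strict inequality fixes a pair of representatives up to a simultaneous
        change of sign, which alters both values of \<open>g\<close> and leaves their sum
        unchanged.\<close>
      have "x = u \<longleftrightarrow> y = v"
        using u v d uv that(1,2) iso[OF that(1,2)] sym[OF that(1,2)] antipodalD[OF X that(1)] antipodalD[OF X that(2)]
        by (auto simp: iso[OF that(1), of "-v"])
      with u v show ?thesis
        using g that(1,2) by (cases "g u"; cases "g v") auto
    qed
    then have "(\<exists>u\<in>topspace X. \<exists>v\<in>topspace X. [{x, -x}, {y, -y}] = [{u, -u}, {v, -v}] \<and> P u v)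
        \<longleftrightarrow> g x \<noteq> g y"
      using xy d unfolding P_def by blast
    then show ?thesis unfolding \<phi>_def by (cases "g x"; cases "g y") auto
  qed
  have "double_cover_cocycle X g \<phi>"
    unfolding double_cover_cocycle_def
  proof (intro conjI ballI)
    show "\<phi> \<in> as_cochains (antipodal_quotient X)"
      by (rule as_cochainsI[where n=2]) (auto simp: \<phi>_def topspace_antipodal_quotient)
    show "\<forall>xs. \<phi> xs \<noteq> 0 \<longrightarrow> length xs = 2" by (auto simp: \<phi>_def)
    fix x assume x: "x \<in> topspace X"
    then show "g (- x) = g x + 1" by (rule g)
    \<comment> \<open>Two points \<open>y\<close>, \<open>z\<close> of the ball are less than
      \<open>2 * r\<close> apart, while \<open>y\<close> and \<open>- z\<close> are more than
      \<open>4 * r - 2 * r\<close> apart. So \<open>z\<close> is the representative of its orbit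
      nearer to \<open>y\<close>.\<close>
    define r where "r = dist x (- x) / 4"
    have r: "r > 0" using ne[OF x] by (simp add: r_def)
    let ?U = "topspace X \<inter> ball x r"
    have "\<phi> [{y, -y}, {z, -z}] = g y + g z" if "y \<in> ?U" "z \<in> ?U" for y z
    proof (rule \<phi>)
      have "dist y z < 2 * r" using that dist_triangle_less_add[of y x r z r] by (simp add: dist_commute)
      moreover have "dist x (- x) \<le> dist x y + dist y (- z) + dist (- z) (- x)"
        using dist_triangle[of x "- x" y] dist_triangle[of y "- x" "- z"] by linarith
      moreover have "dist (- z) (- x) = dist z x" using iso that x by auto
      ultimately show "dist y z < dist y (- z)" using that by (simp add: r_def dist_commute)
    qed (use that in auto)
    then show "\<exists>U. openin X U \<and> x \<in> U \<and> (\<forall>y\<in>U. \<forall>z\<in>U. \<phi> [{y, -y}, {z, -z}] = g y + g z)"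
      using ball[of x r] x r by (intro exI[of _ ?U]) auto
  qed
  then show thesis by (rule that)
qed

section \<open>Degree-one cocycles on the infinite-dimensional sphere\<close>

lemma mem_topspace_nsphere:
  "x \<in> topspace (nsphere n) \<longleftrightarrow> (\<Sum>i\<le>n. (x i)\<^sup>2) = 1 \<and> (\<forall>i>n. x i = 0)"
  by (simp add: nsphere)

lemma nsphere_top_of_set: "nsphere n = top_of_set (topspace (nsphere n))"
  by (simp add: nsphere euclidean_product_topology)

lemma topspace_nsphere_mono:
  assumes "m \<le> n"
  shows "topspace (nsphere m) \<subseteq> topspace (nsphere n)"
proof
  fix x assume x: "x \<in> topspace (nsphere m)"
  then have "(\<Sum>i\<le>n. (x i)\<^sup>2) = (\<Sum>i\<le>m. (x i)\<^sup>2)"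
    using assms by (intro sum.mono_neutral_right) (auto simp: mem_topspace_nsphere)
  then show "x \<in> topspace (nsphere n)" using x assms by (auto simp: mem_topspace_nsphere)
qed

text \<open>The sphere is a closed subset of the cube of sequences with entries in [-1, 1], which is
  compact by Tychonoff.\<close>

lemma compact_topspace_nsphere: "compact (topspace (nsphere n))"
proof -
  have "compactin (product_topology (\<lambda>i. euclideanreal) UNIV) (PiE UNIV (\<lambda>i. {-1..1::real}))"
    by (subst compactin_PiE) (auto simp: compactin_euclidean_iff)
  then have c: "compact (PiE UNIV (\<lambda>i::nat. {-1..1::real}))"
    by (simp add: euclidean_product_topology)
  have "topspace (nsphere n) = {x. (\<Sum>i\<le>n. (x i)\<^sup>2) = 1} \<inter> {x. \<forall>i. i > n \<longrightarrow> x i = 0}"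
    by (auto simp: mem_topspace_nsphere)
  moreover have "continuous_on UNIV (\<lambda>x::nat \<Rightarrow> real. x i)" for i by simp
  then have "closed {x::nat \<Rightarrow> real. (\<Sum>i\<le>n. (x i)\<^sup>2) = 1}"
    "closed {x::nat \<Rightarrow> real. \<forall>i. i > n \<longrightarrow> x i = 0}"
    by (intro closed_Collect_eq closed_Collect_all closed_Collect_imp continuous_intros; simp)+
  ultimately have "closed (topspace (nsphere n))" by (simp add: closed_Int)
  moreover have "x i \<in> {-1..1}" if "x \<in> topspace (nsphere n)" for x i
  proof (cases "i \<le> n")
    case True
    then have "(x i)\<^sup>2 \<le> (\<Sum>i\<le>n. (x i)\<^sup>2)" by (intro member_le_sum) auto
    also have "\<dots> = 1" using that by (simp add: mem_topspace_nsphere)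
    finally show ?thesis by (simp add: abs_square_le_1 abs_le_iff)
  qed (use that in \<open>simp add: mem_topspace_nsphere\<close>)
  then have "topspace (nsphere n) \<subseteq> PiE UNIV (\<lambda>i. {-1..1})" by auto
  ultimately show ?thesis
    using compact_Int_closed[OF c] by (metis inf.absorb2)
qed

lemma topspace_infinite_sphere: "topspace infinite_sphere = (\<Union>n. topspace (nsphere n))"
proof (rule subset_antisym)
  show "topspace infinite_sphere \<subseteq> (\<Union>n. topspace (nsphere n))"
    using openin_topspace[of infinite_sphere] unfolding openin_infinite_sphere by blast
  have "(\<Union>n. topspace (nsphere n)) \<inter> topspace (nsphere n) = topspace (nsphere n)" for n
    by blast
  then have "openin infinite_sphere (\<Union>n. topspace (nsphere n))"
    by (simp add: openin_infinite_sphere)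
  then show "(\<Union>n. topspace (nsphere n)) \<subseteq> topspace infinite_sphere" by (rule openin_subset)
qed

text \<open>The direct limit topology is at least as fine as the one inherited from the product.
  This provides the open balls required by \<open>double_cover_cocycle_exists\<close>.\<close>

lemma openin_infinite_sphere_open:
  assumes "open T"
  shows "openin infinite_sphere (topspace infinite_sphere \<inter> T)"
proof -
  have "topspace infinite_sphere \<inter> T \<inter> topspace (nsphere n) = topspace (nsphere n) \<inter> T" for n
    by (auto simp: topspace_infinite_sphere)
  moreover have "openin (nsphere n) (topspace (nsphere n) \<inter> T)" for n
    by (subst nsphere_top_of_set) (simp add: openin_open_Int assms)
  ultimately show ?thesis by (auto simp: openin_infinite_sphere topspace_infinite_sphere)
qed

lemma uminus_mem_topspace_nsphere [simp]:
  "- x \<in> topspace (nsphere n) \<longleftrightarrow> x \<in> topspace (nsphere n)"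
  by (simp add: mem_topspace_nsphere)

lemma fun_uminus_uminus: "- (- x) = (x :: 'a \<Rightarrow> 'b::group_add)"
  by (simp add: fun_Compl_def)

lemma antipodal_infinite_sphere: "antipodal infinite_sphere"
  unfolding antipodal_def
proof (intro conjI ballI fun_uminus_uminus)
  have c: "continuous_on S (uminus :: (nat \<Rightarrow> real) \<Rightarrow> _)" for S
  proof -
    have "continuous_on S (\<lambda>x i. - x i :: real)"
      by (intro continuous_on_coordinatewise_then_product continuous_on_minus
          continuous_on_subset[OF continuous_on_product_coordinates]) simp
    then show ?thesis by (simp add: fun_Compl_def[abs_def])
  qed
  show "continuous_map infinite_sphere infinite_sphere uminus"
    unfolding continuous_map_def
  proof (intro conjI allI impI)
    fix U assume U: "openin infinite_sphere U"
    show "openin infinite_sphere {x \<in> topspace infinite_sphere. - x \<in> U}"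
      unfolding openin_infinite_sphere
    proof (intro conjI allI)
      fix n
      have "{x \<in> topspace infinite_sphere. - x \<in> U} \<inter> topspace (nsphere n)
          = topspace (nsphere n) \<inter> uminus -` (U \<inter> topspace (nsphere n))"
        by (auto simp: topspace_infinite_sphere)
      moreover have "openin (top_of_set (topspace (nsphere n))) (U \<inter> topspace (nsphere n))"
        using U by (metis nsphere_top_of_set openin_infinite_sphere)
      then have "openin (top_of_set (topspace (nsphere n)))
         (topspace (nsphere n) \<inter> uminus -` (U \<inter> topspace (nsphere n)))"
        by (intro continuous_openin_preimage[OF c, of _ "topspace (nsphere n)"]) auto
      ultimately show "openin (nsphere n) ({x \<in> topspace infinite_sphere. - x \<in> U} \<inter> topspace (nsphere n))"
        by (subst nsphere_top_of_set) simp
    qed (auto simp: topspace_infinite_sphere)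
  qed (auto simp: topspace_infinite_sphere)
qed

text \<open>
  Inside \<open>S\<^bsup>n+1\<^esup>\<close> the sphere \<open>S\<^sup>n\<close> contracts to the pole; the points of \<open>S\<^sup>n\<close> being
  orthogonal to the pole, the normalising factor does not depend on the point.
\<close>

definition contract_to_pole :: "nat \<Rightarrow> (nat \<Rightarrow> real) \<Rightarrow> real \<Rightarrow> nat \<Rightarrow> real" where
  "contract_to_pole n x t i = ((1 - t) * x i + (if i = Suc n then t else 0)) / sqrt ((1 - t)\<^sup>2 + t\<^sup>2)"

lemma contract_to_pole_denominator: "0 < (1 - t)\<^sup>2 + (t::real)\<^sup>2"
  by (simp add: add_nonneg_eq_0_iff order_less_le)

lemma contract_to_pole_mem:
  assumes "x \<in> topspace (nsphere n)"
  shows "contract_to_pole n x t \<in> topspace (nsphere (Suc n))"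
proof -
  let ?D = "(1 - t)\<^sup>2 + t\<^sup>2"
  have D: "?D > 0" by (rule contract_to_pole_denominator)
  have sq: "(contract_to_pole n x t i)\<^sup>2 = (if i = Suc n then t\<^sup>2 else (1 - t)\<^sup>2 * (x i)\<^sup>2) / ?D" for i
    using D assms by (simp add: contract_to_pole_def power_divide power_mult_distrib mem_topspace_nsphere)
  have "(\<Sum>i\<le>Suc n. (contract_to_pole n x t i)\<^sup>2) = (\<Sum>i\<le>n. (1 - t)\<^sup>2 * (x i)\<^sup>2 / ?D) + t\<^sup>2 / ?D"
    unfolding sq by simp
  also have "(\<Sum>i\<le>n. (1 - t)\<^sup>2 * (x i)\<^sup>2 / ?D) = (1 - t)\<^sup>2 / ?D * (\<Sum>i\<le>n. (x i)\<^sup>2)"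
    by (simp add: sum_distrib_left)
  also have "\<dots> + t\<^sup>2 / ?D = 1"
    using assms D by (simp add: mem_topspace_nsphere flip: add_divide_distrib)
  finally show ?thesis
    using assms by (simp add: mem_topspace_nsphere contract_to_pole_def)
qed

lemma continuous_on_contract_to_pole:
  "continuous_on (S \<times> T) (\<lambda>z. contract_to_pole n (fst z) (snd z))"
proof (rule continuous_on_coordinatewise_then_product)
  fix i
  have "continuous_on (S \<times> T) (\<lambda>z. fst z i)"
    by (rule continuous_on_compose2[OF continuous_on_product_coordinates[of i] continuous_on_fst]) auto
  then have "continuous_on (S \<times> T) (\<lambda>z. ((1 - snd z) * fst z i + (if i = Suc n then snd z else 0))
      / sqrt ((1 - snd z)\<^sup>2 + (snd z)\<^sup>2))"
    using contract_to_pole_denominator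
    by (cases "i = Suc n"; simp; intro continuous_intros; simp add: less_imp_neq[symmetric])
  then show "continuous_on (S \<times> T) (\<lambda>z. contract_to_pole n (fst z) (snd z) i)"
    by (simp add: contract_to_pole_def)
qed

lemma contract_to_pole_ends:
  "contract_to_pole n x 0 = x"
  "x \<in> topspace (nsphere n) \<Longrightarrow> contract_to_pole n x 1 = (\<lambda>i. if i = Suc n then 1 else 0)"
  by (auto simp: contract_to_pole_def)

text \<open>Every point of S^n is joined to the pole by its contraction path inside S^(n+1).
  Assuming local constancy one dimension higher includes the disconnected sphere S^0.\<close>

lemma locally_constant_nsphere:
  assumes loc: "\<And>y. y \<in> topspace (nsphere (Suc n)) \<Longrightarrow>
      \<exists>U. openin (nsphere (Suc n)) U \<and> y \<in> U \<and> (\<forall>z\<in>U. f z = f y)"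
    and "x \<in> topspace (nsphere n)" "x' \<in> topspace (nsphere n)"
  shows "f x = f x'"
proof -
  have pole: "f x = f (\<lambda>i. if i = Suc n then 1 else 0)" if x: "x \<in> topspace (nsphere n)" for x
  proof -
    let ?h = "contract_to_pole n x"
    have "continuous_on {0..1} ((\<lambda>z. contract_to_pole n (fst z) (snd z)) \<circ> (\<lambda>t. (x, t)))"
      by (intro continuous_on_compose continuous_on_subset[OF continuous_on_contract_to_pole[of UNIV UNIV]]
          continuous_intros) auto
    then have c: "continuous_on {0..1} ?h" by (simp add: o_def)
    have "f (?h 0) = f (?h 1)"
    proof (rule connected_local_const[of "{0..1::real}"])
      show "\<forall>a\<in>{0..1}. \<forall>\<^sub>F b in at a within {0..1}. f (?h a) = f (?h b)"
      proof
        fix a :: real assume a: "a \<in> {0..1}"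
        obtain U where U: "openin (nsphere (Suc n)) U" "?h a \<in> U" "\<forall>z\<in>U. f z = f (?h a)"
          using loc contract_to_pole_mem[OF x] by blast
        then obtain T where T: "open T" "U = topspace (nsphere (Suc n)) \<inter> T"
          using nsphere_top_of_set openin_open by metis
        have "(?h \<longlongrightarrow> ?h a) (at a within {0..1})"
          using c a by (simp add: continuous_on_def)
        then have "\<forall>\<^sub>F b in at a within {0..1}. ?h b \<in> T"
          using T U(2) by (intro topological_tendstoD) auto
        then show "\<forall>\<^sub>F b in at a within {0..1}. f (?h a) = f (?h b)"
          by (rule eventually_mono) (use U(3) T(2) contract_to_pole_mem[OF x] in auto)
      qed
    qed auto
    then show ?thesis using x by (simp add: contract_to_pole_ends)
  qed
  show ?thesis using pole[OF assms(2)] pole[OF assms(3)] by simp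
qed

lemma locally_constant_infinite_sphere:
  assumes loc: "\<And>y. y \<in> topspace infinite_sphere \<Longrightarrow>
      \<exists>U. openin infinite_sphere U \<and> y \<in> U \<and> (\<forall>z\<in>U. f z = f y)"
    and "x \<in> topspace infinite_sphere" "x' \<in> topspace infinite_sphere"
  shows "f x = f x'"
proof -
  obtain k l where "x \<in> topspace (nsphere k)" "x' \<in> topspace (nsphere l)"
    using assms(2,3) by (auto simp: topspace_infinite_sphere)
  then have xx: "x \<in> topspace (nsphere (max k l))" "x' \<in> topspace (nsphere (max k l))"
    using topspace_nsphere_mono[of k "max k l"] topspace_nsphere_mono[of l "max k l"] by auto
  show ?thesis
  proof (rule locally_constant_nsphere[OF _ xx])
    fix y assume y: "y \<in> topspace (nsphere (Suc (max k l)))"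
    then have "y \<in> topspace infinite_sphere" by (auto simp: topspace_infinite_sphere)
    with loc obtain U where U: "openin infinite_sphere U" "y \<in> U" "\<forall>z\<in>U. f z = f y" by blast
    then have "openin (nsphere (Suc (max k l))) (U \<inter> topspace (nsphere (Suc (max k l))))"
      by (simp add: openin_infinite_sphere)
    then show "\<exists>U. openin (nsphere (Suc (max k l))) U \<and> y \<in> U \<and> (\<forall>z\<in>U. f z = f y)"
      using y U(2,3) by blast
  qed
qed

text \<open>The cocycle condition in degree one, with degenerate triples included: they force
  \<open>\<psi> a a = 0\<close> and the symmetry of \<open>\<psi>\<close> on
  \<open>U\<close>.\<close>

definition cocycle_on :: "'a set \<Rightarrow> ('a \<Rightarrow> 'a \<Rightarrow> bit) \<Rightarrow> bool" where
  "cocycle_on U \<psi> \<longleftrightarrow> (\<forall>a\<in>U. \<forall>b\<in>U. \<forall>c\<in>U. \<psi> b c + \<psi> a c + \<psi> a b = 0)"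

lemma cocycle_on_add:
  assumes "cocycle_on U \<psi>" "a \<in> U" "b \<in> U" "c \<in> U"
  shows "\<psi> a b + \<psi> b c = \<psi> a c"
  using assms unfolding cocycle_on_def
  by (cases "\<psi> a b"; cases "\<psi> b c"; cases "\<psi> a c"; force)

lemma cocycle_on_refl:
  assumes "cocycle_on U \<psi>" "a \<in> U"
  shows "\<psi> a a = 0"
  using cocycle_on_add[OF assms(1), of a a a] assms(2) by (cases "\<psi> a a") auto

text \<open>
  The potential is the sum of the cocycle along the path of each point. Since the complex is
  taken modulo 2, the sums over the rungs of the ladder between two neighbouring paths telescope.
\<close>

lemma cocycle_homotopy:
  fixes H :: "'a::metric_space \<times> real \<Rightarrow> 'b::topological_space"
  assumes S: "compact S" and H: "continuous_on (S \<times> {0..1}) H" "H \<in> S \<times> {0..1} \<rightarrow> T"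
    and loc: "\<And>y. y \<in> T \<Longrightarrow> \<exists>U. openin (top_of_set T) U \<and> y \<in> U \<and> cocycle_on U \<psi>"
  obtains g e where "0 < e" "\<And>x y. x \<in> S \<Longrightarrow> y \<in> S \<Longrightarrow> dist x y < e \<Longrightarrow>
    g x + g y = \<psi> (H (x, 0)) (H (y, 0)) + \<psi> (H (x, 1)) (H (y, 1))"
proof -
  let ?K = "S \<times> {0..1::real}"
  define \<G> where "\<G> = {G. open G \<and> cocycle_on (H ` (G \<inter> ?K)) \<psi>}"
  have "compact ?K" using S by (simp add: compact_Times)
  moreover have "?K \<subseteq> \<Union>\<G>"
  proof
    fix z assume z: "z \<in> ?K"
    then have "H z \<in> T" using H(2) by blast
    with loc obtain U where U: "openin (top_of_set T) U" "H z \<in> U" "cocycle_on U \<psi>" by blast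
    then obtain O' where O: "open O'" "U = T \<inter> O'" by (auto simp: openin_open)
    then obtain G where G: "open G" "?K \<inter> H -` O' = ?K \<inter> G"
      using continuous_openin_preimage_gen[OF H(1) O(1)] by (auto simp: openin_open)
    have "H ` (G \<inter> ?K) \<subseteq> U"
    proof
      fix y assume "y \<in> H ` (G \<inter> ?K)"
      then obtain w where w: "w \<in> G" "w \<in> ?K" "y = H w" by blast
      then have "w \<in> ?K \<inter> H -` O'" using G(2) by blast
      then show "y \<in> U" using w H(2) O(2) by blast
    qed
    then have "cocycle_on (H ` (G \<inter> ?K)) \<psi>" using U(3) unfolding cocycle_on_def by blast
    moreover have "z \<in> G" using z U(2) O(2) G(2) by blast
    ultimately show "z \<in> \<Union>\<G>" using G(1) by (auto simp: \<G>_def)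
  qed
  ultimately obtain \<epsilon> where \<epsilon>: "0 < \<epsilon>" "\<And>z. z \<in> ?K \<Longrightarrow> \<exists>G\<in>\<G>. ball z \<epsilon> \<subseteq> G"
    by (rule Heine_Borel_lemma) (auto simp: \<G>_def)
  \<comment> \<open>\<open>\<epsilon>\<close> is a Lebesgue number of the cover. Time steps below
    \<open>\<epsilon> / 2\<close> and points less than \<open>\<epsilon> / 2\<close> apart put all
    four corners of a ladder cell into one member of the cover.\<close>
  obtain m :: nat where m: "m > 0" "1 / real m < \<epsilon> / 2"
  proof -
    obtain n where "inverse (real (Suc n)) < \<epsilon> / 2"
      using reals_Archimedean[of "\<epsilon> / 2"] \<epsilon>(1) by auto
    then show thesis by (intro that[of "Suc n"]) (simp_all add: inverse_eq_divide)
  qed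
  define P where "P x i = H (x, real i / real m)" for x i
  define g where "g x = (\<Sum>i<m. \<psi> (P x i) (P x (Suc i)))" for x
  have "g x + g y = \<psi> (H (x, 0)) (H (y, 0)) + \<psi> (H (x, 1)) (H (y, 1))"
    if x: "x \<in> S" and y: "y \<in> S" and d: "dist x y < \<epsilon> / 2" for x y
  proof -
    have rung: "\<psi> (P x i) (P x (Suc i)) + \<psi> (P y i) (P y (Suc i))
        = \<psi> (P x i) (P y i) + \<psi> (P x (Suc i)) (P y (Suc i))" if i: "i < m" for i
    proof -
      let ?z = "(x, real i / real m)"
      have K: "(u, real j / real m) \<in> ?K" if "u \<in> S" "j \<le> m" for u j
        using that m(1) by simp
      then have "?z \<in> ?K" using x i by simp
      then obtain G where G: "G \<in> \<G>" "ball ?z \<epsilon> \<subseteq> G" using \<epsilon>(2) by blast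
      have near: "P u j \<in> H ` (G \<inter> ?K)" if u: "u = x \<or> u = y" and j: "j = i \<or> j = Suc i" for u j
      proof -
        have "dist ?z (u, real j / real m) \<le> dist x u + dist (real i / real m) (real j / real m)"
          unfolding dist_Pair_Pair by (rule sqrt_sum_squares_le_sum) auto
        also have "dist x u < \<epsilon> / 2" using u d \<epsilon>(1) by auto
        also have "dist (real i / real m) (real j / real m) \<le> 1 / real m"
          using j m(1) by (auto simp: dist_real_def simp flip: diff_divide_distrib)
        finally have "dist ?z (u, real j / real m) < \<epsilon>" using m(2) by simp
        then have "(u, real j / real m) \<in> G" using G(2) by (intro subsetD[OF G(2)]) simp
        moreover have "(u, real j / real m) \<in> ?K" using u j x y i by (intro K) auto
        ultimately show ?thesis unfolding P_def by blast
      qed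
      have c: "cocycle_on (H ` (G \<inter> ?K)) \<psi>" using G(1) by (simp add: \<G>_def)
      \<comment> \<open>Both ways around the cell give the value on its diagonal.\<close>
      have "\<psi> (P x i) (P x (Suc i)) + \<psi> (P x (Suc i)) (P y (Suc i))
          = \<psi> (P x i) (P y i) + \<psi> (P y i) (P y (Suc i))"
        using cocycle_on_add[OF c near near near, of x i x "Suc i" y "Suc i"]
          cocycle_on_add[OF c near near near, of x i y i y "Suc i"] by simp
      then show ?thesis
        by (cases "\<psi> (P x i) (P x (Suc i))"; cases "\<psi> (P x (Suc i)) (P y (Suc i))";
            cases "\<psi> (P x i) (P y i)"; cases "\<psi> (P y i) (P y (Suc i))"; simp)
    qed
    have "(\<Sum>i<j. \<psi> (P x i) (P x (Suc i)) + \<psi> (P y i) (P y (Suc i)))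
        = \<psi> (P x 0) (P y 0) + \<psi> (P x j) (P y j)" if "j \<le> m" for j
      using that by (induction j) (auto simp: rung)
    from this[of m] show ?thesis using m(1) by (simp add: g_def sum.distrib P_def)
  qed
  then show thesis using \<epsilon>(1) by (intro that[of "\<epsilon> / 2" g]) auto
qed

text \<open>The infinite sphere has no cohomology in degree one: each S^n contracts in S^(n+1),
  which yields a potential on S^n, and the potentials are adjusted so as to fit together on the
  union.\<close>

lemma infinite_sphere_potential:
  assumes loc: "\<And>y. y \<in> topspace infinite_sphere \<Longrightarrow>
      \<exists>U. openin infinite_sphere U \<and> y \<in> U \<and> cocycle_on U \<psi>"
  obtains g where "\<And>x. x \<in> topspace infinite_sphere \<Longrightarrow>
      \<exists>U. openin infinite_sphere U \<and> x \<in> U \<and> (\<forall>y\<in>U. \<forall>z\<in>U. \<psi> y z = g y + g z)"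
proof -
  define S where "S n = topspace (nsphere n)" for n
  have S_mono: "m \<le> n \<Longrightarrow> S m \<subseteq> S n" for m n
    unfolding S_def by (rule topspace_nsphere_mono)
  have S_sub: "S n \<subseteq> topspace infinite_sphere" for n
    by (auto simp: S_def topspace_infinite_sphere)
  have refl: "\<psi> y y = 0" if y: "y \<in> topspace infinite_sphere" for y
  proof -
    obtain U where "y \<in> U" "cocycle_on U \<psi>" using loc[OF y] by blast
    then show ?thesis by (rule cocycle_on_refl[rotated])
  qed
  have "\<exists>g e. 0 < e \<and> (\<forall>x\<in>S n. \<forall>y\<in>S n. dist x y < e \<longrightarrow> \<psi> x y = g x + g y)" for n
  proof -
    have locS: "\<exists>U. openin (top_of_set (S (Suc n))) U \<and> y \<in> U \<and> cocycle_on U \<psi>"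
      if y: "y \<in> S (Suc n)" for y
    proof -
      obtain U where U: "openin infinite_sphere U" "y \<in> U" "cocycle_on U \<psi>"
        using loc S_sub y by blast
      then have "openin (top_of_set (S (Suc n))) (U \<inter> S (Suc n))"
        using nsphere_top_of_set[of "Suc n"] by (auto simp: S_def openin_infinite_sphere)
      moreover have "cocycle_on (U \<inter> S (Suc n)) \<psi>" using U(3) by (auto simp: cocycle_on_def)
      ultimately show ?thesis using U(2) y by blast
    qed
    obtain g e where ge: "0 < e" "\<And>x y. x \<in> S n \<Longrightarrow> y \<in> S n \<Longrightarrow> dist x y < e \<Longrightarrow>
      g x + g y = \<psi> (contract_to_pole n (fst (x, 0)) (snd (x, 0))) (contract_to_pole n (fst (y, 0)) (snd (y, 0)))
        + \<psi> (contract_to_pole n (fst (x, 1)) (snd (x, 1))) (contract_to_pole n (fst (y, 1)) (snd (y, 1)))"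
      by (rule cocycle_homotopy[where H="\<lambda>z. contract_to_pole n (fst z) (snd z)" and S="S n" and T="S (Suc n)" and \<psi>=\<psi>])
        (use locS in \<open>auto simp: S_def compact_topspace_nsphere continuous_on_contract_to_pole contract_to_pole_mem\<close>)
    \<comment> \<open>At time 0 the contraction is the identity. At time 1 both paths are at the
      pole, so the second term is \<open>\<psi>\<close> of a point with itself and vanishes.\<close>
    have "\<psi> x y = g x + g y" if "x \<in> S n" "y \<in> S n" "dist x y < e" for x y
    proof -
      have "contract_to_pole n x 1 \<in> topspace infinite_sphere"
        using contract_to_pole_mem[of x n 1] that(1) S_sub[of "Suc n"] by (auto simp: S_def)
      then show ?thesis
        using ge(2)[OF that] refl that(1,2) by (simp add: contract_to_pole_ends S_def)
    qed
    then show ?thesis using ge(1) by blast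
  qed
  then obtain G E where E: "\<And>n. 0 < E n"
    and GE: "\<And>n x y. x \<in> S n \<Longrightarrow> y \<in> S n \<Longrightarrow> dist x y < E n \<Longrightarrow> \<psi> x y = G n x + G n y"
    by metis
  define b :: "nat \<Rightarrow> real" where "b = (\<lambda>n. if n = 0 then 1 else 0)"
  have b: "b \<in> S n" for n unfolding b_def S_def by (rule in_topspace_nsphere)
  \<comment> \<open>Potentials on different spheres may differ by a constant. Normalising them to
    vanish at \<open>b\<close>, which lies on every sphere, removes this freedom.\<close>
  define G' where "G' n x = G n x + G n b" for n x
  have G': "\<psi> x y = G' n x + G' n y" if "x \<in> S n" "y \<in> S n" "dist x y < E n" for n x y
    using GE[OF that] unfolding G'_def by (cases "G n x"; cases "G n y"; cases "G n b"; simp)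
  have agree: "G' (Suc n) x = G' m x" if x: "x \<in> S n" and m: "Suc n \<le> m" for n m x
  proof -
    have "G' (Suc n) x + G' m x = G' (Suc n) b + G' m b"
    proof (rule locally_constant_nsphere[of n "\<lambda>x. G' (Suc n) x + G' m x"])
      fix y assume "y \<in> topspace (nsphere (Suc n))"
      then have y: "y \<in> S (Suc n)" by (simp add: S_def)
      let ?U = "S (Suc n) \<inter> ball y (min (E (Suc n)) (E m))"
      have "G' (Suc n) z + G' m z = G' (Suc n) y + G' m y" if "z \<in> ?U" for z
      proof -
        have "G' (Suc n) y + G' (Suc n) z = G' m y + G' m z"
          using G'[of y "Suc n" z] G'[of y m z] that y S_mono[OF m] by auto
        then show ?thesis
          by (cases "G' (Suc n) y"; cases "G' (Suc n) z"; cases "G' m y"; cases "G' m z"; simp)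
      qed
      moreover have "openin (nsphere (Suc n)) ?U"
        by (subst nsphere_top_of_set) (simp add: S_def openin_open_Int)
      moreover have "y \<in> ?U" using y E by simp
      ultimately show "\<exists>U. openin (nsphere (Suc n)) U \<and> y \<in> U \<and>
          (\<forall>z\<in>U. G' (Suc n) z + G' m z = G' (Suc n) y + G' m y)"
        by blast
    qed (use x b in \<open>auto simp: S_def\<close>)
    then show ?thesis by (simp add: G'_def)
  qed
  \<comment> \<open>The successor appears because two potentials agree on S^n only when both are
    taken from level n+1 on: \<open>locally_constant_nsphere\<close> costs one dimension.\<close>
  define g where "g x = G' (Suc (LEAST n. x \<in> S n)) x" for x
  have g: "g x = G' (Suc n) x" if "x \<in> S n" for x n
  proof -
    have "x \<in> S (LEAST n. x \<in> S n)" using that by (rule LeastI)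
    moreover have "(LEAST n. x \<in> S n) \<le> n" using that by (rule Least_le)
    ultimately show ?thesis unfolding g_def using agree[of x _ "Suc n"] by auto
  qed
  have gS: "\<psi> x y = g x + g y" if "x \<in> S n" "y \<in> S n" "dist x y < E (Suc n)" for x y n
    using G'[of x "Suc n" y] g[of x n] g[of y n] that S_mono[of n "Suc n"] by auto
  show thesis
  proof
    fix x assume x: "x \<in> topspace infinite_sphere"
    obtain U where U: "openin infinite_sphere U" "x \<in> U" "cocycle_on U \<psi>"
      using loc[OF x] by blast
    \<comment> \<open>The scales \<open>E n\<close> may shrink to 0, so a metric ball need not serve
      as neighbourhood. The set on which the potential is right relative to \<open>x\<close> meets
      every S^n in an open set, which is openness in the direct limit.\<close>
    let ?V = "{y \<in> U. \<psi> x y = g x + g y}"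
    have "openin infinite_sphere ?V"
      unfolding openin_infinite_sphere
    proof (intro conjI allI)
      show "?V \<subseteq> (\<Union>n. topspace (nsphere n))"
        using openin_subset[OF U(1)] by (auto simp: topspace_infinite_sphere)
      fix n
      have US: "openin (nsphere n) (U \<inter> S n)"
        using U(1) by (simp add: openin_infinite_sphere S_def)
      show "openin (nsphere n) (?V \<inter> topspace (nsphere n))"
      proof (subst openin_subopen, intro ballI)
        fix y assume "y \<in> ?V \<inter> topspace (nsphere n)"
        then have y: "y \<in> U" "\<psi> x y = g x + g y" "y \<in> S n" by (auto simp: S_def)
        let ?O = "(U \<inter> S n) \<inter> (S n \<inter> ball y (E (Suc n)))"
        have "openin (nsphere n) (S n \<inter> ball y (E (Suc n)))"
          by (subst nsphere_top_of_set) (simp add: S_def openin_open_Int)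
        then have "openin (nsphere n) ?O" using US by (rule openin_Int[rotated])
        moreover have "y \<in> ?O" using y E by simp
        moreover have "?O \<subseteq> ?V \<inter> topspace (nsphere n)"
        proof
          fix z assume z: "z \<in> ?O"
          have "\<psi> x z = \<psi> x y + \<psi> y z"
            using cocycle_on_add[OF U(3), of x y z] z y U(2) by simp
          also have "\<dots> = g x + g z" using y gS[of y n z] z by (simp add: add.assoc)
          finally show "z \<in> ?V \<inter> topspace (nsphere n)" using z by (simp add: S_def)
        qed
        ultimately show "\<exists>T. openin (nsphere n) T \<and> y \<in> T \<and> T \<subseteq> ?V \<inter> topspace (nsphere n)"
          by blast
      qed
    qed
    moreover have "x \<in> ?V" using U(2) refl[OF x] by simp
    moreover have "\<psi> y z = g y + g z" if "y \<in> ?V" "z \<in> ?V" for y z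
    proof -
      have "\<psi> x y + \<psi> y z = \<psi> x z" "\<psi> x y = g x + g y" "\<psi> x z = g x + g z"
        using cocycle_on_add[OF U(3), of x y z] that U(2) by simp_all
      then show ?thesis by (cases "g x"; cases "g y"; cases "g z"; cases "\<psi> y z"; simp)
    qed
    ultimately show "\<exists>U. openin infinite_sphere U \<and> x \<in> U \<and> (\<forall>y\<in>U. \<forall>z\<in>U. \<psi> y z = g y + g z)"
      by blast
  qed
qed

section \<open>The generator of the cohomology of the infinite projective space\<close>

text \<open>Lifted to the sphere the cocycle has a potential \<open>g\<close>. The lift is even, so
  \<open>g x + g (- x)\<close> is locally constant, hence constant. If the constant is 0 the
  potential is even and descends; if it is 1 the cocycle represents the double covering.\<close>

lemma RP_infinity_degree_one:
  assumes \<phi>: "\<phi> \<in> carrier (as_cocycle_ring RP_infinity)"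
    and deg: "\<forall>xs. \<phi> xs \<noteq> 0 \<longrightarrow> length xs = 2"
  shows "\<phi> \<in> as_boundary_ideal RP_infinity \<or> (\<exists>g. double_cover_cocycle infinite_sphere g \<phi>)"
proof -
  let ?X = infinite_sphere
  define \<psi> where "\<psi> x y = \<phi> [{x, -x}, {y, -y}]" for x y
  have \<phi>c: "\<phi> \<in> as_cochains (antipodal_quotient ?X)"
    using \<phi> by (simp add: carrier_as_cocycle_ring RP_infinity_def)
  have "\<exists>U. openin ?X U \<and> x \<in> U \<and> cocycle_on U \<psi>" if x: "x \<in> topspace ?X" for x
  proof -
    have "as_coboundary RP_infinity \<phi> \<in> as_locally_zero (antipodal_quotient ?X)"
      using \<phi> by (simp add: carrier_as_cocycle_ring RP_infinity_def)
    then obtain U where U: "openin ?X U" "x \<in> U"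
      "\<forall>ys. set ys \<subseteq> U \<longrightarrow> as_coboundary RP_infinity \<phi> (map (\<lambda>y. {y, -y}) ys) = 0"
      using x unfolding as_locally_zero_antipodal_iff[OF antipodal_infinite_sphere] by blast
    have "cocycle_on U \<psi>"
      unfolding cocycle_on_def
    proof (intro ballI)
      fix a b c assume abc: "a \<in> U" "b \<in> U" "c \<in> U"
      have "as_coboundary RP_infinity \<phi> (map (\<lambda>y. {y, -y}) [a, b, c]) = 0"
        using U(3)[rule_format, of "[a, b, c]"] abc by simp
      moreover have "{a, -a} \<in> topspace RP_infinity" "{b, -b} \<in> topspace RP_infinity"
        "{c, -c} \<in> topspace RP_infinity"
        using openin_subset[OF U(1)] abc by (auto simp: RP_infinity_def topspace_antipodal_quotient)
      ultimately show "\<psi> b c + \<psi> a c + \<psi> a b = 0"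
        by (simp add: as_coboundary_three \<psi>_def)
    qed
    then show ?thesis using U(1,2) by blast
  qed
  then obtain g where g: "\<And>x. x \<in> topspace ?X \<Longrightarrow>
      \<exists>U. openin ?X U \<and> x \<in> U \<and> (\<forall>y\<in>U. \<forall>z\<in>U. \<psi> y z = g y + g z)"
    by (rule infinite_sphere_potential[of \<psi>]) blast+
  have const: "g x + g (- x) = g y + g (- y)" if xy: "x \<in> topspace ?X" "y \<in> topspace ?X" for x y
  proof (rule locally_constant_infinite_sphere[of "\<lambda>x. g x + g (- x)", OF _ xy])
    fix y assume y: "y \<in> topspace ?X"
    obtain U where U: "openin ?X U" "y \<in> U" "\<forall>a\<in>U. \<forall>b\<in>U. \<psi> a b = g a + g b"
      using g[OF y] by blast
    obtain V where V: "openin ?X V" "- y \<in> V" "\<forall>a\<in>V. \<forall>b\<in>V. \<psi> a b = g a + g b"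
      using g[of "- y"] antipodalD[OF antipodal_infinite_sphere y] by blast
    let ?W = "U \<inter> {z \<in> topspace ?X. - z \<in> V}"
    have "openin ?X {z \<in> topspace ?X. - z \<in> V}"
      using V(1) antipodal_infinite_sphere unfolding antipodal_def continuous_map_def by blast
    then have "openin ?X ?W" using U(1) by blast
    moreover have "g z + g (- z) = g y + g (- y)" if z: "z \<in> ?W" for z
    proof -
      have "\<psi> y z = \<psi> (- y) (- z)"
        unfolding \<psi>_def using antipodalD[OF antipodal_infinite_sphere] y z by (simp add: insert_commute)
      then have "g y + g z = g (- y) + g (- z)" using U V z by auto
      then show ?thesis by (cases "g y"; cases "g z"; cases "g (- y)"; cases "g (- z)"; simp)
    qed
    moreover have "y \<in> ?W" using y U(2) V(2) by simp
    ultimately show "\<exists>W. openin ?X W \<and> y \<in> W \<and> (\<forall>z\<in>W. g z + g (- z) = g y + g (- y))"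
      by blast
  qed
  show ?thesis
  proof (cases "\<forall>x\<in>topspace ?X. g (- x) = g x")
    case True
    then have "\<phi> \<in> as_boundary_ideal (antipodal_quotient ?X)"
      using g by (intro even_local_potential_boundary[OF antipodal_infinite_sphere \<phi>c deg, of g])
        (auto simp: \<psi>_def)
    then show ?thesis by (simp add: RP_infinity_def)
  next
    case False
    then obtain x0 where x0: "x0 \<in> topspace ?X" "g (- x0) \<noteq> g x0" by blast
    have "g (- x) = g x + 1" if "x \<in> topspace ?X" for x
      using const[OF that x0(1)] x0(2)
      by (cases "g x"; cases "g (- x)"; cases "g x0"; cases "g (- x0)"; simp)
    then have "double_cover_cocycle ?X g \<phi>"
      using \<phi>c deg g unfolding double_cover_cocycle_def \<psi>_def by blast
    then show ?thesis by blast
  qed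
qed

text \<open>Otherwise \<open>g\<close> corrected by the bounding 0-cochain would be locally constant
  on the sphere, hence constant, although it changes by 1 from \<open>x\<close> to
  \<open>- x\<close>.\<close>

lemma double_cover_cocycle_infinite_sphere_not_boundary:
  assumes "double_cover_cocycle infinite_sphere g \<phi>"
  shows "\<phi> \<notin> as_boundary_ideal RP_infinity"
proof
  let ?X = infinite_sphere
  assume "\<phi> \<in> as_boundary_ideal RP_infinity"
  then obtain \<psi> \<theta> where "\<theta> \<in> as_locally_zero (antipodal_quotient ?X)"
    and eq: "\<phi> = (\<lambda>xs. as_coboundary RP_infinity \<psi> xs + \<theta> xs)"
    unfolding as_boundary_ideal_def RP_infinity_def by blast
  then have \<theta>: "\<exists>U. openin ?X U \<and> x \<in> U \<and> (\<forall>ys. set ys \<subseteq> U \<longrightarrow> \<theta> (map (\<lambda>y. {y, -y}) ys) = 0)"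
    if "x \<in> topspace ?X" for x
    using that as_locally_zero_antipodal_iff[OF antipodal_infinite_sphere] by blast
  define f where "f x = g x + \<psi> [{x, -x}]" for x
  obtain x :: "nat \<Rightarrow> real" where x: "x \<in> topspace ?X"
    using in_topspace_nsphere by (auto simp: topspace_infinite_sphere)
  have mx: "- x \<in> topspace ?X" "{- x, - (- x)} = {x, - x}"
    using antipodalD[OF antipodal_infinite_sphere x] by auto
  have "f x = f (- x)"
  proof (rule locally_constant_infinite_sphere[OF _ x mx(1)])
    fix y assume y: "y \<in> topspace ?X"
    obtain U where U: "openin ?X U" "y \<in> U"
        "\<forall>ys. set ys \<subseteq> U \<longrightarrow> \<theta> (map (\<lambda>y. {y, -y}) ys) = 0"
      using \<theta>[OF y] by blast
    obtain V where V: "openin ?X V" "y \<in> V" "\<forall>a\<in>V. \<forall>b\<in>V. \<phi> [{a, -a}, {b, -b}] = g a + g b"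
      using assms y unfolding double_cover_cocycle_def by blast
    have "f z = f y" if z: "z \<in> U \<inter> V" for z
    proof -
      have "\<theta> (map (\<lambda>y. {y, -y}) [y, z]) = 0"
        using U(3)[rule_format, of "[y, z]"] U(2) z by simp
      moreover have "{y, -y} \<in> topspace RP_infinity" "{z, -z} \<in> topspace RP_infinity"
        using openin_subset[OF U(1)] U(2) z by (auto simp: RP_infinity_def topspace_antipodal_quotient)
      ultimately have "\<phi> [{y, -y}, {z, -z}] = \<psi> [{z, -z}] + \<psi> [{y, -y}]"
        unfolding eq by (simp add: as_coboundary_two)
      then have "g y + g z = \<psi> [{z, -z}] + \<psi> [{y, -y}]" using V z by auto
      then show ?thesis
        unfolding f_def by (cases "g y"; cases "g z"; cases "\<psi> [{z, -z}]"; cases "\<psi> [{y, -y}]"; simp)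
    qed
    moreover have "openin ?X (U \<inter> V)" "y \<in> U \<inter> V" using U V by auto
    ultimately show "\<exists>W. openin ?X W \<and> y \<in> W \<and> (\<forall>z\<in>W. f z = f y)" by blast
  qed
  moreover have "g (- x) = g x + 1" using assms x by (simp add: double_cover_cocycle_def)
  ultimately show False
    unfolding f_def mx(2) by (cases "g x"; cases "\<psi> [{x, -x}]"; simp)
qed

text \<open>This resolves the definite description. A double cover cocycle exists and is no
  boundary; by \<open>RP_infinity_degree_one\<close> every nonzero class of degree one contains such
  a cocycle, and all of them are cohomologous.\<close>

lemma RP_generator_eq:
  obtains g \<phi> where "double_cover_cocycle infinite_sphere g \<phi>"
    and "\<phi> \<in> carrier (as_cocycle_ring RP_infinity)"
    and "RP_generator = as_class RP_infinity \<phi>"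
proof -
  have ne: "x \<noteq> - x" if x: "x \<in> topspace infinite_sphere" for x :: "nat \<Rightarrow> real"
  proof
    assume eq: "x = - x"
    have "x i = 0" for i
    proof -
      have "x i = (- x) i" by (rule fun_cong[OF eq])
      then show ?thesis by simp
    qed
    then show False using x by (auto simp: topspace_infinite_sphere mem_topspace_nsphere)
  qed
  obtain g \<phi> where \<phi>: "double_cover_cocycle infinite_sphere g \<phi>"
  proof (rule double_cover_cocycle_exists[OF antipodal_infinite_sphere])
    fix x y :: "nat \<Rightarrow> real" show "dist (- x) (- y) = dist x y" by (simp add: dist_fun_def dist_minus)
  qed (use ne openin_infinite_sphere_open in auto)
  have \<phi>c: "\<phi> \<in> carrier (as_cocycle_ring RP_infinity)"
    using double_cover_cocycle_in_carrier[OF antipodal_infinite_sphere \<phi>] by (simp add: RP_infinity_def)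
  interpret ideal "as_boundary_ideal RP_infinity" "as_cocycle_ring RP_infinity"
    by (rule as_boundary_ideal)
  have "RP_generator = as_class RP_infinity \<phi>"
    unfolding RP_generator_def
  proof (rule the_equality)
    have "\<phi> \<in> as_class RP_infinity \<phi>" using \<phi>c a_rcos_self by blast
    then have "as_class RP_infinity \<phi> \<in> as_cohomology_group 1 RP_infinity"
      using as_class_mem_carrier[OF \<phi>c] \<phi>
      unfolding as_cohomology_group_def double_cover_cocycle_def numeral_2_eq_2 One_nat_def by blast
    then show "as_class RP_infinity \<phi> \<in> as_cohomology_group 1 RP_infinity \<and>
        as_class RP_infinity \<phi> \<noteq> \<zero>\<^bsub>as_cohomology_ring RP_infinity\<^esub>"
      using as_class_eq_zero_iff[OF \<phi>c] double_cover_cocycle_infinite_sphere_not_boundary[OF \<phi>] by blast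
  next
    fix c assume c: "c \<in> as_cohomology_group 1 RP_infinity \<and> c \<noteq> \<zero>\<^bsub>as_cohomology_ring RP_infinity\<^esub>"
    then obtain \<phi>' where \<phi>': "\<phi>' \<in> c" "\<forall>xs. \<phi>' xs \<noteq> 0 \<longrightarrow> length xs = 2"
      unfolding as_cohomology_group_def numeral_2_eq_2 One_nat_def by blast
    have "c \<in> carrier (as_cohomology_ring RP_infinity)"
      using c by (simp add: as_cohomology_group_def)
    note cc = as_cohomology_class_eq[OF this \<phi>'(1)]
    then have "\<phi>' \<notin> as_boundary_ideal RP_infinity" using c as_class_eq_zero_iff by metis
    then obtain g' where "double_cover_cocycle infinite_sphere g' \<phi>'"
      using RP_infinity_degree_one[OF cc(1) \<phi>'(2)] by blast
    then show "c = as_class RP_infinity \<phi>"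
      using double_cover_cocycle_unique[OF antipodal_infinite_sphere _ \<phi>] cc(2)
      by (simp add: RP_infinity_def)
  qed
  then show thesis using \<phi> \<phi>c by (intro that)
qed

section \<open>Properties of the cohomological index\<close>

lemma antipodal_top_of_set:
  fixes A :: "'a::real_normed_vector set"
  assumes "symmetric_set A"
  shows "antipodal (top_of_set A)"
  using assms by (auto simp: antipodal_def symmetric_set_def intro!: continuous_intros)

lemma symmetric_setD: "symmetric_set A \<Longrightarrow> x \<in> A \<Longrightarrow> - x \<in> A"
  by (auto simp: symmetric_set_def)

lemma symmetric_setI:
  fixes A :: "'a::group_add set"
  assumes "\<And>x. x \<in> A \<Longrightarrow> - x \<in> A"
  shows "symmetric_set A"
  using assms unfolding symmetric_set_def by (force intro: image_eqI[of _ uminus "- _"])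

lemma symmetric_set_closure:
  fixes A :: "'a::real_normed_vector set"
  assumes "symmetric_set A"
  shows "symmetric_set (closure A)"
proof (rule symmetric_setI)
  have "uminus ` closure A \<subseteq> closure A"
    using assms closure_subset
    by (intro image_closure_subset continuous_intros closed_closure) (simp add: symmetric_set_def)
  then show "- x \<in> closure A" if "x \<in> closure A" for x using that by blast
qed

lemma double_cover_cocycle_top_of_set_exists:
  fixes A :: "'a::real_normed_vector set"
  assumes A: "symmetric_set A" and "0 \<notin> A"
  obtains g w where "double_cover_cocycle (top_of_set A) g w"
proof (rule double_cover_cocycle_exists[OF antipodal_top_of_set[OF A]])
  fix x :: 'a assume "x \<in> topspace (top_of_set A)"
  then have "x \<noteq> 0" using assms(2) by auto
  show "x \<noteq> - x"
  proof
    assume "x = - x"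
    then have "x + x = 0" by (metis add.right_inverse)
    then have "(2::real) *\<^sub>R x = 0" by (simp add: scaleR_2)
    then show False using \<open>x \<noteq> 0\<close> by simp
  qed
qed (use openin_open_Int in \<open>auto simp: dist_minus\<close>)

lemma continuous_map_antipodal_quotient:
  assumes F: "continuous_map X Y F" and odd: "\<And>x. x \<in> topspace X \<Longrightarrow> F (- x) = - F x"
  shows "continuous_map (antipodal_quotient X) (antipodal_quotient Y) (image F)"
proof -
  have img: "F ` {x, -x} = {F x, - F x}" if "x \<in> topspace X" for x using odd[OF that] by auto
  have FY: "F x \<in> topspace Y" if "x \<in> topspace X" for x
    using F that by (auto simp: continuous_map_def)
  show ?thesis
    unfolding continuous_map_def
  proof (intro conjI allI impI)
    show "image F \<in> topspace (antipodal_quotient X) \<rightarrow> topspace (antipodal_quotient Y)"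
      unfolding topspace_antipodal_quotient using img FY by blast
    fix V assume V: "openin (antipodal_quotient Y) V"
    let ?W = "{q \<in> topspace (antipodal_quotient X). F ` q \<in> V}"
    have "{x \<in> topspace X. {x, -x} \<in> ?W} = {x \<in> topspace X. F x \<in> {y \<in> topspace Y. {y, -y} \<in> V}}"
      using img FY unfolding topspace_antipodal_quotient by auto
    moreover have "openin X {x \<in> topspace X. F x \<in> {y \<in> topspace Y. {y, -y} \<in> V}}"
      using V F by (intro openin_continuous_map_preimage) (auto simp: openin_antipodal_quotient)
    ultimately show "openin (antipodal_quotient X) ?W"
      by (auto simp: openin_antipodal_quotient topspace_antipodal_quotient)
  qed
qed

text \<open>A map with values in a single S^n has to be tested against one level of the direct limit
  only.\<close>

lemma continuous_map_infinite_sphereI: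
  assumes "continuous_on S F" "F \<in> S \<rightarrow> topspace (nsphere n)"
  shows "continuous_map (top_of_set S) infinite_sphere F"
  unfolding continuous_map_def
proof (intro conjI allI impI)
  show "F \<in> topspace (top_of_set S) \<rightarrow> topspace infinite_sphere"
    using assms(2) by (auto simp: topspace_infinite_sphere)
  fix U assume "openin infinite_sphere U"
  then have "openin (top_of_set (topspace (nsphere n))) (U \<inter> topspace (nsphere n))"
    by (metis nsphere_top_of_set openin_infinite_sphere)
  then have "openin (top_of_set S) (S \<inter> F -` (U \<inter> topspace (nsphere n)))"
    using assms by (intro continuous_openin_preimage[of _ _ "topspace (nsphere n)"])
  moreover have "S \<inter> F -` (U \<inter> topspace (nsphere n)) = {x \<in> topspace (top_of_set S). F x \<in> U}"
    using assms(2) by auto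
  ultimately show "openin (top_of_set S) {x \<in> topspace (top_of_set S). F x \<in> U}" by simp
qed

text \<open>
  Finitely many of the odd functions \<open>y \<mapsto> \<parallel>y + x\<parallel> - \<parallel>y - x\<parallel>\<close> have no common zero on a compact set
  avoiding the origin.
\<close>

lemma classifying_map_exists:
  fixes K :: "'a::real_normed_vector set"
  assumes K: "compact K" "symmetric_set K" "0 \<notin> K"
  shows "\<exists>f. classifying_map K f"
proof -
  define h where "h x y = norm (y + x) - norm (y - x)" for x y :: 'a
  have cont: "continuous_on S (h x)" for S x
    unfolding h_def by (intro continuous_intros)
  have h_odd: "h x (- y) = - h x y" for x y
  proof -
    have "norm (- y + x) = norm (y - x)" "norm (- y - x) = norm (y + x)"
      by (metis norm_minus_commute uminus_add_conv_diff) (metis minus_add_distrib norm_minus_cancel uminus_add_conv_diff add.commute)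
    then show ?thesis by (simp add: h_def)
  qed
  have "K \<subseteq> (\<Union>x\<in>K. {y. h x y \<noteq> 0})"
  proof
    fix x assume x: "x \<in> K"
    then have "x \<noteq> 0" using K(3) by auto
    then have "h x x \<noteq> 0" by (simp add: h_def flip: scaleR_2)
    then show "x \<in> (\<Union>x\<in>K. {y. h x y \<noteq> 0})" using x by blast
  qed
  moreover have "open {y. h x y \<noteq> 0}" for x
    by (intro open_Collect_neq cont continuous_on_const)
  ultimately obtain D where D: "D \<subseteq> K" "finite D" "K \<subseteq> (\<Union>x\<in>D. {y. h x y \<noteq> 0})"
    using compactE_image[OF K(1), of K "\<lambda>x. {y. h x y \<noteq> 0}"] by metis
  obtain xs where xs: "set xs = D" using D(2) finite_list by blast
  define n where "n = length xs"
  \<comment> \<open>S^n has n+1 coordinates: the \<open>n\<close> functions fill the first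
    \<open>n\<close> of them, and the last one is 0.\<close>
  define c where "c y i = (if i < n then h (xs ! i) y else 0)" for y i
  define N where "N y = (\<Sum>i\<le>n. (c y i)\<^sup>2)" for y
  define F where "F y i = c y i / sqrt (N y)" for y i
  have N: "N y > 0" if y: "y \<in> K" for y
  proof -
    obtain x where "x \<in> D" "h x y \<noteq> 0" using D(3) y by blast
    then obtain i where i: "i < n" "c y i \<noteq> 0"
      using xs by (metis c_def in_set_conv_nth n_def)
    then have "0 < (c y i)\<^sup>2" by simp
    also have "(c y i)\<^sup>2 \<le> N y" unfolding N_def using i by (intro member_le_sum) auto
    finally show ?thesis .
  qed
  have cc: "continuous_on K (\<lambda>y. c y i)" for i
    by (cases "i < n") (simp_all add: c_def cont)
  have "continuous_on K F"
  proof (rule continuous_on_coordinatewise_then_product)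
    have "continuous_on K N" unfolding N_def by (intro continuous_intros cc)
    then show "continuous_on K (\<lambda>y. F y i)" for i
      unfolding F_def using N by (intro continuous_intros cc) (auto simp: less_imp_neq[symmetric])
  qed
  moreover have "F \<in> K \<rightarrow> topspace (nsphere n)"
  proof
    fix y assume y: "y \<in> K"
    have "(\<Sum>i\<le>n. (F y i)\<^sup>2) = (\<Sum>i\<le>n. (c y i)\<^sup>2) / N y"
      using N[OF y] by (simp add: F_def power_divide sum_divide_distrib)
    also have "\<dots> = 1" using N[OF y] by (simp add: N_def)
    finally show "F y \<in> topspace (nsphere n)" by (simp add: mem_topspace_nsphere F_def c_def)
  qed
  ultimately have F: "continuous_map (top_of_set K) infinite_sphere F"
    by (rule continuous_map_infinite_sphereI)
  have c_odd: "c (- y) i = - c y i" for y i by (simp add: c_def h_odd)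
  have odd: "F (- y) = - F y" for y
    by (rule ext) (simp add: F_def N_def c_odd)
  have "continuous_map (antipodal_quotient (top_of_set K)) RP_infinity (image F)"
    unfolding RP_infinity_def by (rule continuous_map_antipodal_quotient[OF F odd])
  then have "classifying_map K (image F)"
    unfolding classifying_map_def using F odd by auto
  then show ?thesis by blast
qed

text \<open>The lift of \<open>f\<close> to the spheres pulls an odd potential back to an odd
  potential on \<open>A\<close>, and double cover cocycles are unique up to boundaries. This takes
  the place of the homotopy uniqueness of classifying maps.\<close>

lemma as_induced_RP_generator_pow:
  fixes A :: "'a::real_normed_vector set"
  assumes A: "symmetric_set A" and f: "classifying_map A f"
    and w: "double_cover_cocycle (top_of_set A) g w"
  shows "as_induced (antipodal_quotient (top_of_set A)) f
      (RP_generator [^]\<^bsub>as_cohomology_ring RP_infinity\<^esub> (n::nat))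
    = as_class (antipodal_quotient (top_of_set A))
        (w [^]\<^bsub>as_cocycle_ring (antipodal_quotient (top_of_set A))\<^esub> n)"
proof -
  let ?X = "top_of_set A" and ?Q = "antipodal_quotient (top_of_set A)"
  have X: "antipodal ?X" using A by (rule antipodal_top_of_set)
  obtain g' \<phi> where \<phi>: "double_cover_cocycle infinite_sphere g' \<phi>"
    and \<phi>c: "\<phi> \<in> carrier (as_cocycle_ring RP_infinity)"
    and gen: "RP_generator = as_class RP_infinity \<phi>"
    by (rule RP_generator_eq)
  obtain F where f_cont: "continuous_map ?Q RP_infinity f"
    and F: "continuous_map ?X infinite_sphere F"
    and Ff: "\<And>u. u \<in> A \<Longrightarrow> F (- u) = - F u \<and> f {u, -u} = {F u, - F u}"
    using f unfolding classifying_map_def by blast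
  have w': "double_cover_cocycle ?X (g' \<circ> F) (as_pullback ?Q f \<phi>)"
  proof (rule double_cover_cocycle_pullback[OF X \<phi>])
    fix x assume x: "x \<in> topspace ?X"
    then show Fx: "F x \<in> topspace infinite_sphere" using F by (auto simp: continuous_map_def)
    show "F (- x) = - F x \<and> f {x, -x} = {F x, - F x}" using Ff x by simp
    obtain U where U: "openin infinite_sphere U" "F x \<in> U"
        "\<forall>y\<in>U. \<forall>z\<in>U. \<phi> [{y, -y}, {z, -z}] = g' y + g' z"
      using \<phi> Fx unfolding double_cover_cocycle_def by blast
    have "openin ?X {y \<in> topspace ?X. F y \<in> U}"
      using F U(1) by (rule openin_continuous_map_preimage)
    then show "\<exists>U. openin ?X U \<and> x \<in> U \<and>
       (\<forall>y\<in>U. \<forall>z\<in>U. \<phi> [{F y, - F y}, {F z, - F z}] = g' (F y) + g' (F z))"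
      using x U(2,3) by (intro exI[of _ "{y \<in> topspace ?X. F y \<in> U}"] conjI) blast+
  qed
  have "as_induced ?Q f (RP_generator [^]\<^bsub>as_cohomology_ring RP_infinity\<^esub> n)
      = as_class ?Q (as_pullback ?Q f (\<phi> [^]\<^bsub>as_cocycle_ring RP_infinity\<^esub> n))"
    using as_induced_class(2)[OF f_cont as_cocycle_pow_closed[OF \<phi>c]] by (simp add: gen as_class_pow[OF \<phi>c])
  also have "\<dots> = as_class ?Q (as_pullback ?Q f \<phi> [^]\<^bsub>as_cocycle_ring ?Q\<^esub> n)"
    using f_cont \<phi>c by (subst as_pullback_pow) (auto simp: continuous_map_def carrier_as_cocycle_ring)
  also have "\<dots> = as_class ?Q (w [^]\<^bsub>as_cocycle_ring ?Q\<^esub> n)"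
    using double_cover_cocycle_unique[OF X w' w] double_cover_cocycle_in_carrier[OF X] w w'
    by (simp flip: as_class_pow)
  finally show ?thesis .
qed

text \<open>The induced class is the same for all classifying maps, so their existence splits off as
  a separate condition; the exponents with nonvanishing power form an initial segment, so only
  \<open>k - 1\<close> has to be tested.\<close>

lemma enat_le_cohomological_index_iff:
  fixes A :: "'a::real_normed_vector set"
  assumes A: "symmetric_set A" "A \<noteq> {}" and k: "1 \<le> k"
    and w: "double_cover_cocycle (top_of_set A) g w"
  shows "enat k \<le> cohomological_index A \<longleftrightarrow> (\<exists>f. classifying_map A f) \<and>
    w [^]\<^bsub>as_cocycle_ring (antipodal_quotient (top_of_set A))\<^esub> (k - 1)
      \<notin> as_boundary_ideal (antipodal_quotient (top_of_set A))"
proof -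
  let ?Q = "antipodal_quotient (top_of_set A)"
  define P where "P m \<longleftrightarrow> (\<exists>f. classifying_map A f) \<and>
    w [^]\<^bsub>as_cocycle_ring ?Q\<^esub> (m - 1) \<notin> as_boundary_ideal ?Q" for m :: nat
  have wc: "w \<in> carrier (as_cocycle_ring ?Q)"
    using double_cover_cocycle_in_carrier[OF antipodal_top_of_set[OF A(1)] w] .
  have index: "cohomological_index A = Sup {enat m | m. 1 \<le> m \<and> P m}"
  proof -
    have "as_induced ?Q f (RP_generator [^]\<^bsub>as_cohomology_ring RP_infinity\<^esub> (m - 1))
          \<noteq> \<zero>\<^bsub>as_cohomology_ring ?Q\<^esub> \<longleftrightarrow>
        w [^]\<^bsub>as_cocycle_ring ?Q\<^esub> (m - 1) \<notin> as_boundary_ideal ?Q"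
      if "classifying_map A f" for f and m :: nat
      using as_induced_RP_generator_pow[OF A(1) that w]
        as_class_eq_zero_iff[OF as_cocycle_pow_closed[OF wc]] by metis
    then have "P m \<longleftrightarrow> (\<exists>f. classifying_map A f \<and>
        as_induced ?Q f (RP_generator [^]\<^bsub>as_cohomology_ring RP_infinity\<^esub> (m - 1))
          \<noteq> \<zero>\<^bsub>as_cohomology_ring ?Q\<^esub>)" for m
      unfolding P_def by blast
    then show ?thesis using A(2) by (simp add: cohomological_index_def)
  qed
  have "enat k \<le> cohomological_index A \<longleftrightarrow> P k"
  proof
    assume le: "enat k \<le> cohomological_index A"
    \<comment> \<open>A strict bound below the supremum yields a member beyond \<open>k - 1\<close>
      even if the supremum is infinite.\<close>
    have "enat (k - 1) < enat k" using k by simp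
    also note le
    finally have "enat (k - 1) < Sup {enat m | m. 1 \<le> m \<and> P m}" unfolding index .
    then obtain m where m: "P m" "k - 1 < m" by (auto simp: less_Sup_iff)
    then have "k - 1 \<le> m - 1" by simp
    then show "P k" using m(1) as_pow_mem_boundary_mono[OF wc] unfolding P_def by blast
  next
    assume "P k"
    then show "enat k \<le> cohomological_index A" unfolding index using k by (intro Sup_upper) blast
  qed
  then show ?thesis by (simp add: P_def)
qed

text \<open>If a power of the class bounds on \<open>B\<close>, it bounds on \<open>A\<close> by
  pullback. A classifying map of \<open>B\<close> is assumed because one of \<open>A\<close> cannot
  be transported along \<open>F\<close>.\<close>

lemma cohomological_index_mono:
  fixes A :: "'a::real_normed_vector set" and B :: "'b::real_normed_vector set"
  assumes A: "symmetric_set A" "0 \<notin> A" and B: "symmetric_set B" "0 \<notin> B"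
    and cl: "\<exists>f. classifying_map B f"
    and F: "continuous_on A F" "F \<in> A \<rightarrow> B" "\<And>x. x \<in> A \<Longrightarrow> F (- x) = - F x"
    and k: "1 \<le> k" "enat k \<le> cohomological_index A"
  shows "enat k \<le> cohomological_index B"
proof -
  let ?X = "top_of_set A" and ?Y = "top_of_set B"
  obtain g v where v: "double_cover_cocycle ?X g v"
    using double_cover_cocycle_top_of_set_exists A by blast
  obtain g' w where w: "double_cover_cocycle ?Y g' w"
    using double_cover_cocycle_top_of_set_exists B by blast
  have "A \<noteq> {}" using k by (auto simp: cohomological_index_def zero_enat_def)
  then have "B \<noteq> {}" using F(2) by auto
  have cm: "continuous_map ?X ?Y F" using F by auto
  have "w [^]\<^bsub>as_cocycle_ring (antipodal_quotient ?Y)\<^esub> (k - 1) \<notin> as_boundary_ideal (antipodal_quotient ?Y)"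
  proof
    assume "w [^]\<^bsub>as_cocycle_ring (antipodal_quotient ?Y)\<^esub> (k - 1) \<in> as_boundary_ideal (antipodal_quotient ?Y)"
    then obtain \<psi> \<theta> where \<psi>: "\<psi> \<in> as_cochains (antipodal_quotient ?Y)"
      and \<theta>: "\<theta> \<in> as_locally_zero (antipodal_quotient ?Y)"
      and eq: "w [^]\<^bsub>as_cocycle_ring (antipodal_quotient ?Y)\<^esub> (k - 1)
         = (\<lambda>xs. as_coboundary (antipodal_quotient ?Y) \<psi> xs + \<theta> xs)"
      unfolding as_boundary_ideal_def by blast
    have "v [^]\<^bsub>as_cocycle_ring (antipodal_quotient ?X)\<^esub> (k - 1) \<in> as_boundary_ideal (antipodal_quotient ?X)"
    proof (rule double_cover_pow_boundary_pullback[OF antipodal_top_of_set[OF A(1)] v w fun_cong[OF eq] \<psi>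
          as_locally_zero_cochain[OF \<theta>], of F])
      fix x assume x: "x \<in> topspace ?X"
      then show "F x \<in> topspace ?Y \<and> F (- x) = - F x" using F by auto
      then have Fx: "F x \<in> topspace ?Y" by blast
      obtain U where U: "openin ?Y U" "F x \<in> U"
          "\<forall>y\<in>U. \<forall>z\<in>U. w [{y, -y}, {z, -z}] = g' y + g' z"
        using w Fx unfolding double_cover_cocycle_def by blast
      obtain V where V: "openin ?Y V" "F x \<in> V"
          "\<forall>ys. set ys \<subseteq> V \<longrightarrow> \<theta> (map (\<lambda>y. {y, -y}) ys) = 0"
        using \<theta> Fx as_locally_zero_antipodal_iff[OF antipodal_top_of_set[OF B(1)], of \<theta>] by blast
      let ?W = "{y \<in> topspace ?X. F y \<in> U \<inter> V}"
      have "openin ?X ?W"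
        using cm U(1) V(1) by (intro openin_continuous_map_preimage[of _ ?Y]) auto
      moreover have "x \<in> ?W" using x U(2) V(2) by blast
      moreover have "\<theta> (map (\<lambda>y. {F y, - F y}) ys) = 0" if "set ys \<subseteq> ?W" for ys
        using V(3)[rule_format, of "map F ys"] that by (auto simp: o_def)
      moreover have "\<forall>y\<in>?W. \<forall>z\<in>?W. w [{F y, - F y}, {F z, - F z}] = g' (F y) + g' (F z)"
        using U(3) by blast
      ultimately show "\<exists>U. openin ?X U \<and> x \<in> U \<and>
         (\<forall>y\<in>U. \<forall>z\<in>U. w [{F y, - F y}, {F z, - F z}] = g' (F y) + g' (F z)) \<and>
         (\<forall>ys. set ys \<subseteq> U \<longrightarrow> \<theta> (map (\<lambda>y. {F y, - F y}) ys) = 0)"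
        by blast
    qed
    then show False using k enat_le_cohomological_index_iff[OF A(1) \<open>A \<noteq> {}\<close> k(1) v] by blast
  qed
  then show ?thesis
    using enat_le_cohomological_index_iff[OF B(1) \<open>B \<noteq> {}\<close> k(1) w] cl by blast
qed

text \<open>
  Tautness: a coboundary on \<open>K/\<int>\<^sub>2\<close> that kills the power of the class is transported to nearby
  sets by an odd, discontinuous, almost nearest point map.
\<close>

lemma cohomological_index_tautness:
  fixes K :: "'a::real_normed_vector set"
  assumes K: "compact K" "symmetric_set K" "0 \<notin> K" "K \<noteq> {}" and k: "1 \<le> k"
    and near: "\<And>e. 0 < e \<Longrightarrow> \<exists>C. symmetric_set C \<and> 0 \<notin> C \<and> enat k \<le> cohomological_index C \<and>
       (\<forall>c\<in>C. \<exists>x\<in>K. dist c x < e)"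
  shows "enat k \<le> cohomological_index K"
proof -
  let ?Y = "top_of_set K"
  obtain g w where w: "double_cover_cocycle ?Y g w"
    using double_cover_cocycle_top_of_set_exists K(2,3) by blast
  have "w [^]\<^bsub>as_cocycle_ring (antipodal_quotient ?Y)\<^esub> (k - 1) \<notin> as_boundary_ideal (antipodal_quotient ?Y)"
  proof
    assume "w [^]\<^bsub>as_cocycle_ring (antipodal_quotient ?Y)\<^esub> (k - 1) \<in> as_boundary_ideal (antipodal_quotient ?Y)"
    then obtain \<psi> \<theta> where \<psi>: "\<psi> \<in> as_cochains (antipodal_quotient ?Y)"
      and \<theta>: "\<theta> \<in> as_locally_zero (antipodal_quotient ?Y)"
      and eq: "w [^]\<^bsub>as_cocycle_ring (antipodal_quotient ?Y)\<^esub> (k - 1)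
         = (\<lambda>xs. as_coboundary (antipodal_quotient ?Y) \<psi> xs + \<theta> xs)"
      unfolding as_boundary_ideal_def by blast
    define \<G> where "\<G> = {G. open G \<and>
       (\<forall>y\<in>G \<inter> K. \<forall>z\<in>G \<inter> K. w [{y, -y}, {z, -z}] = g y + g z) \<and>
       (\<forall>ys. set ys \<subseteq> G \<inter> K \<longrightarrow> \<theta> (map (\<lambda>y. {y, -y}) ys) = 0)}"
    have "K \<subseteq> \<Union>\<G>"
    proof
      fix x assume x: "x \<in> K"
      obtain U where U: "openin ?Y U" "x \<in> U"
          "\<forall>y\<in>U. \<forall>z\<in>U. w [{y, -y}, {z, -z}] = g y + g z"
        using w x unfolding double_cover_cocycle_def by force
      obtain V where V: "openin ?Y V" "x \<in> V"
          "\<forall>ys. set ys \<subseteq> V \<longrightarrow> \<theta> (map (\<lambda>y. {y, -y}) ys) = 0"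
        using \<theta> x as_locally_zero_antipodal_iff[OF antipodal_top_of_set[OF K(2)], of \<theta>] by force
      from U(1) V(1) obtain G H where G: "open G" "U = K \<inter> G" and H: "open H" "V = K \<inter> H"
        by (auto simp: openin_open)
      have "G \<inter> H \<in> \<G>" using U(3) V(3) G H unfolding \<G>_def by auto
      then show "x \<in> \<Union>\<G>" using U(2) V(2) G(2) H(2) by blast
    qed
    then obtain e where e: "0 < e" "\<And>x. x \<in> K \<Longrightarrow> \<exists>G\<in>\<G>. ball x e \<subseteq> G"
      by (rule Heine_Borel_lemma[OF K(1)]) (auto simp: \<G>_def)
    obtain C where C: "symmetric_set C" "0 \<notin> C" "enat k \<le> cohomological_index C"
      and "\<forall>c\<in>C. \<exists>x\<in>K. dist c x < e / 3"
      using near[of "e / 3"] e(1) by auto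
    then obtain n where n: "\<And>c. c \<in> C \<Longrightarrow> n c \<in> K" "\<And>c. c \<in> C \<Longrightarrow> dist c (n c) < e / 3"
      by metis
    let ?X = "top_of_set C"
    obtain g' v where v: "double_cover_cocycle ?X g' v"
      using double_cover_cocycle_top_of_set_exists C by blast
    \<comment> \<open>The choice \<open>n\<close> of near points need not be odd. The values of
      \<open>g'\<close> single out one point of each pair \<open>c\<close>, \<open>- c\<close>, from
      which \<open>n\<close> is extended oddly.\<close>
    define r where "r c = (if g' c = 0 then n c else - n (- c))" for c
    have r_odd: "r (- c) = - r c" if "c \<in> C" for c
    proof -
      have "g' (- c) = g' c + 1" using v that by (simp add: double_cover_cocycle_def)
      then show ?thesis by (cases "g' c") (simp_all add: r_def)
    qed
    have rK: "r c \<in> K" if "c \<in> C" for c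
      using n(1) that symmetric_setD[OF C(1)] symmetric_setD[OF K(2)] by (simp add: r_def)
    have rd: "dist c (r c) < e / 3" if "c \<in> C" for c
      using n(2)[OF that] n(2)[OF symmetric_setD[OF C(1) that]] dist_minus[of c "- n (- c)"]
      by (simp add: r_def)
    have "v [^]\<^bsub>as_cocycle_ring (antipodal_quotient ?X)\<^esub> (k - 1) \<in> as_boundary_ideal (antipodal_quotient ?X)"
    proof (rule double_cover_pow_boundary_pullback[OF antipodal_top_of_set[OF C(1)] v w fun_cong[OF eq] \<psi>
          as_locally_zero_cochain[OF \<theta>], of r])
      fix x assume x: "x \<in> topspace ?X"
      then show "r x \<in> topspace ?Y \<and> r (- x) = - r x" using r_odd rK by auto
      have "r x \<in> K" using rK x by simp
      from e(2)[OF this] obtain G where G: "G \<in> \<G>" "ball (r x) e \<subseteq> G" by blast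
      \<comment> \<open>The way from \<open>r x\<close> to \<open>r y\<close> passes through
        \<open>x\<close> and \<open>y\<close> in three legs, each shorter than \<open>e / 3\<close>,
        so \<open>r\<close> maps \<open>?W\<close> into one member of the cover in spite of its
        jumps.\<close>
      let ?W = "C \<inter> ball x (e / 3)"
      have rG: "r y \<in> G \<inter> K" if "y \<in> ?W" for y
      proof -
        have "dist (r x) (r y) \<le> dist (r x) x + dist x y + dist y (r y)"
          using dist_triangle[of "r x" "r y" x] dist_triangle[of x "r y" y] by linarith
        also have "\<dots> < e" using rd[of x] rd[of y] x that by (simp add: dist_commute)
        finally show ?thesis using G(2) rK that by auto
      qed
      have "\<theta> (map (\<lambda>y. {r y, - r y}) ys) = 0" if "set ys \<subseteq> ?W" for ys
      proof -
        have "set (map r ys) \<subseteq> G \<inter> K" using rG that unfolding set_map by blast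
        then have "\<theta> (map (\<lambda>y. {y, -y}) (map r ys)) = 0" using G(1) unfolding \<G>_def by blast
        then show ?thesis by (simp add: o_def)
      qed
      moreover have "\<forall>y\<in>?W. \<forall>z\<in>?W. w [{r y, - r y}, {r z, - r z}] = g (r y) + g (r z)"
        using G(1) rG unfolding \<G>_def by blast
      moreover have "openin ?X ?W" by (simp add: openin_open_Int)
      moreover have "x \<in> ?W" using x e(1) by simp
      ultimately show "\<exists>U. openin ?X U \<and> x \<in> U \<and>
         (\<forall>y\<in>U. \<forall>z\<in>U. w [{r y, - r y}, {r z, - r z}] = g (r y) + g (r z)) \<and>
         (\<forall>ys. set ys \<subseteq> U \<longrightarrow> \<theta> (map (\<lambda>y. {r y, - r y}) ys) = 0)"
        by blast
    qed
    moreover have "C \<noteq> {}" using C(3) k by (auto simp: cohomological_index_def zero_enat_def)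
    ultimately show False using C(3) enat_le_cohomological_index_iff[OF C(1) _ k v] by blast
  qed
  then show ?thesis
    using enat_le_cohomological_index_iff[OF K(2,4) k w] classifying_map_exists[OF K(1-3)] by blast
qed

section \<open>Norming vectors in uniformly convex spaces\<close>

text \<open>Unit vectors far apart have a midpoint of norm at most \<open>1 - d\<close>, where
  \<open>f\<close> cannot exceed \<open>(1 - d) * norm f\<close>; so not both values of
  \<open>f\<close> exceed it. Existence, uniqueness and continuity of the maximiser all rest on
  this.\<close>

lemma uniformly_convex_near_norming:
  fixes f :: "'w::real_normed_vector \<Rightarrow>\<^sub>L real"
  assumes uc: "uniformly_convex TYPE('w)" and f: "f \<noteq> 0" and e: "0 < e"
  obtains d where "0 < d" "\<And>x y. norm x = 1 \<Longrightarrow> norm y = 1 \<Longrightarrow>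
    (1 - d) * norm f < f x \<Longrightarrow> (1 - d) * norm f < f y \<Longrightarrow> norm (x - y) < e"
proof -
  obtain d where d: "0 < d"
    and conv: "\<And>x y::'w. norm x = 1 \<Longrightarrow> norm y = 1 \<Longrightarrow> e \<le> norm (x - y) \<Longrightarrow>
      norm ((1/2) *\<^sub>R (x + y)) \<le> 1 - d"
    using uc[unfolded uniformly_convex_def, rule_format, OF e] by metis
  have "norm (x - y) < e"
    if xy: "norm x = 1" "norm y = 1" "(1 - d) * norm f < f x" "(1 - d) * norm f < f y" for x y
  proof (rule ccontr)
    assume "\<not> norm (x - y) < e"
    then have le: "norm ((1/2) *\<^sub>R (x + y)) \<le> 1 - d" using conv xy by simp
    have "f ((1/2) *\<^sub>R (x + y)) \<le> norm f * norm ((1/2) *\<^sub>R (x + y))"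
      using norm_blinfun[of f "(1/2) *\<^sub>R (x + y)"] by simp
    also have "\<dots> \<le> norm f * (1 - d)" using le by (intro mult_left_mono) auto
    finally have "(f x + f y) / 2 \<le> (1 - d) * norm f"
      by (simp add: blinfun.scaleR_right blinfun.add_right mult.commute)
    then show False using xy(3,4) by simp
  qed
  then show thesis using d by (rule that[rotated])
qed

lemma near_norming_exists:
  fixes f :: "'w::real_normed_vector \<Rightarrow>\<^sub>L real"
  assumes f: "f \<noteq> 0" and d: "0 < d" "d \<le> 1"
  shows "\<exists>x. norm x = 1 \<and> (1 - d) * norm f < f x"
proof (rule ccontr)
  assume neg: "\<not> ?thesis"
  have "norm (f x) \<le> (1 - d) * norm f * norm x" for x
  proof (cases "x = 0")
    case False
    have "f (s *\<^sub>R x) \<le> (1 - d) * norm f" if "s = 1 / norm x \<or> s = - (1 / norm x)" for s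
      using neg that False by (intro leI notI) auto
    from this[of "1 / norm x"] this[of "- (1 / norm x)"] False show ?thesis
      by (simp add: blinfun.scaleR_right blinfun.minus_right field_simps abs_le_iff)
  qed simp
  then have "norm f \<le> (1 - d) * norm f"
    using d by (intro norm_blinfun_bound) auto
  then show False using f d by (simp add: algebra_simps mult_le_0_iff)
qed

text \<open>Up to scaling, the inverse of the duality map; the choice is made unique by uniform
  convexity for \<open>f \<noteq> 0\<close>.\<close>

definition norming :: "('w::real_normed_vector \<Rightarrow>\<^sub>L real) \<Rightarrow> 'w" where
  "norming f = (SOME v. norm v = 1 \<and> f v = norm f)"

text \<open>A maximising sequence is Cauchy by \<open>uniformly_convex_near_norming\<close>, and its
  limit attains the norm.\<close>

lemma norming:
  fixes f :: "'w::banach \<Rightarrow>\<^sub>L real"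
  assumes uc: "uniformly_convex TYPE('w)" and f: "f \<noteq> 0"
  shows "norm (norming f) = 1" "f (norming f) = norm f"
proof -
  have "\<exists>x. norm x = 1 \<and> (1 - 1 / real (Suc n)) * norm f < f x" for n
    by (rule near_norming_exists[OF f]) auto
  then obtain X where X: "\<And>n. norm (X n) = 1" "\<And>n. (1 - 1 / real (Suc n)) * norm f < f (X n)"
    by metis
  have "Cauchy X"
  proof (rule CauchyI)
    fix e :: real assume "0 < e"
    then obtain d where d: "0 < d" "\<And>x y. norm x = 1 \<Longrightarrow> norm y = 1 \<Longrightarrow>
        (1 - d) * norm f < f x \<Longrightarrow> (1 - d) * norm f < f y \<Longrightarrow> norm (x - y) < e"
      by (rule uniformly_convex_near_norming[OF uc f]) blast
    obtain N where N: "inverse (real (Suc N)) < d" using reals_Archimedean[OF d(1)] by blast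
    have "(1 - d) * norm f < f (X n)" if "N \<le> n" for n
    proof -
      have "1 / real (Suc n) \<le> 1 / real (Suc N)" using that by (simp add: frac_le)
      then have "(1 - d) * norm f \<le> (1 - 1 / real (Suc n)) * norm f"
        using N by (intro mult_right_mono) (auto simp: inverse_eq_divide)
      then show ?thesis using X(2)[of n] by linarith
    qed
    then show "\<exists>M. \<forall>m\<ge>M. \<forall>n\<ge>M. norm (X m - X n) < e"
      using d(2) X(1) by blast
  qed
  then obtain v where v: "X \<longlonglongrightarrow> v" using Cauchy_convergent convergent_def by blast
  have "(\<lambda>n. norm (X n)) \<longlonglongrightarrow> norm v" using v by (rule tendsto_norm)
  then have v1: "norm v = 1" using X(1) by (simp add: LIMSEQ_const_iff)
  have "(\<lambda>n. (1 - inverse (real (Suc n))) * norm f) \<longlonglongrightarrow> (1 - 0) * norm f"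
    by (intro tendsto_intros LIMSEQ_inverse_real_of_nat)
  moreover have "(\<lambda>n. f (X n)) \<longlonglongrightarrow> f v" using v by (intro tendsto_intros)
  ultimately have "(1 - 0) * norm f \<le> f v"
    using X(2) by (intro LIMSEQ_le[of _ _ "\<lambda>n. f (X n)"]) (auto simp: inverse_eq_divide less_imp_le)
  then have "f v = norm f" using norm_blinfun[of f v] v1 by simp
  then have "norm v = 1 \<and> f v = norm f" using v1 by blast
  then have "norm (norming f) = 1 \<and> f (norming f) = norm f"
    unfolding norming_def by (rule someI)
  then show "norm (norming f) = 1" "f (norming f) = norm f" by auto
qed

lemma norming_unique:
  fixes f :: "'w::banach \<Rightarrow>\<^sub>L real"
  assumes uc: "uniformly_convex TYPE('w)" and f: "f \<noteq> 0" and v: "norm v = 1" "f v = norm f"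
  shows "norming f = v"
proof (rule ccontr)
  assume "norming f \<noteq> v"
  then have "0 < norm (norming f - v)" by simp
  then obtain d where d: "0 < d" "\<And>x y. norm x = 1 \<Longrightarrow> norm y = 1 \<Longrightarrow>
      (1 - d) * norm f < f x \<Longrightarrow> (1 - d) * norm f < f y \<Longrightarrow> norm (x - y) < norm (norming f - v)"
    by (rule uniformly_convex_near_norming[OF uc f]) blast
  have "(1 - d) * norm f < norm f" using d(1) f by (simp add: algebra_simps)
  then show False using d(2)[of "norming f" v] norming[OF uc f] v by simp
qed

lemma norming_minus:
  fixes f :: "'w::banach \<Rightarrow>\<^sub>L real"
  assumes "uniformly_convex TYPE('w)" "f \<noteq> 0"
  shows "norming (- f) = - norming f"
  using norming[OF assms] assms
  by (intro norming_unique) (auto simp: blinfun.minus_left blinfun.minus_right)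

lemma continuous_on_norming:
  fixes S :: "('w::banach \<Rightarrow>\<^sub>L real) set"
  assumes uc: "uniformly_convex TYPE('w)" and "0 \<notin> S"
  shows "continuous_on S norming"
  unfolding continuous_on_iff
proof (intro ballI allI impI)
  fix f and e :: real assume f: "f \<in> S" and e: "0 < e"
  then have "f \<noteq> 0" using assms(2) by auto
  then obtain d where d: "0 < d" "\<And>x y. norm x = 1 \<Longrightarrow> norm y = 1 \<Longrightarrow>
      (1 - d) * norm f < f x \<Longrightarrow> (1 - d) * norm f < f y \<Longrightarrow> norm (x - y) < e"
    using uniformly_convex_near_norming[OF uc _ e] by metis
  \<comment> \<open>The distance from \<open>g\<close> to \<open>f\<close> is lost twice, once in
    comparing the norms and once in comparing the values at \<open>norming g\<close>; hence the
    factor 1/2.\<close>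
  have "dist (norming g) (norming f) < e" if g: "g \<in> S" and gf: "dist g f < d * norm f / 2" for g
  proof -
    have "g \<noteq> 0" using g assms(2) by auto
    note ng = norming[OF uc this] and nf = norming[OF uc \<open>f \<noteq> 0\<close>]
    have "(g - f) (norming g) \<le> norm (g - f)"
      using norm_blinfun[of "g - f" "norming g"] ng(1) by simp
    then have "norm g - norm (g - f) \<le> f (norming g)"
      using ng(2) by (simp add: blinfun.diff_left)
    moreover have "norm f \<le> norm g + norm (g - f)"
      using norm_triangle_ineq2[of f g] by (simp add: norm_minus_commute)
    ultimately have "(1 - d) * norm f < f (norming g)"
      using gf by (simp add: dist_norm algebra_simps)
    moreover have "(1 - d) * norm f < f (norming f)"
      using d(1) nf(2) \<open>f \<noteq> 0\<close> by (simp add: algebra_simps)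
    ultimately show ?thesis using d(2) ng(1) nf(1) by (simp add: dist_norm)
  qed
  then show "\<exists>d>0. \<forall>g\<in>S. dist g f < d \<longrightarrow> dist (norming g) (norming f) < e"
    using d(1) \<open>f \<noteq> 0\<close> by (intro exI[of _ "d * norm f / 2"]) auto
qed

text \<open>Points of the \<open>C n\<close> staying \<open>e\<close> away from the intersection
  would accumulate at a point belonging to every \<open>C m\<close>.\<close>

lemma compact_decreasing_near_Inter:
  fixes C :: "nat \<Rightarrow> 'a::metric_space set"
  assumes C: "\<And>n. compact (C n)" and dec: "\<And>m n. m \<le> n \<Longrightarrow> C n \<subseteq> C m" and e: "0 < e"
  shows "\<exists>n. \<forall>c\<in>C n. \<exists>x\<in>(\<Inter>n. C n). dist c x < e"
proof (rule ccontr)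
  assume "\<not> ?thesis"
  then have "\<forall>n. \<exists>c\<in>C n. \<forall>x\<in>(\<Inter>n. C n). e \<le> dist c x" by (simp add: not_less)
  then obtain c where c: "\<And>n. c n \<in> C n" "\<And>n x. x \<in> (\<Inter>n. C n) \<Longrightarrow> e \<le> dist (c n) x"
    by metis
  have "\<forall>n. c n \<in> C 0" using c(1) dec by blast
  then obtain l r where l: "strict_mono r" "(c \<circ> r) \<longlonglongrightarrow> l"
    using C[of 0] unfolding compact_def by metis
  have "l \<in> C m" for m
  proof (rule Lim_in_closed_set[OF compact_imp_closed[OF C] _ _ l(2)])
    show "\<forall>\<^sub>F n in sequentially. (c \<circ> r) n \<in> C m"
      unfolding eventually_sequentially
      using c(1) dec seq_suble[OF l(1)] by (metis comp_apply le_trans subsetD)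
  qed simp
  then have "e \<le> dist ((c \<circ> r) n) l" for n using c(2) by simp
  moreover have "\<forall>\<^sub>F n in sequentially. dist ((c \<circ> r) n) l < e" using l(2) e by (rule tendstoD)
  ultimately show False by (simp add: eventually_sequentially flip: not_less)
qed

section \<open>Compact sets of index \<open>k\<close> in the sublevel set\<close>

theorem theorem1p3:
  fixes A B :: "'w::banach \<Rightarrow> 'w \<Rightarrow>\<^sub>L real" and p :: real and k :: nat
  assumes "uniformly_convex TYPE('w)"
    and "potential_operator A" and "potential_operator B"
    and "1 < p"
    and A1: "\<And>u t. A (t *\<^sub>R u) = (\<bar>t\<bar> powr (p - 2) * t) *\<^sub>R A u"
    and A2_le: "\<And>u v. blinfun_apply (A u) v \<le> norm u powr (p - 1) * norm v"
    and A2_eq: "\<And>u v. blinfun_apply (A u) v = norm u powr (p - 1) * norm v \<longleftrightarrow>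
        (\<exists>\<alpha> \<beta>::real. 0 \<le> \<alpha> \<and> 0 \<le> \<beta> \<and> \<not> (\<alpha> = 0 \<and> \<beta> = 0) \<and> \<alpha> *\<^sub>R u = \<beta> *\<^sub>R v)"
    and B1: "\<And>u t. B (t *\<^sub>R u) = (\<bar>t\<bar> powr (p - 2) * t) *\<^sub>R B u"
    and B2_pos: "\<And>u. u \<noteq> 0 \<Longrightarrow> 0 < blinfun_apply (B u) u"
    and B2_le: "\<And>u v. blinfun_apply (B u) v \<le>
        blinfun_apply (B u) u powr ((p - 1) / p) * blinfun_apply (B v) v powr (1 / p)"
    and B3: "compact_operator B"
    and "1 \<le> k"
    and "minimax_eigenvalue p A B k < minimax_eigenvalue p A B (Suc k)"
  shows "\<exists>C. C \<subseteq> Psi_sublevel p A B (minimax_eigenvalue p A B k) \<and>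
             compact C \<and> symmetric_set C \<and> cohomological_index C = enat k"
proof -
  note uc = assms(1) and p = \<open>1 < p\<close> and k = \<open>1 \<le> k\<close>
  \<comment> \<open>By \<open>(A_2)\<close> with \<open>v = u\<close>, \<open>I_p u = 1\<close>
    means that the p-th power of \<open>norm u\<close> is \<open>p\<close>; this gives the radius of
    the level sphere.\<close>
  define R where "R = p powr (1 / p)"
  have R: "R > 0" using p by (simp add: R_def)
  have A_self: "A u u = norm u powr (p - 1) * norm u" for u
    unfolding A2_eq by (intro exI[of _ 1]) simp
  have sphere: "level_manifold p A = sphere 0 R"
  proof -
    have "norm u powr (p - 1) * norm u = p \<longleftrightarrow> norm u = R" for u :: 'w
    proof (cases "u = 0")
      case False
      then have eq: "norm u powr (p - 1) * norm u = norm u powr p"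
        using powr_add[of "norm u" "p - 1" 1] by simp
      have "norm u = R" if "norm u powr p = p"
      proof -
        have "R = (norm u powr p) powr (1 / p)" unfolding R_def that ..
        then show ?thesis using p by (simp add: powr_powr)
      qed
      moreover have "R powr p = p" using p by (simp add: R_def powr_powr)
      ultimately show ?thesis unfolding eq by blast
    qed (use p R in auto)
    moreover have "1 / p * t = 1 \<longleftrightarrow> t = p" for t using p by (auto simp: field_simps)
    ultimately show ?thesis
      unfolding level_manifold_def homogeneous_potential_def A_self by (simp add: set_eq_iff)
  qed
  have B_cont: "continuous_on S B" for S
    using assms(3) continuous_on_subset unfolding potential_operator_def by blast
  have B_odd: "B (- u) = - B u" for u using B1[of "-1" u] by simp
  have B_ne: "B u \<noteq> 0" if "u \<noteq> 0" for u using B2_pos[OF that] by auto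
  define b where "b u = B u u" for u
  have b_cont: "continuous_on UNIV b"
    unfolding b_def by (intro continuous_intros B_cont)
  have b_odd: "b (- u) = b u" for u by (simp add: b_def B_odd blinfun.minus_left blinfun.minus_right)
  have Psi: "Psi p B u = p / b u" for u
    by (simp add: Psi_def homogeneous_potential_def b_def)

  \<comment> \<open>The compact sets obtained from superlevel sets of \<open>b\<close>\<close>
  define D where "D f = R *\<^sub>R norming f" for f :: "'w \<Rightarrow>\<^sub>L real"
  \<comment> \<open>Since \<open>\<Psi>\<close> is \<open>p / b\<close>, the sublevel set of
    \<open>\<mu> > 0\<close> is \<open>L (p / \<mu>)\<close>. The map \<open>T\<close> is split into
    \<open>B\<close> and \<open>D\<close> so that the closure is taken between them, where
    \<open>B\<close> has relatively compact image.\<close>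
  define L where "L a = {u \<in> sphere 0 R. a \<le> b u}" for a
  define K where "K a = closure (B ` L a)" for a

  have b_mono: "D (B u) \<in> sphere 0 R \<and> b u \<le> b (D (B u))" if u: "u \<in> sphere 0 R" for u
  proof -
    have u0: "u \<noteq> 0" using u R by auto
    note n = norming[OF uc B_ne[OF u0]]
    let ?v = "D (B u)"
    have v: "norm ?v = R" using n(1) R by (simp add: D_def)
    then have "?v \<noteq> 0" using R by auto
    then have bv: "0 < b ?v" and bu: "0 < b u" using B2_pos u0 by (auto simp: b_def)
    \<comment> \<open>The maximiser \<open>?v\<close> gives \<open>b u \<le> B u ?v\<close>. By
      \<open>(B_2)\<close> this is at most a product with the factor
      \<open>b u powr ((p - 1) / p)\<close>, which cancels and leaves
      \<open>b u \<le> b ?v\<close>.\<close>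
    have "b u \<le> norm (B u) * R" using norm_blinfun[of "B u" u] u by (simp add: b_def)
    also have "\<dots> = B u ?v" using n(2) by (simp add: D_def blinfun.scaleR_right)
    also have "\<dots> \<le> b u powr ((p - 1) / p) * b ?v powr (1 / p)"
      using B2_le[of u ?v] by (simp add: b_def)
    finally have "b u \<le> b u powr ((p - 1) / p) * b ?v powr (1 / p)" .
    moreover have "b u = b u powr ((p - 1) / p) * b u powr (1 / p)"
      using bu p by (simp add: add_divide_distrib[symmetric] flip: powr_add)
    ultimately have "b u powr ((p - 1) / p) * b u powr (1 / p)
        \<le> b u powr ((p - 1) / p) * b ?v powr (1 / p)" by simp
    then have "b u powr (1 / p) \<le> b ?v powr (1 / p)" using bu by simp
    then have "b u \<le> b ?v" using powr_less_mono2[of "1 / p" "b ?v" "b u"] bv p by (meson divide_pos_pos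
      le_less_linear less_imp_le not_less less_trans zero_less_one)
    then show ?thesis using v by simp
  qed
  have L_sym: "symmetric_set (L a)" for a
    by (rule symmetric_setI) (simp add: L_def b_odd)
  \<comment> \<open>Continuity of \<open>norming\<close> is available away from 0 only. The bound
    \<open>a \<le> b u\<close> keeps \<open>norm (B u)\<close> above \<open>a / R\<close>, and this
    survives the closure.\<close>
  have K0: "0 \<notin> K a" if a: "0 < a" for a
  proof -
    have "B ` L a \<subseteq> {f. a / R \<le> norm f}"
    proof clarify
      fix u assume "u \<in> L a"
      then have "a \<le> norm (B u) * R"
        using norm_blinfun[of "B u" u] by (auto simp: L_def b_def)
      then show "a / R \<le> norm (B u)" using R by (simp add: field_simps)
    qed
    moreover have "closed {f :: 'w \<Rightarrow>\<^sub>L real. a / R \<le> norm f}"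
      by (intro closed_Collect_le continuous_intros)
    ultimately have "K a \<subseteq> {f. a / R \<le> norm f}" unfolding K_def by (rule closure_minimal)
    moreover have "\<not> a / R \<le> norm (0 :: 'w \<Rightarrow>\<^sub>L real)" using divide_pos_pos[OF a R] by simp
    ultimately show ?thesis by blast
  qed
  have D_cont: "continuous_on (K a) D" if "0 < a" for a
    unfolding D_def using K0[OF that] by (intro continuous_intros continuous_on_norming[OF uc])
  have C_compact: "compact (D ` K a)" if "0 < a" for a
  proof (rule compact_continuous_image[OF D_cont[OF that]])
    have "bounded (L a)" unfolding bounded_iff by (intro exI[of _ R]) (simp add: L_def)
    then show "compact (K a)" using B3 by (simp add: compact_operator_def K_def)
  qed
  \<comment> \<open>\<open>b_mono\<close> makes \<open>L a\<close> invariant under \<open>D\<close>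
    after \<open>B\<close>; as \<open>L a\<close> is closed, continuity of \<open>D\<close> extends
    this to the closure.\<close>
  have C_sub: "D ` K a \<subseteq> L a" if a: "0 < a" for a
    unfolding K_def
  proof (rule image_closure_subset)
    show "continuous_on (closure (B ` L a)) D" using D_cont[OF a] by (simp add: K_def)
    have "L a = {u. norm u = R} \<inter> {u. a \<le> b u}" by (auto simp: L_def)
    moreover have "closed {u :: 'w. norm u = R}"
      by (intro closed_Collect_eq continuous_intros)
    moreover have "closed {u. a \<le> b u}"
      by (intro closed_Collect_le continuous_on_const b_cont)
    ultimately show "closed (L a)" by (simp add: closed_Int)
    show "D ` B ` L a \<subseteq> L a" using b_mono by (force simp: L_def)
  qed
  have C_sym: "symmetric_set (D ` K a)" if a: "0 < a" for a
  proof -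
    have "symmetric_set (K a)"
      unfolding K_def
      by (intro symmetric_set_closure symmetric_setI)
        (auto simp: symmetric_setD[OF L_sym] simp flip: B_odd)
    moreover have "D (- f) = - D f" if "f \<in> K a" for f
    proof -
      have "f \<noteq> 0" using K0[OF a] that by blast
      then show ?thesis by (simp add: D_def norming_minus[OF uc])
    qed
    ultimately show ?thesis
      by (intro symmetric_setI) (metis (no_types, lifting) imageE imageI symmetric_setD)
  qed
  have C0: "0 \<notin> D ` K a" if "0 < a" for a using C_sub[OF that] R by (auto simp: L_def)
  have C_mono: "D ` K a' \<subseteq> D ` K a" if "a \<le> a'" for a a'
    unfolding K_def using that by (intro image_mono closure_mono) (auto simp: L_def)

  \<comment> \<open>Finiteness of the minimax value and index of the compact sets\<close>
  have class_ne: "M \<noteq> {}" if "M \<in> index_class p A k" for M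
    using that k by (auto simp: index_class_def cohomological_index_def zero_enat_def)
  have Psi_pos: "0 \<le> Psi p B u" if "u \<in> sphere 0 R" for u
    using B2_pos[of u] that R p by (auto simp: Psi b_def intro!: divide_nonneg_nonneg less_imp_le)
  have "0 \<le> minimax_eigenvalue p A B k"
    unfolding minimax_eigenvalue_def
  proof (rule INF_greatest)
    fix M assume M: "M \<in> index_class p A k"
    then obtain u where u: "u \<in> M" using class_ne by blast
    then have "u \<in> sphere 0 R" using M by (auto simp: index_class_def sphere)
    then show "0 \<le> (SUP u\<in>M. ereal (Psi p B u))"
      using Psi_pos u by (intro SUP_upper2[of u]) auto
  qed
  \<comment> \<open>The strict inequality with the next value excludes infinity. Nonnegativity
    excludes minus infinity; it relies on \<open>class_ne\<close>, since the supremum over an empty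
    set would be minus infinity.\<close>
  then obtain l where l: "minimax_eigenvalue p A B k = ereal l" "0 \<le> l"
    using assms(13) by (cases "minimax_eigenvalue p A B k") auto

  \<comment> \<open>An almost optimal \<open>M\<close> need not be compact, but \<open>D\<close>
    after \<open>B\<close> maps it into a compact set, which has a classifying map of its
    own.\<close>
  have C_index: "enat k \<le> cohomological_index (D ` K (p / \<mu>))" if \<mu>: "l < \<mu>" for \<mu>
  proof -
    have "minimax_eigenvalue p A B k < ereal \<mu>" using l \<mu> by simp
    then obtain M where M: "M \<in> index_class p A k" "(SUP u\<in>M. ereal (Psi p B u)) < ereal \<mu>"
      unfolding minimax_eigenvalue_def by (auto simp: INF_less_iff)
    have M_sphere: "M \<subseteq> sphere 0 R" and M_sym: "symmetric_set M"
      and M_index: "enat k \<le> cohomological_index M"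
      using M(1) by (auto simp: index_class_def sphere)
    have M_ne: "u \<noteq> 0" if "u \<in> M" for u using that M_sphere R by auto
    have "M \<subseteq> L (p / \<mu>)"
    proof
      fix u assume u: "u \<in> M"
      then have "ereal (Psi p B u) < ereal \<mu>" using M(2) by (meson SUP_upper le_less_trans)
      then have "p / b u < \<mu>" by (simp add: Psi)
      moreover have "0 < b u" using B2_pos M_ne[OF u] by (simp add: b_def)
      moreover have "0 < \<mu>" using l \<mu> by simp
      ultimately show "u \<in> L (p / \<mu>)" using u M_sphere by (auto simp: L_def field_simps)
    qed
    then have BM: "B ` M \<subseteq> K (p / \<mu>)" unfolding K_def using closure_subset by blast
    have a: "0 < p / \<mu>" using l \<mu> p by simp
    show ?thesis
    proof (rule cohomological_index_mono[OF M_sym _ C_sym[OF a] C0[OF a] _ _ _ _ k M_index])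
      show "0 \<notin> M" using M_ne by blast
      show "\<exists>f. classifying_map (D ` K (p / \<mu>)) f"
        by (rule classifying_map_exists[OF C_compact[OF a] C_sym[OF a] C0[OF a]])
      show "continuous_on M (D \<circ> B)"
        by (rule continuous_on_compose[OF B_cont continuous_on_subset[OF D_cont[OF a] BM]])
      show "D \<circ> B \<in> M \<rightarrow> D ` K (p / \<mu>)" using BM by auto
      show "(D \<circ> B) (- x) = - (D \<circ> B) x" if "x \<in> M" for x
        using norming_minus[OF uc B_ne[OF M_ne[OF that]]] by (simp add: D_def B_odd)
    qed
  qed

  \<comment> \<open>The intersection of the compact sets\<close>
  define C where "C n = D ` K (p / (l + 1 / real (Suc n)))" for n
  \<comment> \<open>The summand \<open>1 / real (Suc n)\<close> keeps the threshold positive even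
    for \<open>l = 0\<close>.\<close>
  have a: "0 < p / (l + 1 / real (Suc n))" for n
    using l(2) p by (intro divide_pos_pos add_nonneg_pos) auto
  define E where "E = (\<Inter>n. C n)"
  have C_dec: "C n \<subseteq> C m" if "m \<le> n" for m n
    unfolding C_def
  proof (rule C_mono)
    have "1 / real (Suc n) \<le> 1 / real (Suc m)" using that by (simp add: frac_le)
    then show "p / (l + 1 / real (Suc m)) \<le> p / (l + 1 / real (Suc n))"
      using l(2) p by (intro divide_left_mono mult_pos_pos add_nonneg_pos) auto
  qed
  have Cn: "compact (C n)" "symmetric_set (C n)" "0 \<notin> C n" "enat k \<le> cohomological_index (C n)" for n
    using C_compact[OF a] C_sym[OF a] C0[OF a] C_index[of "l + 1 / real (Suc n)"] by (simp_all add: C_def)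
  have near: "\<exists>n. \<forall>c\<in>C n. \<exists>x\<in>E. dist c x < e" if "0 < e" for e
    unfolding E_def by (rule compact_decreasing_near_Inter[OF Cn(1) C_dec that])
  have "C n \<noteq> {}" for n using Cn(4)[of n] k by (auto simp: cohomological_index_def zero_enat_def)
  \<comment> \<open>Nearness to \<open>E\<close> of a nonempty \<open>C n\<close> already provides a
    point of \<open>E\<close>; the value 1 is arbitrary.\<close>
  then have E_ne: "E \<noteq> {}" using near[of 1] by force
  have E_compact: "compact E"
  proof -
    have "closed E" unfolding E_def by (intro closed_INT ballI compact_imp_closed Cn(1))
    then have "compact (C 0 \<inter> E)" by (rule compact_Int_closed[OF Cn(1)])
    moreover have "C 0 \<inter> E = E" by (auto simp: E_def)
    ultimately show ?thesis by simp
  qed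
  have E_sym: "symmetric_set E"
    by (rule symmetric_setI) (simp add: E_def symmetric_setD[OF Cn(2)])
  have E_index: "enat k \<le> cohomological_index E"
  proof (rule cohomological_index_tautness[OF E_compact E_sym _ E_ne k])
    show "0 \<notin> E" using Cn(3) by (auto simp: E_def)
    fix e :: real assume "0 < e"
    then show "\<exists>C. symmetric_set C \<and> 0 \<notin> C \<and> enat k \<le> cohomological_index C \<and>
        (\<forall>c\<in>C. \<exists>x\<in>E. dist c x < e)"
      using near Cn by meson
  qed
  have E_sub: "u \<in> sphere 0 R \<and> Psi p B u \<le> l" if "u \<in> E" for u
  proof -
    have u: "u \<in> L (p / (l + 1 / real (Suc n)))" for n
      using that C_sub[OF a, of n] unfolding E_def C_def by blast
    have b: "0 < b u" using u[of 0] a[of 0] by (simp add: L_def)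
    have "p / b u \<le> l + 1 / real (Suc n)" for n
    proof -
      have "0 < l + 1 / real (Suc n)" using l(2) by (intro add_nonneg_pos) auto
      then show ?thesis using u[of n] b by (simp add: L_def field_simps)
    qed
    moreover have "(\<lambda>n. l + 1 / real (Suc n)) \<longlonglongrightarrow> l + 0"
      using LIMSEQ_inverse_real_of_nat by (intro tendsto_intros) (simp add: inverse_eq_divide)
    ultimately have "p / b u \<le> l" by (intro LIMSEQ_le_const[of _ l]) auto
    then show ?thesis using u[of 0] by (simp add: Psi L_def)
  qed
  have "\<not> enat (Suc k) \<le> cohomological_index E"
  proof
    assume "enat (Suc k) \<le> cohomological_index E"
    then have "E \<in> index_class p A (Suc k)"
      using E_sub E_sym by (auto simp: index_class_def sphere)
    then have "minimax_eigenvalue p A B (Suc k) \<le> (SUP u\<in>E. ereal (Psi p B u))"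
      unfolding minimax_eigenvalue_def by (rule INF_lower)
    also have "\<dots> \<le> ereal l" using E_sub by (intro SUP_least) simp
    finally show False using assms(13) l(1) by simp
  qed
  then have "cohomological_index E = enat k"
    using E_index by (metis Suc_ile_eq order_le_imp_less_or_eq)
  moreover have "E \<subseteq> Psi_sublevel p A B (minimax_eigenvalue p A B k)"
    using E_sub by (auto simp: Psi_sublevel_def sphere l)
  ultimately show ?thesis using E_compact E_sym by blast
qed

end
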